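(* Let $G=(V,E,L)$ be a looped simple graph and let $d,t$ be positive integers with $d\geq 2$ and $d\geq 2t-1$. Then $$r^{lc}_d(G^{[d-t]})=(d-t)|V|+\min \mathrm{val}_t(\mathcal{X}),$$ where, when $d=2t-1$, the minimum is taken over all $T\subseteq E\cup L$ and all non-intersecting admissible covers $\mathcal{X}=\{X_0,X_1,\ldots,X_k\}$ of $G-T$, and, when $d\geq 2t$, the minimum is taken over all $T\subseteq E\cup L$ and all covers $\mathcal{X}=\{X_0\}$ (i.e. $k=0$) of $G-T$.
   Context: A looped simple graph $G=(V,E,L)$ has vertex set $V$, simple edges $E$ (no multiple edges) and loops $L$ (possibly several per vertex). $G^{[s]}$ is obtained from $G$ by adding $s$ new loops at every vertex. For $T\subseteq E\cup L$, $G-T$ is the graph $(V,E\setminus T,L\setminus T)$. A family $\mathcal{X}=\{X_0,X_1,\ldots,X_k\}$ of subsets of $V$ is a cover of a looped simple graph if every edge and every loop of it is induced by (has all its end-vertices in) some member of $\mathcal{X}$. A cover $\mathcal{X}=\{X_0,\ldots,X_k\}$ of $G-T$ is admissible if every loop of $G-T$ is induced by $X_0$, every loop in $T$ is at a vertex of $V\setminus X_0$, and $|X_j|=2t+1$ for all $1\leq j\leq k$ ($X_0$ may be empty). It is non-intersecting if $X_j\cap X_l=\emptyset$ for all distinct $j,l$. The value of the cover $\mathcal{X}$ of $G-T$ is $\mathrm{val}_t(\mathcal{X})=|T|+t|X_0|+\sum_{j=1}^k(t|X_j|-1)$. Rigidity matroid: for a linearly constrained framework $(G,p,q)$ with $p:V\to\mathbb{R}^d$,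 $q:L\to\mathbb{R}^d$, the rigidity matrix $R_d(G,p,q)$ has a row for each edge $v_iv_j$ with $p(v_i)-p(v_j)$ in the $d$ columns of $v_i$, $p(v_j)-p(v_i)$ in those of $v_j$, zeros elsewhere, and a row for each loop $e$ at $v_i$ with $q(e)$ in the columns of $v_i$, zeros elsewhere. $\mathcal{R}^{lc}_d(G)$ is the matroid on $E\cup L$ whose independent sets are those whose rows are linearly independent for a generic $(p,q)$ (coordinates algebraically independent over $\mathbb{Q}$); $r^{lc}_d(G)$ denotes its rank (of the full set $E\cup L$). *)

theory Defs
  imports "HOL-Analysis.Analysis" "HOL-Analysis.Finite_Function_Topology"
begin

section \<open>Looped simple graphs\<close>

text \<open>
  Simple edges are two-element vertex sets. Loops have their own names, so that a vertex may carry
  several of them; \<open>loop_at\<close> maps a loop to the vertex where it is attached.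
\<close>

record ('v, 'l) looped_graph =
  verts :: "'v set"
  edges :: "'v set set"
  loops :: "'l set"
  loop_at :: "'l \<Rightarrow> 'v"

definition looped_simple_graph :: "('v, 'l) looped_graph \<Rightarrow> bool" where
  "looped_simple_graph G \<longleftrightarrow>
     finite (verts G) \<and> finite (loops G) \<and>
     (\<forall>e\<in>edges G. e \<subseteq> verts G \<and> card e = 2) \<and>
     (\<forall>l\<in>loops G. loop_at G l \<in> verts G)"

text \<open>The set $E\cup L$, as a disjoint union.\<close>

definition ground :: "('v, 'l) looped_graph \<Rightarrow> ('v set + 'l) set" where
  "ground G = edges G <+> loops G"

definition add_loops :: "nat \<Rightarrow> ('v, 'l) looped_graph \<Rightarrow> ('v, 'l + 'v \<times> nat) looped_graph" where
  "add_loops s G =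
     \<lparr>verts = verts G, edges = edges G, loops = loops G <+> (verts G \<times> {..<s}),
      loop_at = case_sum (loop_at G) fst\<rparr>"

definition remove :: "('v, 'l) looped_graph \<Rightarrow> ('v set + 'l) set \<Rightarrow> ('v, 'l) looped_graph" where
  "remove G T =
     \<lparr>verts = verts G, edges = edges G - {e. Inl e \<in> T}, loops = loops G - {l. Inr l \<in> T},
      loop_at = loop_at G\<rparr>"


section \<open>Generic frameworks and the rigidity matroid\<close>

text \<open>
  An element of \<open>('i \<Rightarrow>\<^sub>0 nat) \<Rightarrow>\<^sub>0 rat\<close> is a polynomial with rational coefficients in variables
  indexed by \<open>'i\<close>: it maps monomials, given by their exponents, to coefficients.
\<close>

definition poly_value :: "('i \<Rightarrow> real) \<Rightarrow> (('i \<Rightarrow>\<^sub>0 nat) \<Rightarrow>\<^sub>0 rat) \<Rightarrow> real" where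
  "poly_value x P =
     (\<Sum>m\<in>Poly_Mapping.keys P.
        of_rat (Poly_Mapping.lookup P m) * (\<Prod>i\<in>Poly_Mapping.keys m. x i ^ Poly_Mapping.lookup m i))"

definition alg_independent_on :: "'i set \<Rightarrow> ('i \<Rightarrow> real) \<Rightarrow> bool" where
  "alg_independent_on I x \<longleftrightarrow>
     (\<forall>P. P \<noteq> 0 \<longrightarrow> (\<forall>m\<in>Poly_Mapping.keys P. Poly_Mapping.keys m \<subseteq> I) \<longrightarrow> poly_value x P \<noteq> 0)"

definition generic ::
    "('v, 'l) looped_graph \<Rightarrow> ('v \<Rightarrow> real^'d) \<Rightarrow> ('l \<Rightarrow> real^'d) \<Rightarrow> bool" where
  "generic G p q \<longleftrightarrow>
     alg_independent_on ((verts G <+> loops G) \<times> UNIV) (\<lambda>(a, i). case_sum p q a $ i)"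

text \<open>
  The rows of the rigidity matrix. A row, with its columns grouped in blocks of $d$ according to the
  vertices, is a finitely supported function from vertices to $\mathbb{R}^d$. In the row of an edge
  $\{u,v\}$ the double sum runs over all ordered pairs of end-vertices; the diagonal terms vanish, and
  what remains is $p(u)-p(v)$ in block $u$ and $p(v)-p(u)$ in block $v$
  (see \<open>rigidity_row_edge\<close>).
\<close>

definition rigidity_row ::
    "('v, 'l) looped_graph \<Rightarrow> ('v \<Rightarrow> real^'d) \<Rightarrow> ('l \<Rightarrow> real^'d) \<Rightarrow> 'v set + 'l \<Rightarrow> 'v \<Rightarrow>\<^sub>0 real^'d" where
  "rigidity_row G p q x =
     (case x of
        Inl e \<Rightarrow> (\<Sum>u\<in>e. \<Sum>v\<in>e. Poly_Mapping.single u (p u - p v))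
      | Inr l \<Rightarrow> Poly_Mapping.single (loop_at G l) (q l))"

lemma rigidity_row_edge:
  assumes "u \<noteq> v"
  shows "rigidity_row G p q (Inl {u, v}) =
           Poly_Mapping.single u (p u - p v) + Poly_Mapping.single v (p v - p u)"
  using assms by (simp add: rigidity_row_def)

text \<open>
  The dimension $d$ is the cardinality of the index type \<open>'d\<close>. Injectivity is required because the
  family of rows, rather than the set of rows, is to be linearly independent.
\<close>

definition lc_independent ::
    "'d::finite itself \<Rightarrow> ('v, 'l) looped_graph \<Rightarrow> ('v set + 'l) set \<Rightarrow> bool" where
  "lc_independent d G F \<longleftrightarrow>
     F \<subseteq> ground G \<and>
     (\<exists>(p :: 'v \<Rightarrow> real^'d) (q :: 'l \<Rightarrow> real^'d).
        generic G p q \<and> inj_on (rigidity_row G p q) F \<and> independent (rigidity_row G p q ` F))"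

definition lc_rank :: "'d::finite itself \<Rightarrow> ('v, 'l) looped_graph \<Rightarrow> nat" where
  "lc_rank d G = Max {card F | F. lc_independent d G F}"


section \<open>Covers\<close>

text \<open>A family $\{X_0,\ldots,X_k\}$ is given by \<open>k\<close> and the values of \<open>X\<close> on \<open>{..k}\<close>.\<close>

definition is_cover :: "('v, 'l) looped_graph \<Rightarrow> nat \<Rightarrow> (nat \<Rightarrow> 'v set) \<Rightarrow> bool" where
  "is_cover G k X \<longleftrightarrow>
     (\<forall>j\<le>k. X j \<subseteq> verts G) \<and>
     (\<forall>e\<in>edges G. \<exists>j\<le>k. e \<subseteq> X j) \<and>
     (\<forall>l\<in>loops G. \<exists>j\<le>k. loop_at G l \<in> X j)"

definition admissible_cover ::
    "nat \<Rightarrow> ('v, 'l) looped_graph \<Rightarrow> ('v set + 'l) set \<Rightarrow> nat \<Rightarrow> (nat \<Rightarrow> 'v set) \<Rightarrow> bool" where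
  "admissible_cover t G T k X \<longleftrightarrow>
     is_cover (remove G T) k X \<and>
     (\<forall>l\<in>loops (remove G T). loop_at G l \<in> X 0) \<and>
     (\<forall>l. Inr l \<in> T \<longrightarrow> loop_at G l \<in> verts G - X 0) \<and>
     (\<forall>j\<in>{1..k}. card (X j) = 2 * t + 1)"

definition non_intersecting :: "nat \<Rightarrow> (nat \<Rightarrow> 'v set) \<Rightarrow> bool" where
  "non_intersecting k X \<longleftrightarrow> (\<forall>j\<le>k. \<forall>l\<le>k. j \<noteq> l \<longrightarrow> X j \<inter> X l = {})"

definition cover_value :: "nat \<Rightarrow> ('v set + 'l) set \<Rightarrow> nat \<Rightarrow> (nat \<Rightarrow> 'v set) \<Rightarrow> int" where
  "cover_value t T k X =
     int (card T) + int t * int (card (X 0)) + (\<Sum>j=1..k. int t * int (card (X j)) - 1)"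

end

theory Submission
  imports Defs "HOL-Computational_Algebra.Polynomial"
begin

text \<open>
  The rank is bounded above by counting rows, since an affine dependence among \<open>d + 2\<close> points is a
  self-stress of their complete graph. For the converse, a maximal sparse set of edges and loops (without \<open>K\<^bsub>2t+1\<^esub>\<close> if
  \<open>d = 2 t - 1\<close>) has the size of a cover, by uncrossing tight sets, and it can be oriented with indegree at most
  \<open>t\<close> everywhere. It then has to be realised with independent rows in some position; a generic
  position inherits the independence.

  If some vertex \<open>v\<close> has at most \<open>d\<close> edges, place it in general position, let the span of its loops contain the
  directions of its outgoing edges and be complementary to those of the incoming ones, and pin \<open>v\<close>: in
  a linear dependence the incoming edges at \<open>v\<close> get coefficient \<open>0\<close>, and the outgoing ones are left as
  constraints on the other vertices. Counting degrees, this gets stuck only if \<open>d = 2 t - 1\<close> and the remaining graph is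
  \<open>2 t\<close>-regular with no edge to a pinned vertex. Then \<open>v\<close> is removed by the inverse of a 1-extension: it has
  non-adjacent neighbours \<open>a\<close>, \<open>b\<close>, and putting \<open>v\<close> at the midpoint of \<open>a\<close> and \<open>b\<close> makes the edges
  \<open>v a\<close>, \<open>v b\<close> act as an edge \<open>a b\<close>. Since pinning \<open>v\<close> also works for the smaller graph, exchange
  supplies the loops at \<open>v\<close>.
\<close>

section \<open>Linearly independent families\<close>

text \<open>The sparsity bound \<open>t * card X\<close> is what remains of the \<open>d\<close>
  columns per vertex once \<open>d - t\<close> of them are reserved for added loops. The obstacle is
  the complete graph on \<open>2 t + 1\<close> vertices: its \<open>t * (2 t + 1)\<close> edges meet
  the bound exactly, but for \<open>d = 2 t - 1\<close> it has \<open>d + 2\<close> vertices and is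
  dependent. Hence the size \<open>2 t + 1\<close> of the extra cover members and the loss of 1 for
  each in the value. For \<open>d >= 2 t\<close> it is a simplex in general position and does no
  harm. The construction meets the same threshold: a vertex with \<open>2 t = d + 1\<close> edges
  cannot have independent edge directions. The requirements on a position (an independent star at a
  vertex, an independent smaller framework) are easily met separately, at unrelated positions. They
  are combined on the line joining two positions: rows depend linearly on the position, so each
  independence that holds somewhere on the line fails only finitely often there. The midpoint
  condition is affine, so a line joining two positions that satisfy it stays inside this special
  family.\<close>

definition indep_on :: "'w set \<Rightarrow> 'r set \<Rightarrow> ('r \<Rightarrow> 'w \<Rightarrow> 'a::real_vector) \<Rightarrow> bool" where
  "indep_on U F f \<longleftrightarrow> (\<forall>c. (\<forall>w\<in>U. (\<Sum>r\<in>F. c r *\<^sub>R f r w) = 0) \<longrightarrow> (\<forall>r\<in>F. c r = 0))"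

lemma indep_onI:
  assumes "\<And>c r. (\<And>w. w \<in> U \<Longrightarrow> (\<Sum>r\<in>F. c r *\<^sub>R f r w) = 0) \<Longrightarrow> r \<in> F \<Longrightarrow> c r = 0"
  shows "indep_on U F f"
  using assms unfolding indep_on_def by blast

lemma indep_onD:
  assumes "indep_on U F f" "\<And>w. w \<in> U \<Longrightarrow> (\<Sum>r\<in>F. c r *\<^sub>R f r w) = 0" "r \<in> F"
  shows "c r = 0"
  using assms unfolding indep_on_def by blast

lemma indep_on_mono:
  assumes "indep_on U F f" "F' \<subseteq> F" "finite F"
  shows "indep_on U F' f"
proof (rule indep_onI)
  fix c r assume h: "\<And>w. w \<in> U \<Longrightarrow> (\<Sum>r\<in>F'. c r *\<^sub>R f r w) = 0" "r \<in> F'"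
  have "(if r \<in> F' then c r else 0) = 0"
  proof (rule indep_onD[OF assms(1), of "\<lambda>r. if r \<in> F' then c r else 0"])
    fix w assume "w \<in> U"
    have "(\<Sum>r\<in>F. (if r \<in> F' then c r else 0) *\<^sub>R f r w) = (\<Sum>r\<in>F'. c r *\<^sub>R f r w)"
      using assms(2,3) by (intro sum.mono_neutral_cong_right) auto
    then show "(\<Sum>r\<in>F. (if r \<in> F' then c r else 0) *\<^sub>R f r w) = 0"
      using h(1)[OF \<open>w \<in> U\<close>] by simp
  qed (use h(2) assms(2) in auto)
  with h(2) show "c r = 0" by simp
qed

lemma indep_on_cong:
  assumes "\<And>r w. r \<in> F \<Longrightarrow> w \<in> U \<Longrightarrow> f r w = g r w"
  shows "indep_on U F f \<longleftrightarrow> indep_on U F g"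
proof -
  have "(\<Sum>r\<in>F. c r *\<^sub>R f r w) = (\<Sum>r\<in>F. c r *\<^sub>R g r w)" if "w \<in> U" for c w
    using assms that by (intro sum.cong) auto
  then show ?thesis unfolding indep_on_def by simp
qed

lemma indep_on_reindex:
  assumes "inj_on h F"
  shows "indep_on U (h ` F) f \<longleftrightarrow> indep_on U F (\<lambda>r. f (h r))"
proof
  assume L: "indep_on U (h ` F) f"
  show "indep_on U F (\<lambda>r. f (h r))"
  proof (rule indep_onI)
    fix c r assume h: "\<And>w. w \<in> U \<Longrightarrow> (\<Sum>r\<in>F. c r *\<^sub>R f (h r) w) = 0" "r \<in> F"
    have "c (the_inv_into F h (h r)) = 0"
    proof (rule indep_onD[OF L])
      fix w assume "w \<in> U"
      show "(\<Sum>r\<in>h ` F. c (the_inv_into F h r) *\<^sub>R f r w) = 0"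
        using h(1)[OF \<open>w \<in> U\<close>] by (simp add: sum.reindex[OF assms] the_inv_into_f_f[OF assms])
    qed (use h(2) in auto)
    then show "c r = 0" by (simp add: the_inv_into_f_f[OF assms h(2)])
  qed
next
  assume R: "indep_on U F (\<lambda>r. f (h r))"
  show "indep_on U (h ` F) f"
  proof (rule indep_onI)
    fix c r assume h: "\<And>w. w \<in> U \<Longrightarrow> (\<Sum>r\<in>h ` F. c r *\<^sub>R f r w) = 0" "r \<in> h ` F"
    then obtain r' where r': "r' \<in> F" "r = h r'" by auto
    have "c (h r') = 0"
      by (rule indep_onD[OF R, of "\<lambda>r. c (h r)"]) (use h(1) r' in \<open>auto simp: sum.reindex[OF assms]\<close>)
    then show "c r = 0" using r' by simp
  qed
qed

text \<open>Elimination without division: a nonzero entry serves as pivot, and cross-multiplying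
  with it keeps all entries polynomial. Independence can then fail only at roots of pivots. No
  minors occur, so \<open>U\<close> may be infinite.\<close>

lemma finite_dependent_poly:
  fixes f :: "'r \<Rightarrow> 'w \<Rightarrow> real poly"
  assumes "finite F" "indep_on U F (\<lambda>r w. poly (f r w) s\<^sub>0)"
  shows "finite {s. \<not> indep_on U F (\<lambda>r w. poly (f r w) s)}"
  using assms
proof (induction F arbitrary: f rule: finite_induct)
  case empty
  then show ?case by (simp add: indep_on_def)
next
  case (insert r\<^sub>0 F)
  have "\<exists>w\<^sub>0\<in>U. poly (f r\<^sub>0 w\<^sub>0) s\<^sub>0 \<noteq> 0"
  proof (rule ccontr)
    assume "\<not> ?thesis"
    then have "(\<lambda>r. if r = r\<^sub>0 then 1 else 0 :: real) r\<^sub>0 = 0"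
      by (intro indep_onD[OF insert.prems, of "\<lambda>r. if r = r\<^sub>0 then 1 else 0" r\<^sub>0])
        (use insert.hyps in \<open>auto intro!: sum.neutral\<close>)
    then show False by simp
  qed
  then obtain w\<^sub>0 where w\<^sub>0: "w\<^sub>0 \<in> U" "poly (f r\<^sub>0 w\<^sub>0) s\<^sub>0 \<noteq> 0" by blast
  define h where "h = f r\<^sub>0 w\<^sub>0"
  \<comment> \<open>The pivot times row \<open>r\<close> minus a multiple of row
    \<open>r\<^sub>0\<close>, which clears column \<open>w\<^sub>0\<close>.\<close>
  define g where "g r w = h * f r w - f r w\<^sub>0 * f r\<^sub>0 w" for r w
  have expand: "(\<Sum>r\<in>F. c r *\<^sub>R poly (g r w) s) =
      poly h s * (\<Sum>r\<in>F. c r * poly (f r w) s) - (\<Sum>r\<in>F. c r * poly (f r w\<^sub>0) s) * poly (f r\<^sub>0 w) s"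
    for c :: "'r \<Rightarrow> real" and w s
    by (simp add: g_def sum_subtractf right_diff_distrib sum_distrib_left sum_distrib_right mult_ac)
  have "indep_on U F (\<lambda>r w. poly (g r w) s\<^sub>0)"
  proof (rule indep_onI)
    fix c r
    assume c: "\<And>w. w \<in> U \<Longrightarrow> (\<Sum>r\<in>F. c r *\<^sub>R poly (g r w) s\<^sub>0) = 0" and r: "r \<in> F"
    \<comment> \<open>The coefficient of \<open>r\<^sub>0\<close> is chosen so that this combination
      of the original rows equals the given combination of the reduced ones.\<close>
    define c' where "c' x = (if x = r\<^sub>0 then - (\<Sum>r\<in>F. c r * poly (f r w\<^sub>0) s\<^sub>0) else poly h s\<^sub>0 * c x)" for x
    have c'F: "(\<Sum>r\<in>F. c' r * poly (f r w) s\<^sub>0) = poly h s\<^sub>0 * (\<Sum>r\<in>F. c r * poly (f r w) s\<^sub>0)" for w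
      unfolding sum_distrib_left by (intro sum.cong) (use insert.hyps in \<open>auto simp: c'_def\<close>)
    have "c' r = 0"
    proof (rule indep_onD[OF insert.prems])
      fix w assume "w \<in> U"
      then show "(\<Sum>r\<in>insert r\<^sub>0 F. c' r *\<^sub>R poly (f r w) s\<^sub>0) = 0"
        using c[of w] insert.hyps unfolding expand by (simp add: c'F) (simp add: c'_def)
    qed (use r in auto)
    then show "c r = 0" using r insert.hyps w\<^sub>0 by (auto simp: c'_def h_def split: if_splits)
  qed
  then have fin: "finite {s. \<not> indep_on U F (\<lambda>r w. poly (g r w) s)}" by (rule insert.IH)
  have "{s. \<not> indep_on U (insert r\<^sub>0 F) (\<lambda>r w. poly (f r w) s)} \<subseteq>
      {s. \<not> indep_on U F (\<lambda>r w. poly (g r w) s)} \<union> {s. poly h s = 0}"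
  proof (rule ccontr)
    assume "\<not> ?thesis"
    then obtain s where s: "\<not> indep_on U (insert r\<^sub>0 F) (\<lambda>r w. poly (f r w) s)"
        "indep_on U F (\<lambda>r w. poly (g r w) s)" "poly h s \<noteq> 0" by blast
    have "indep_on U (insert r\<^sub>0 F) (\<lambda>r w. poly (f r w) s)"
    proof (rule indep_onI)
      fix c r
      assume c: "\<And>w. w \<in> U \<Longrightarrow> (\<Sum>r\<in>insert r\<^sub>0 F. c r *\<^sub>R poly (f r w) s) = 0"
        and r: "r \<in> insert r\<^sub>0 F"
      have c': "c r\<^sub>0 * poly (f r\<^sub>0 w) s + (\<Sum>r\<in>F. c r * poly (f r w) s) = 0" if "w \<in> U" for w
        using c[OF that] insert.hyps by simp
      have z: "c r = 0" if "r \<in> F" for r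
      proof (rule indep_onD[OF s(2) _ that])
        fix w assume w: "w \<in> U"
        have e1: "(\<Sum>r\<in>F. c r * poly (f r w) s) = - c r\<^sub>0 * poly (f r\<^sub>0 w) s" using c'[OF w] by simp
        have e2: "(\<Sum>r\<in>F. c r * poly (f r w\<^sub>0) s) = - c r\<^sub>0 * poly h s"
          using c'[OF w\<^sub>0(1)] by (simp add: h_def)
        show "(\<Sum>r\<in>F. c r *\<^sub>R poly (g r w) s) = 0" unfolding expand e1 e2 by simp
      qed
      moreover have "c r\<^sub>0 = 0" using c'[OF w\<^sub>0(1)] z s(3) by (simp add: h_def)
      ultimately show "c r = 0" using r by blast
    qed
    with s(1) show False by simp
  qed
  moreover have "h \<noteq> 0" using w\<^sub>0 by (auto simp: h_def)
  then have "finite {s. poly h s = 0}" by (rule poly_roots_finite)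
  ultimately show ?case using fin by (meson finite_UnI finite_subset)
qed

lemma indep_on_coordinates:
  fixes f :: "'r \<Rightarrow> 'w \<Rightarrow> real^'d"
  shows "indep_on U F f \<longleftrightarrow> indep_on (U \<times> UNIV) F (\<lambda>r x. f r (fst x) $ snd x)"
  unfolding indep_on_def by (auto simp: vec_eq_iff)

lemma finite_dependent_on_line:
  fixes f g :: "'r \<Rightarrow> 'w \<Rightarrow> real^'d"
  assumes "finite F" "indep_on U F f"
  shows "finite {s. \<not> indep_on U F (\<lambda>r w. f r w + s *\<^sub>R g r w)}"
proof -
  have "finite {s. \<not> indep_on (U \<times> UNIV) F
      (\<lambda>r x. poly [: f r (fst x) $ snd x, g r (fst x) $ snd x :] s)}"
    by (rule finite_dependent_poly[where s\<^sub>0 = 0])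
      (use assms in \<open>simp_all add: indep_on_coordinates\<close>)
  then show ?thesis by (simp add: indep_on_coordinates)
qed

text \<open>Each family is known to be independent at one end only, but fails at finitely many
  points of the line; some point is good for both.\<close>

lemma indep_on_common_point:
  fixes f\<^sub>0 f\<^sub>1 :: "'r \<Rightarrow> 'w \<Rightarrow> real^'d" and g\<^sub>0 g\<^sub>1 :: "'r' \<Rightarrow> 'w' \<Rightarrow> real^'d'"
  assumes "finite F" "indep_on U F f\<^sub>0" "finite H" "indep_on W H g\<^sub>1"
  obtains s where "indep_on U F (\<lambda>r w. f\<^sub>0 r w + s *\<^sub>R (f\<^sub>1 r w - f\<^sub>0 r w))"
    and "indep_on W H (\<lambda>r w. g\<^sub>0 r w + s *\<^sub>R (g\<^sub>1 r w - g\<^sub>0 r w))"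
proof -
  let ?A = "{s. \<not> indep_on U F (\<lambda>r w. f\<^sub>0 r w + s *\<^sub>R (f\<^sub>1 r w - f\<^sub>0 r w))}"
  \<comment> \<open>The second family is known at \<open>s = 1\<close>, so its line is run backwards
    from there.\<close>
  let ?B = "{s. \<not> indep_on W H (\<lambda>r w. g\<^sub>1 r w + s *\<^sub>R (g\<^sub>0 r w - g\<^sub>1 r w))}"
  have "finite (?A \<union> (\<lambda>s. 1 - s) ` ?B)"
    using assms by (simp add: finite_dependent_on_line)
  then obtain s where s: "s \<notin> ?A \<union> (\<lambda>s. 1 - s) ` ?B"
    using ex_new_if_finite infinite_UNIV_char_0 by blast
  then have "1 - s \<notin> ?B" by (force simp: image_iff)
  moreover have "g\<^sub>1 r w + (1 - s) *\<^sub>R (g\<^sub>0 r w - g\<^sub>1 r w) = g\<^sub>0 r w + s *\<^sub>R (g\<^sub>1 r w - g\<^sub>0 r w)" for r w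
    by (simp add: algebra_simps)
  ultimately show ?thesis using that[of s] s by simp
qed


section \<open>Indexed families versus sets of vectors, and exchange\<close>

lemma lookup_scaleR: "Poly_Mapping.lookup (c *\<^sub>R f) w = c *\<^sub>R Poly_Mapping.lookup f w"
proof -
  have "finite {w. c *\<^sub>R Poly_Mapping.lookup f w \<noteq> 0}"
    by (rule finite_subset[OF _ finite_lookup[of f]]) auto
  then show ?thesis by (simp add: scaleR_poly_mapping_def)
qed

lemma inj_on_and_independent_iff:
  fixes f :: "'r \<Rightarrow> 'a::real_vector"
  assumes "finite F"
  shows "inj_on f F \<and> independent (f ` F) \<longleftrightarrow> (\<forall>c. (\<Sum>r\<in>F. c r *\<^sub>R f r) = 0 \<longrightarrow> (\<forall>r\<in>F. c r = 0))"
proof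
  assume h: "inj_on f F \<and> independent (f ` F)"
  show "\<forall>c. (\<Sum>r\<in>F. c r *\<^sub>R f r) = 0 \<longrightarrow> (\<forall>r\<in>F. c r = 0)"
  proof (intro allI impI ballI)
    fix c r assume c: "(\<Sum>r\<in>F. c r *\<^sub>R f r) = 0" and r: "r \<in> F"
    have "(\<Sum>x\<in>f ` F. c (the_inv_into F f x) *\<^sub>R x) = 0"
      using c h by (simp add: sum.reindex the_inv_into_f_f)
    then have "c (the_inv_into F f (f r)) = 0"
      using h assms r independentD[of "f ` F" "f ` F" "\<lambda>x. c (the_inv_into F f x)" "f r"] by auto
    then show "c r = 0" using h r by (simp add: the_inv_into_f_f)
  qed
next
  assume h: "\<forall>c. (\<Sum>r\<in>F. c r *\<^sub>R f r) = 0 \<longrightarrow> (\<forall>r\<in>F. c r = 0)"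
  have inj: "inj_on f F"
  proof (rule inj_onI, rule ccontr)
    fix x y assume xy: "x \<in> F" "y \<in> F" "f x = f y" "x \<noteq> y"
    define c where "c r = (if r = x then 1 else 0) - (if r = y then 1 else 0 :: real)" for r
    have "(\<Sum>r\<in>F. c r *\<^sub>R f r) = (\<Sum>r\<in>F. if r = x then f r else 0) - (\<Sum>r\<in>F. if r = y then f r else 0)"
      unfolding sum_subtractf[symmetric] by (intro sum.cong) (auto simp: c_def)
    also have "\<dots> = 0" using xy assms by simp
    finally have "c x = 0" using h xy by blast
    then show False using xy by (simp add: c_def)
  qed
  moreover have "independent (f ` F)"
  proof (rule independent_if_scalars_zero)
    fix c x assume c: "(\<Sum>x\<in>f ` F. c x *\<^sub>R x) = 0" and x: "x \<in> f ` F"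
    from c have "(\<Sum>r\<in>F. c (f r) *\<^sub>R f r) = 0" using inj by (simp add: sum.reindex)
    then have "\<forall>r\<in>F. c (f r) = 0" using h[rule_format, of "\<lambda>r. c (f r)"] by blast
    with x show "c x = 0" by auto
  qed (use assms in simp)
  ultimately show "inj_on f F \<and> independent (f ` F)" by simp
qed

lemma indep_on_Poly_Mapping:
  fixes f :: "'r \<Rightarrow> 'w \<Rightarrow>\<^sub>0 'a::real_vector"
  assumes "finite F" "\<And>r. r \<in> F \<Longrightarrow> Poly_Mapping.keys (f r) \<subseteq> U"
  shows "indep_on U F (\<lambda>r. Poly_Mapping.lookup (f r)) \<longleftrightarrow> inj_on f F \<and> independent (f ` F)"
proof -
  have lk: "Poly_Mapping.lookup (\<Sum>r\<in>F. c r *\<^sub>R f r) w = (\<Sum>r\<in>F. c r *\<^sub>R Poly_Mapping.lookup (f r) w)"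
    for c w by (simp add: lookup_sum lookup_scaleR)
  have "(\<Sum>r\<in>F. c r *\<^sub>R f r) = 0 \<longleftrightarrow>
      (\<forall>w\<in>U. (\<Sum>r\<in>F. c r *\<^sub>R Poly_Mapping.lookup (f r) w) = 0)" for c
  proof
    assume *: "\<forall>w\<in>U. (\<Sum>r\<in>F. c r *\<^sub>R Poly_Mapping.lookup (f r) w) = 0"
    have "(\<Sum>r\<in>F. c r *\<^sub>R Poly_Mapping.lookup (f r) w) = 0" if "w \<notin> U" for w
    proof (rule sum.neutral, rule ballI)
      fix r assume "r \<in> F"
      then have "Poly_Mapping.lookup (f r) w = 0" using assms(2)[of r] that by (metis in_keys_iff subsetD)
      then show "c r *\<^sub>R Poly_Mapping.lookup (f r) w = 0" by simp
    qed
    with * show "(\<Sum>r\<in>F. c r *\<^sub>R f r) = 0"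
      by (intro poly_mapping_eqI) (metis lk lookup_zero)
  qed (simp add: lk[symmetric])
  then show ?thesis unfolding inj_on_and_independent_iff[OF assms(1)] indep_on_def by simp
qed

text \<open>Steinitz exchange for indices instead of vectors: different indices may carry the same
  vector, so the new indices are an injective choice of preimages of the new basis vectors.\<close>

lemma indep_on_augment:
  fixes f :: "'r \<Rightarrow> 'w \<Rightarrow> 'a::real_vector"
  assumes "finite U" "finite F" "finite B" "indep_on U F f" "indep_on U B f"
  obtains I where "F \<subseteq> I" "I \<subseteq> F \<union> B" "indep_on U I f" "card B \<le> card I"
proof -
  define g where "g r = (\<Sum>w\<in>U. Poly_Mapping.single w (f r w))" for r
  have lg: "Poly_Mapping.lookup (g r) w = (if w \<in> U then f r w else 0)" for r w
    using assms(1) by (simp add: g_def lookup_sum lookup_single when_def)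
  have ind: "indep_on U H f \<longleftrightarrow> inj_on g H \<and> independent (g ` H)" if "finite H" for H
  proof -
    have "indep_on U H f \<longleftrightarrow> indep_on U H (\<lambda>r. Poly_Mapping.lookup (g r))"
      by (rule indep_on_cong) (simp add: lg)
    also have "\<dots> \<longleftrightarrow> inj_on g H \<and> independent (g ` H)"
      by (rule indep_on_Poly_Mapping) (use that in \<open>auto simp: in_keys_iff lg split: if_splits\<close>)
    finally show ?thesis .
  qed
  have F: "inj_on g F" "independent (g ` F)" and B: "inj_on g B" "independent (g ` B)"
    using assms ind by auto
  obtain C where C: "g ` F \<subseteq> C" "C \<subseteq> g ` (F \<union> B)" "independent C" "g ` (F \<union> B) \<subseteq> span C"
    using maximal_independent_subset_extend[of "g ` F" "g ` (F \<union> B)"] F by (auto simp: image_Un)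
  have finC: "finite C" using C(2) assms finite_subset by blast
  have "card (g ` B) \<le> card C"
    using independent_span_bound[OF finC B(2)] C(4) by (auto simp: image_Un)
  then have cB: "card B \<le> card C" using B(1) by (simp add: card_image)
  have "C - g ` F \<subseteq> g ` B" using C(2) by (auto simp: image_Un)
  then obtain B' where B': "B' \<subseteq> B" "g ` B' = C - g ` F" "inj_on g B'"
    by (metis B(1) inj_on_subset subset_image_iff)
  have "inj_on g (F \<union> B')" using F(1) B' by (auto simp: inj_on_Un)
  moreover have "g ` (F \<union> B') = C" using B' C(1) by (auto simp: image_Un)
  moreover have "finite (F \<union> B')" using assms B' finite_subset by blast
  ultimately have "indep_on U (F \<union> B') f" "card C = card (F \<union> B')"
    using ind C(3) by (auto simp: card_image)
  then show ?thesis using that[of "F \<union> B'"] B'(1) cB by auto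
qed

section \<open>Frameworks with pinned vertices\<close>

text \<open>The term \<open>x = w\<close> vanishes, so for an edge this is \<open>p w\<close> minus
  the position of the other end. Written as a sum, it needs no order of the two ends and is visibly
  linear in \<open>p\<close>.\<close>

definition edge_vec :: "('v \<Rightarrow> 'a::real_vector) \<Rightarrow> 'v set \<Rightarrow> 'v \<Rightarrow> 'a" where
  "edge_vec p e w = (if w \<in> e then \<Sum>x\<in>e. p w - p x else 0)"

text \<open>The row of the rigidity matrix as a plain function of the vertex; independence can then
  be asked on a subset of the columns, which is how vertices are pinned.\<close>

definition frow :: "('l \<Rightarrow> 'v) \<Rightarrow> ('v \<Rightarrow> 'a::real_vector) \<Rightarrow> ('l \<Rightarrow> 'a) \<Rightarrow> 'v set + 'l \<Rightarrow> 'v \<Rightarrow> 'a" where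
  "frow lv p q r w = (case r of Inl e \<Rightarrow> edge_vec p e w | Inr l \<Rightarrow> if w = lv l then q l else 0)"

lemma frow_simps [simp]:
  "frow lv p q (Inl e) = edge_vec p e"
  "frow lv p q (Inr l) w = (if w = lv l then q l else 0)"
  by (auto simp: frow_def)

lemma edge_vec_pair: "x \<noteq> y \<Longrightarrow> edge_vec p {x, y} x = p x - p y"
  by (simp add: edge_vec_def)

lemma edge_vec_line:
  "edge_vec p\<^sub>0 e w + s *\<^sub>R (edge_vec p\<^sub>1 e w - edge_vec p\<^sub>0 e w) = edge_vec (\<lambda>x. p\<^sub>0 x + s *\<^sub>R (p\<^sub>1 x - p\<^sub>0 x)) e w"
  by (simp add: edge_vec_def sum_subtractf[symmetric] scaleR_sum_right sum.distrib[symmetric] algebra_simps)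

lemma frow_line:
  "frow lv p\<^sub>0 q\<^sub>0 r w + s *\<^sub>R (frow lv p\<^sub>1 q\<^sub>1 r w - frow lv p\<^sub>0 q\<^sub>0 r w) =
   frow lv (\<lambda>x. p\<^sub>0 x + s *\<^sub>R (p\<^sub>1 x - p\<^sub>0 x)) (\<lambda>x. q\<^sub>0 x + s *\<^sub>R (q\<^sub>1 x - q\<^sub>0 x)) r w"
  by (cases r) (simp_all add: edge_vec_line)

text \<open>Rows are linear in \<open>(p, q)\<close>, so the line joining two systems of rows
  consists of rows of frameworks. The positions are returned explicitly because affine relations
  valid at both ends, such as a midpoint, persist along the line.\<close>

lemma frow_common_point:
  fixes p\<^sub>0 p\<^sub>1 :: "'v \<Rightarrow> real^'d"
  assumes "finite F" "indep_on U F (frow lv p\<^sub>0 q\<^sub>0)" "finite H" "indep_on W H (frow lv p\<^sub>1 q\<^sub>1)"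
  obtains s q where "indep_on U F (frow lv (\<lambda>x. p\<^sub>0 x + s *\<^sub>R (p\<^sub>1 x - p\<^sub>0 x)) q)"
    and "indep_on W H (frow lv (\<lambda>x. p\<^sub>0 x + s *\<^sub>R (p\<^sub>1 x - p\<^sub>0 x)) q)"
  by (rule indep_on_common_point[OF assms, of "frow lv p\<^sub>1 q\<^sub>1" "frow lv p\<^sub>0 q\<^sub>0"])
    (unfold frow_line, rule that)

lemma sum_frow_column:
  assumes "finite E" "finite U" "\<And>u. finite (N u)"
  shows "(\<Sum>r\<in>E <+> Sigma U N. c r *\<^sub>R frow fst p q r w) =
    (\<Sum>e\<in>E. c (Inl e) *\<^sub>R edge_vec p e w) +
    (if w \<in> U then \<Sum>j\<in>N w. c (Inr (w, j)) *\<^sub>R q (w, j) else 0)"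
proof -
  have "(\<Sum>x\<in>Sigma U N. c (Inr x) *\<^sub>R frow fst p q (Inr x) w) =
      (\<Sum>(u, j)\<in>Sigma U N. c (Inr (u, j)) *\<^sub>R (if w = u then q (u, j) else 0))"
    by (intro sum.cong) auto
  also have "\<dots> = (\<Sum>u\<in>U. \<Sum>j\<in>N u. c (Inr (u, j)) *\<^sub>R (if w = u then q (u, j) else 0))"
    using assms by (intro sum.Sigma[symmetric]) auto
  also have "\<dots> = (\<Sum>u\<in>U. if u = w then \<Sum>j\<in>N w. c (Inr (w, j)) *\<^sub>R q (w, j) else 0)"
    by (auto intro!: sum.cong)
  finally show ?thesis
    using assms by (simp add: sum.Plus comp_def)
qed

lemma sum_edge_vec_incident:
  assumes "finite E"
  shows "(\<Sum>e\<in>{e\<in>E. w \<in> e}. c e *\<^sub>R edge_vec p e w) = (\<Sum>e\<in>E. c e *\<^sub>R edge_vec p e w)"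
  using assms by (intro sum.mono_neutral_left) (auto simp: edge_vec_def)

section \<open>Stars, pinning and 1-extension\<close>

lemma card2_other:
  assumes "card e = 2" "v \<in> e"
  obtains u where "u \<noteq> v" "e = {v, u}"
proof -
  obtain x y where "e = {x, y}" "x \<noteq> y" using assms(1) by (auto simp: card_2_iff)
  then show ?thesis using assms(2) that[of x] that[of y] by (auto simp: insert_commute)
qed

lemma card2_other_unique:
  assumes "card e = 2" "v \<in> e" "x \<in> e" "y \<in> e" "x \<noteq> v" "y \<noteq> v"
  shows "x = y"
  using card2_other[OF assms(1,2)] assms(3-6) by blast

text \<open>With \<open>v\<close> at the origin, the at most \<open>d\<close> edges can be given
  distinct coordinate vectors.\<close>

lemma independent_star_exists:
  fixes v :: 'v
  assumes "finite S" "card S \<le> CARD('d::finite)" "\<And>e. e \<in> S \<Longrightarrow> card e = 2 \<and> v \<in> e"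
  obtains p :: "'v \<Rightarrow> real^'d" where "p v = 0" "indep_on {v} S (edge_vec p)"
proof -
  obtain h :: "'v set \<Rightarrow> 'd" where h: "inj_on h S"
    using card_le_inj[of S "UNIV :: 'd set"] assms(1,2) by auto
  define p :: "'v \<Rightarrow> real^'d" where "p u = (if u = v then 0 else - axis (h {v, u}) 1)" for u
  have ev: "edge_vec p e v = axis (h e) 1" if e: "e \<in> S" for e
  proof -
    obtain u where "u \<noteq> v" "e = {v, u}" using assms(3)[OF e] card2_other[of e v] by metis
    then show ?thesis by (simp add: edge_vec_pair p_def)
  qed
  have "indep_on {v} S (edge_vec p)"
  proof (rule indep_onI)
    fix c e assume c: "\<And>w. w \<in> {v} \<Longrightarrow> (\<Sum>e\<in>S. c e *\<^sub>R edge_vec p e w) = 0" and e: "e \<in> S"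
    have "(\<Sum>x\<in>S. c x *\<^sub>R edge_vec p x v) $ h e = (\<Sum>x\<in>S. if x = e then c x else 0)"
      unfolding sum_component
      by (intro sum.cong) (use h e in \<open>auto simp: ev axis_def inj_on_eq_iff\<close>)
    with c[of v] e assms(1) show "c e = 0" by simp
  qed
  then show ?thesis using that[of p] by (simp add: p_def)
qed

text \<open>\<open>In\<close> are the edges directed into \<open>v\<close>. The loops at
  \<open>v\<close> receive a basis of the whole space that extends the edge vectors at
  \<open>v\<close>, without the vectors of \<open>In\<close>. Exactly \<open>d - card In\<close>
  vectors remain, those of the outgoing edges among them.\<close>

lemma pin_vertex:
  fixes p :: "'v \<Rightarrow> real^'d"
  assumes fin: "finite U" "finite E" and v: "v \<in> U" and In: "In \<subseteq> {e\<in>E. v \<in> e}"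
    and rest: "indep_on (U - {v}) ((E - In) <+> Sigma (U - {v}) (\<lambda>u. {..<n u})) (frow fst p q)"
    and star: "indep_on {v} {e\<in>E. v \<in> e} (edge_vec p)"
    and n: "n v = CARD('d) - card In"
  obtains q' where "indep_on U (E <+> Sigma U (\<lambda>u. {..<n u})) (frow fst p q')"
proof -
  define S where "S = {e\<in>E. v \<in> e}"
  define vec where "vec e = edge_vec p e v" for e
  have finS: "finite S" using fin by (simp add: S_def)
  have "inj_on vec S \<and> independent (vec ` S)"
    unfolding inj_on_and_independent_iff[OF finS] using star by (simp add: indep_on_def S_def vec_def)
  then have inj: "inj_on vec S" and ind: "independent (vec ` S)" by auto
  obtain B where B: "vec ` S \<subseteq> B" "independent B" "UNIV \<subseteq> span B"
    using maximal_independent_subset_extend[of "vec ` S" UNIV] ind by auto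
  have finB: "finite B" using B(2) independent_bound_general by blast
  have cB: "card B = CARD('d)"
    using B dim_eq_card_independent[OF B(2)] dim_span[of B] by (metis DIM_cart DIM_real dim_UNIV mult_1_right top.extremum_uniqueI)
  have InS: "In \<subseteq> S" using In by (simp add: S_def)
  have "card (B - vec ` In) = n v"
  proof -
    have "card (vec ` In) = card In" using InS inj by (meson card_image inj_on_subset)
    moreover have "vec ` In \<subseteq> B" using InS B(1) by auto
    ultimately show ?thesis using finB cB n by (simp add: card_Diff_subset finite_subset)
  qed
  then obtain g where g: "bij_betw g {..<n v} (B - vec ` In)"
    using finB bij_betw_iff_card[of "{..<n v}" "B - vec ` In"] by auto
  define q' where "q' x = (if fst x = v then g (snd x) else q x)" for x
  have "indep_on U (E <+> Sigma U (\<lambda>u. {..<n u})) (frow fst p q')"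
  proof (rule indep_onI)
    fix c r
    assume c: "\<And>w. w \<in> U \<Longrightarrow> (\<Sum>r\<in>E <+> Sigma U (\<lambda>u. {..<n u}). c r *\<^sub>R frow fst p q' r w) = 0"
      and r: "r \<in> E <+> Sigma U (\<lambda>u. {..<n u})"
    have col: "(\<Sum>e\<in>{e\<in>E. w \<in> e}. c (Inl e) *\<^sub>R edge_vec p e w) + (\<Sum>j<n w. c (Inr (w, j)) *\<^sub>R q' (w, j)) = 0"
      if "w \<in> U" for w
      using c[OF that] fin that by (simp add: sum_frow_column sum_edge_vec_incident)
    have colv: "(\<Sum>e\<in>S. c (Inl e) *\<^sub>R vec e) + (\<Sum>j<n v. c (Inr (v, j)) *\<^sub>R g j) = 0"
      using col[OF v] by (simp add: q'_def S_def vec_def)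
    have functional: "\<exists>\<phi>. linear \<phi> \<and> \<phi> b = (1::real) \<and> (\<forall>x\<in>B. x \<noteq> b \<longrightarrow> \<phi> x = 0)" if "b \<in> B" for b
      using linear_independent_extend[OF B(2), of "\<lambda>x. if x = b then 1 else 0"] that by auto
    \<comment> \<open>The functional dual to \<open>vec e\<close> kills all loop vectors and all
      other edge vectors in column \<open>v\<close>, so it reads off the coefficient of
      \<open>e\<close>.\<close>
    have zero_In: "c (Inl e) = 0" if e: "e \<in> In" for e
    proof -
      obtain \<phi> where \<phi>: "linear \<phi>" "\<phi> (vec e) = (1::real)" "\<And>x. x \<in> B \<Longrightarrow> x \<noteq> vec e \<Longrightarrow> \<phi> x = 0"
        using functional[of "vec e"] e InS B(1) by blast
      have "\<phi> (g j) = 0" if "j < n v" for j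
      proof -
        have "g j \<in> B - vec ` In" using g that by (auto simp: bij_betw_def)
        then show ?thesis using \<phi>(3)[of "g j"] e by auto
      qed
      moreover have "\<phi> (vec x) = (if x = e then 1 else 0)" if "x \<in> S" for x
        using \<phi> that e InS inj B(1) by (auto simp: inj_on_eq_iff subset_iff)
      ultimately have "\<phi> ((\<Sum>e\<in>S. c (Inl e) *\<^sub>R vec e) + (\<Sum>j<n v. c (Inr (v, j)) *\<^sub>R g j)) =
          (\<Sum>x\<in>S. if x = e then c (Inl x) else 0)"
        by (simp add: linear_add[OF \<phi>(1)] linear_sum[OF \<phi>(1)] linear_scale[OF \<phi>(1)] mult_delta_right cong: if_cong)
      also have "\<dots> = c (Inl e)" using e InS finS by (simp add: subset_iff)
      finally show ?thesis unfolding colv using linear_0[OF \<phi>(1)] by simp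
    qed
    \<comment> \<open>With zero coefficients on \<open>In\<close>, the columns other than
      \<open>v\<close> give a dependence of the pinned framework.\<close>
    have zero_rest: "c r = 0" if "r \<in> (E - In) <+> Sigma (U - {v}) (\<lambda>u. {..<n u})" for r
    proof (rule indep_onD[OF rest _ that])
      fix w assume w: "w \<in> U - {v}"
      have "(\<Sum>e\<in>E - In. c (Inl e) *\<^sub>R edge_vec p e w) = (\<Sum>e\<in>E. c (Inl e) *\<^sub>R edge_vec p e w)"
        by (rule sum.mono_neutral_left) (use fin zero_In In in auto)
      then show "(\<Sum>r\<in>(E - In) <+> Sigma (U - {v}) (\<lambda>u. {..<n u}). c r *\<^sub>R frow fst p q r w) = 0"
        using w col[of w] fin by (simp add: sum_frow_column sum_edge_vec_incident) (simp add: q'_def)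
    qed
    have zero_E: "c (Inl e) = 0" if "e \<in> E" for e
      using zero_In[of e] zero_rest[of "Inl e"] that by auto
    have zero_v: "c (Inr (v, j)) = 0" if j: "j < n v" for j
    proof -
      have gB: "g i \<in> B" if "i < n v" for i using g that by (auto simp: bij_betw_def)
      obtain \<phi> where \<phi>: "linear \<phi>" "\<phi> (g j) = (1::real)" "\<And>x. x \<in> B \<Longrightarrow> x \<noteq> g j \<Longrightarrow> \<phi> x = 0"
        using functional[OF gB[OF j]] by blast
      have "\<phi> (g i) = (if i = j then 1 else 0)" if "i < n v" for i
      proof -
        have "g i \<noteq> g j" if "i \<noteq> j" using g \<open>i < n v\<close> j that unfolding bij_betw_def inj_on_def by blast
        then show ?thesis using \<phi>(2,3) gB[OF that] by auto
      qed
      then have "\<phi> (\<Sum>i<n v. c (Inr (v, i)) *\<^sub>R g i) = (\<Sum>i<n v. if i = j then c (Inr (v, i)) else 0)"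
        by (simp add: linear_sum[OF \<phi>(1)] linear_scale[OF \<phi>(1)] mult_delta_right)
      also have "\<dots> = c (Inr (v, j))" using j by simp
      moreover have "(\<Sum>i<n v. c (Inr (v, i)) *\<^sub>R g i) = 0"
      proof -
        have "(\<Sum>e\<in>S. c (Inl e) *\<^sub>R vec e) = 0" by (rule sum.neutral) (simp add: S_def zero_E)
        then show ?thesis using colv by simp
      qed
      ultimately show ?thesis using linear_0[OF \<phi>(1)] by simp
    qed
    show "c r = 0"
    proof (cases r)
      case (Inl e)
      then show ?thesis using r zero_E by auto
    next
      case (Inr x)
      then obtain u j where "r = Inr (u, j)" "u \<in> U" "j < n u" using r by auto
      then show ?thesis using zero_v zero_rest[of r] by (cases "u = v") auto
    qed
  qed
  then show ?thesis by (rule that)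
qed

text \<open>At the midpoint the vectors of \<open>v a\<close> and \<open>v b\<close> in column
  \<open>v\<close> are opposite, and without \<open>v b\<close> the edges at \<open>v\<close> are
  independent. So column \<open>v\<close> forces a common coefficient on these two edges and zero on
  the others at \<open>v\<close>; in the remaining columns the pair then acts as one half of the
  edge \<open>a b\<close>.\<close>

lemma one_extension:
  fixes p :: "'v \<Rightarrow> real^'d"
  assumes fin: "finite U" "finite E" "\<And>u. finite (N u)"
    and ab: "a \<in> U - {v}" "b \<in> U - {v}" "a \<noteq> b"
    and E: "{v, a} \<in> E" "{v, b} \<in> E" "{a, b} \<notin> E"
    and mid: "p v = (1/2) *\<^sub>R (p a + p b)"
    and star: "indep_on {v} ({e\<in>E. v \<in> e} - {{v, b}}) (edge_vec p)"
    and rest: "indep_on (U - {v}) (insert {a, b} {e\<in>E. v \<notin> e} <+> Sigma (U - {v}) N) (frow fst p q)"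
    and v: "v \<in> U"
  shows "indep_on U (E <+> Sigma (U - {v}) N) (frow fst p q)"
proof (rule indep_onI)
  fix c r
  assume c: "\<And>w. w \<in> U \<Longrightarrow> (\<Sum>r\<in>E <+> Sigma (U - {v}) N. c r *\<^sub>R frow fst p q r w) = 0"
    and r: "r \<in> E <+> Sigma (U - {v}) N"
  define S where "S = {e\<in>E. v \<in> e}"
  have finS: "finite S" using fin by (simp add: S_def)
  define \<gamma> where "\<gamma> = c (Inl {v, b})"
  have vab: "a \<noteq> v" "b \<noteq> v" using ab by auto
  have ne: "{v, a} \<noteq> {v, b}" using ab(3) vab by (simp add: doubleton_eq_iff)
  have half: "edge_vec p {v, a} w + edge_vec p {v, b} w = (if w = v then 0 else (1/2) *\<^sub>R edge_vec p {a, b} w)" for w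
    using ab(3) vab by (auto simp: edge_vec_def mid vec_eq_iff field_simps)
  have colv: "(\<Sum>e\<in>S. c (Inl e) *\<^sub>R edge_vec p e v) = 0"
    using c[OF v] fin by (simp add: sum_frow_column sum_edge_vec_incident S_def)
  \<comment> \<open>Replacing the vector of \<open>v b\<close> by minus that of \<open>v a\<close>
    turns column \<open>v\<close> into a relation in the independent star.\<close>
  have star0: "c (Inl e) - (if e = {v, a} then \<gamma> else 0) = 0" if "e \<in> S - {{v, b}}" for e
  proof (rule indep_onD[OF star, of "\<lambda>e. c (Inl e) - (if e = {v, a} then \<gamma> else 0)"])
    fix w assume "w \<in> {v}"
    have "(\<Sum>e\<in>S - {{v, b}}. (c (Inl e) - (if e = {v, a} then \<gamma> else 0)) *\<^sub>R edge_vec p e v) =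
        (\<Sum>e\<in>S - {{v, b}}. c (Inl e) *\<^sub>R edge_vec p e v) -
        (\<Sum>e\<in>S - {{v, b}}. if e = {v, a} then \<gamma> *\<^sub>R edge_vec p e v else 0)"
      unfolding sum_subtractf[symmetric] by (intro sum.cong) (auto simp: algebra_simps)
    also have "(\<Sum>e\<in>S - {{v, b}}. if e = {v, a} then \<gamma> *\<^sub>R edge_vec p e v else 0) = \<gamma> *\<^sub>R edge_vec p {v, a} v"
      using finS E ne by (simp add: S_def)
    also have "(\<Sum>e\<in>S - {{v, b}}. c (Inl e) *\<^sub>R edge_vec p e v) = - \<gamma> *\<^sub>R edge_vec p {v, b} v"
      using colv sum.remove[of S "{v, b}" "\<lambda>e. c (Inl e) *\<^sub>R edge_vec p e v"] finS E(2)
      by (simp add: S_def \<gamma>_def algebra_simps eq_neg_iff_add_eq_0)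
    also have "- \<gamma> *\<^sub>R edge_vec p {v, b} v - \<gamma> *\<^sub>R edge_vec p {v, a} v = - \<gamma> *\<^sub>R (edge_vec p {v, a} v + edge_vec p {v, b} v)"
      by (simp add: algebra_simps)
    finally show "(\<Sum>e\<in>{e\<in>E. v \<in> e} - {{v, b}}. (c (Inl e) - (if e = {v, a} then \<gamma> else 0)) *\<^sub>R edge_vec p e w) = 0"
      using \<open>w \<in> {v}\<close> by (simp add: half S_def)
  qed (use that in \<open>simp add: S_def\<close>)
  have cS: "c (Inl e) = (if e \<in> {{v, a}, {v, b}} then \<gamma> else 0)" if "e \<in> S" for e
    using star0[of e] that ne by (cases "e = {v, b}") (simp_all add: \<gamma>_def split: if_splits)
  \<comment> \<open>The factor 1/2 appears because \<open>p a - p v\<close> is half of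
    \<open>p a - p b\<close>.\<close>
  define c' where "c' r = (if r = Inl {a, b} then \<gamma> / 2 else c r)" for r
  have zero: "c' r = 0" if "r \<in> insert {a, b} {e\<in>E. v \<notin> e} <+> Sigma (U - {v}) N" for r
  proof (rule indep_onD[OF rest _ that])
    fix w assume w: "w \<in> U - {v}"
    have "(\<Sum>e\<in>S. c (Inl e) *\<^sub>R edge_vec p e w) = (\<Sum>e\<in>{{v, a}, {v, b}}. \<gamma> *\<^sub>R edge_vec p e w)"
      using finS E(1,2) cS by (intro sum.mono_neutral_cong_right) (auto simp: S_def)
    also have "\<dots> = (\<gamma> / 2) *\<^sub>R edge_vec p {a, b} w"
      using ne half[of w] w by (simp add: scaleR_add_right[symmetric] del: scaleR_add_right)
    finally have S: "(\<Sum>e\<in>S. c (Inl e) *\<^sub>R edge_vec p e w) = (\<gamma> / 2) *\<^sub>R edge_vec p {a, b} w" .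
    have split: "E = S \<union> {e\<in>E. v \<notin> e}" "S \<inter> {e\<in>E. v \<notin> e} = {}" by (auto simp: S_def)
    have "(\<Sum>e\<in>E. c (Inl e) *\<^sub>R edge_vec p e w) =
        (\<Sum>e\<in>S. c (Inl e) *\<^sub>R edge_vec p e w) + (\<Sum>e\<in>{e\<in>E. v \<notin> e}. c (Inl e) *\<^sub>R edge_vec p e w)"
      using split finS fin by (metis (no_types, lifting) finite_Un sum.union_disjoint)
    also have "(\<Sum>e\<in>{e\<in>E. v \<notin> e}. c (Inl e) *\<^sub>R edge_vec p e w) =
        (\<Sum>e\<in>{e\<in>E. v \<notin> e}. c' (Inl e) *\<^sub>R edge_vec p e w)"
      using E(3) by (intro sum.cong) (auto simp: c'_def)
    finally have "(\<Sum>e\<in>E. c (Inl e) *\<^sub>R edge_vec p e w) =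
        (\<Sum>e\<in>insert {a, b} {e\<in>E. v \<notin> e}. c' (Inl e) *\<^sub>R edge_vec p e w)"
      using fin E(3) S by (simp add: c'_def)
    then show "(\<Sum>r\<in>insert {a, b} {e\<in>E. v \<notin> e} <+> Sigma (U - {v}) N. c' r *\<^sub>R frow fst p q r w) = 0"
      using c[of w] w fin by (simp add: sum_frow_column) (simp add: c'_def)
  qed
  have "\<gamma> = 0" using zero[of "Inl {a, b}"] by (auto simp: c'_def)
  show "c r = 0"
  proof (cases "r \<in> Inl ` S")
    case True
    then show ?thesis using cS \<open>\<gamma> = 0\<close> by auto
  next
    case False
    then have "r \<in> insert {a, b} {e\<in>E. v \<notin> e} <+> Sigma (U - {v}) N" using r by (auto simp: S_def)
    moreover have "r \<noteq> Inl {a, b}" using r E(3) by auto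
    ultimately show ?thesis using zero[of r] by (simp add: c'_def)
  qed
qed

text \<open>Two independent sets of rows are compared in one framework: all edges without any loop
  at \<open>v\<close>, by 1-extension, and all edges outside \<open>In\<close> with \<open>d\<close>
  loops at \<open>v\<close>, by pinning. The second set has \<open>t - 1\<close> more rows, so
  exchange adds at least \<open>t - 1\<close> elements to the first, and these can only be loops at
  \<open>v\<close>.\<close>

lemma regular_step:
  fixes p\<^sub>1 p\<^sub>2 :: "'v \<Rightarrow> real^'d"
  assumes fin: "finite U" "finite E" and card2: "\<And>e. e \<in> E \<Longrightarrow> card e = 2 \<and> e \<subseteq> U"
    and v: "v \<in> U" and t: "t > 0" "CARD('d) = 2 * t - 1"
    and cS: "card {e\<in>E. v \<in> e} = 2 * t" and cE: "card E = t * card U"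
    and In: "In \<subseteq> {e\<in>E. v \<in> e}" "card In = t"
    and ab: "{v, a} \<in> E" "{v, b} \<in> E" "{a, b} \<notin> E" "a \<noteq> b"
    and pinned: "indep_on (U - {v}) ((E - In) <+> (U - {v}) \<times> {..<t-1}) (frow fst p\<^sub>1 q\<^sub>1)"
    and reduced: "indep_on (U - {v}) (insert {a, b} {e\<in>E. v \<notin> e} <+> (U - {v}) \<times> {..<t-1}) (frow fst p\<^sub>2 q\<^sub>2)"
  obtains p :: "'v \<Rightarrow> real^'d" and q where "indep_on U (E <+> U \<times> {..<t-1}) (frow fst p q)"
proof -
  define S where "S = {e\<in>E. v \<in> e}"
  have vab: "a \<noteq> v" "b \<noteq> v" "a \<in> U" "b \<in> U" using card2[OF ab(1)] card2[OF ab(2)] by auto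
  have ne: "{v, a} \<noteq> {v, b}" using ab(4) vab by (simp add: doubleton_eq_iff)
  have finS: "finite S" using fin by (simp add: S_def)
  have bS: "{v, b} \<in> S" "{v, a} \<in> S" using ab by (simp_all add: S_def)
  \<comment> \<open>Leaving out \<open>v b\<close> reduces the \<open>2 t = d + 1\<close> edges at
    \<open>v\<close> to \<open>d\<close>, which can be independent.\<close>
  have "card (S - {{v, b}}) \<le> CARD('d)" using cS bS t by (simp add: S_def[symmetric])
  then obtain p\<^sub>3 :: "'v \<Rightarrow> real^'d" where p3: "p\<^sub>3 v = 0" "indep_on {v} (S - {{v, b}}) (edge_vec p\<^sub>3)"
    using independent_star_exists[of "S - {{v, b}}" v] finS card2 unfolding S_def
    by (metis (no_types, lifting) DiffD1 finite_Diff mem_Collect_eq)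
  \<comment> \<open>Since \<open>v b\<close> is not in this star, \<open>b\<close> may be moved;
    opposite to \<open>a\<close>, it makes the origin, where \<open>v\<close> is, the
    midpoint.\<close>
  define p\<^sub>4 where "p\<^sub>4 = p\<^sub>3(b := - p\<^sub>3 a)"
  have "edge_vec p\<^sub>4 e v = edge_vec p\<^sub>3 e v" if e: "e \<in> S - {{v, b}}" for e
  proof -
    have "card e = 2" "v \<in> e" using e card2 by (auto simp: S_def)
    then obtain u where "u \<noteq> v" "e = {v, u}" by (rule card2_other)
    then show ?thesis using e vab by (auto simp: edge_vec_pair p\<^sub>4_def)
  qed
  then have star4: "indep_on {v} (S - {{v, b}}) (edge_vec p\<^sub>4)"
    using p3(2) by (subst indep_on_cong) auto
  have mid4: "p\<^sub>4 v = (1/2) *\<^sub>R (p\<^sub>4 a + p\<^sub>4 b)" using p3(1) vab ab(4) by (simp add: p\<^sub>4_def)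
  \<comment> \<open>No row of the reduced framework involves \<open>v\<close>, so \<open>v\<close>
    may be moved to the midpoint.\<close>
  define p\<^sub>5 where "p\<^sub>5 = p\<^sub>2(v := (1/2) *\<^sub>R (p\<^sub>2 a + p\<^sub>2 b))"
  have mid5: "p\<^sub>5 v = (1/2) *\<^sub>R (p\<^sub>5 a + p\<^sub>5 b)" using vab by (simp add: p\<^sub>5_def)
  have "edge_vec p\<^sub>5 e w = edge_vec p\<^sub>2 e w" if "v \<notin> e" for e w
    using that by (auto simp: edge_vec_def p\<^sub>5_def intro!: sum.cong)
  then have "frow fst p\<^sub>5 q\<^sub>2 r w = frow fst p\<^sub>2 q\<^sub>2 r w"
    if "r \<in> insert {a, b} {e\<in>E. v \<notin> e} <+> (U - {v}) \<times> {..<t-1}" for r w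
    using that vab by (cases r) auto
  then have reduced5: "indep_on (U - {v}) (insert {a, b} {e\<in>E. v \<notin> e} <+> (U - {v}) \<times> {..<t-1}) (frow fst p\<^sub>5 q\<^sub>2)"
    using reduced by (subst indep_on_cong) auto
  have star4': "indep_on {v} (Inl ` (S - {{v, b}})) (frow fst p\<^sub>4 q\<^sub>2)"
    using star4 by (subst indep_on_reindex) auto
  have fin5: "finite (insert {a, b} {e\<in>E. v \<notin> e} <+> (U - {v}) \<times> {..<t-1})"
    using fin by simp
  have fin4: "finite (Inl ` (S - {{v, b}}) :: ('v set + 'v \<times> nat) set)" using finS by simp
  obtain s q\<^sub>6 where
    red6: "indep_on (U - {v}) (insert {a, b} {e\<in>E. v \<notin> e} <+> (U - {v}) \<times> {..<t-1})
      (frow fst (\<lambda>x. p\<^sub>5 x + s *\<^sub>R (p\<^sub>4 x - p\<^sub>5 x)) q\<^sub>6)" and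
    star6: "indep_on {v} (Inl ` (S - {{v, b}})) (frow fst (\<lambda>x. p\<^sub>5 x + s *\<^sub>R (p\<^sub>4 x - p\<^sub>5 x)) q\<^sub>6)"
    by (rule frow_common_point[OF fin5 reduced5 fin4 star4'])
  define p\<^sub>6 where "p\<^sub>6 = (\<lambda>x. p\<^sub>5 x + s *\<^sub>R (p\<^sub>4 x - p\<^sub>5 x))"
  have mid6: "p\<^sub>6 v = (1/2) *\<^sub>R (p\<^sub>6 a + p\<^sub>6 b)"
    unfolding p\<^sub>6_def mid4 mid5 by (simp add: algebra_simps)
  have full6: "indep_on U (E <+> (U - {v}) \<times> {..<t-1}) (frow fst p\<^sub>6 q\<^sub>6)"
  proof (rule one_extension[of U E "\<lambda>_. {..<t-1}" a v b])
    show "indep_on {v} ({e\<in>E. v \<in> e} - {{v, b}}) (edge_vec p\<^sub>6)"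
      using star6 unfolding p\<^sub>6_def[symmetric] S_def by (subst (asm) indep_on_reindex) auto
  qed (use fin vab ab v mid6 red6 in \<open>auto simp: p\<^sub>6_def\<close>)
  have fin1: "finite ((E - In) <+> (U - {v}) \<times> {..<t-1})" and fin6: "finite (E <+> (U - {v}) \<times> {..<t-1})"
    using fin by auto
  \<comment> \<open>The midpoint has served its purpose; only the independence obtained from it has
    to survive on the line to \<open>p\<^sub>1\<close>.\<close>
  obtain s' q where
    pin7: "indep_on (U - {v}) ((E - In) <+> (U - {v}) \<times> {..<t-1}) (frow fst (\<lambda>x. p\<^sub>1 x + s' *\<^sub>R (p\<^sub>6 x - p\<^sub>1 x)) q)" and
    full7: "indep_on U (E <+> (U - {v}) \<times> {..<t-1}) (frow fst (\<lambda>x. p\<^sub>1 x + s' *\<^sub>R (p\<^sub>6 x - p\<^sub>1 x)) q)"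
    by (rule frow_common_point[OF fin1 pinned fin6 full6])
  define p where "p = (\<lambda>x. p\<^sub>1 x + s' *\<^sub>R (p\<^sub>6 x - p\<^sub>1 x))"
  obtain h :: "nat \<Rightarrow> 'd" where h: "bij_betw h {..<CARD('d)} UNIV"
    using bij_betw_iff_card[of "{..<CARD('d)}" "UNIV :: 'd set"] by auto
  define q' :: "'v \<times> nat \<Rightarrow> real^'d" where "q' x = (if fst x = v then axis (h (snd x)) 1 else q x)" for x
  \<comment> \<open>A full basis of loops at \<open>v\<close> has the effect of pinning
    \<open>v\<close>.\<close>
  define N where "N u = (if u = v then {..<CARD('d)} else {..<t-1})" for u
  define F where "F = E <+> (U - {v}) \<times> {..<t-1}"
  define B where "B = (E - In) <+> Sigma U N"
  have q'_eq: "frow fst p q' r w = frow fst p q r w" if "r \<in> F" for r w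
    using that by (cases r) (auto simp: F_def q'_def)
  have indF: "indep_on U F (frow fst p q')"
    using full7 q'_eq unfolding p_def[symmetric] F_def[symmetric] by (subst indep_on_cong) auto
  have finN: "finite (N u)" for u by (simp add: N_def)
  have indB: "indep_on U B (frow fst p q')"
  proof (rule indep_onI)
    fix c r
    assume c: "\<And>w. w \<in> U \<Longrightarrow> (\<Sum>r\<in>B. c r *\<^sub>R frow fst p q' r w) = 0" and r: "r \<in> B"
    have zero: "c r = 0" if "r \<in> (E - In) <+> (U - {v}) \<times> {..<t-1}" for r
    proof (rule indep_onD[OF pin7 _ that])
      fix w assume w: "w \<in> U - {v}"
      show "(\<Sum>r\<in>(E - In) <+> (U - {v}) \<times> {..<t-1}. c r *\<^sub>R frow fst (\<lambda>x. p\<^sub>1 x + s' *\<^sub>R (p\<^sub>6 x - p\<^sub>1 x)) q r w) = 0"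
        using c[of w] w fin finN unfolding B_def p_def[symmetric]
        by (simp add: sum_frow_column) (simp add: q'_def N_def)
    qed
    have "(\<Sum>e\<in>E - In. c (Inl e) *\<^sub>R edge_vec p e v) = 0"
      by (rule sum.neutral) (use zero in auto)
    then have colv: "(\<Sum>j<CARD('d). c (Inr (v, j)) *\<^sub>R (axis (h j) 1 :: real^'d)) = 0"
      using c[OF v] v fin finN unfolding B_def by (simp add: sum_frow_column) (simp add: q'_def N_def)
    have zero_v: "c (Inr (v, j)) = 0" if j: "j < CARD('d)" for j
    proof -
      have "(\<Sum>i<CARD('d). c (Inr (v, i)) *\<^sub>R (axis (h i) 1 :: real^'d)) $ h j =
          (\<Sum>i<CARD('d). if i = j then c (Inr (v, i)) else 0)"
        unfolding sum_component using h j
        by (intro sum.cong) (auto simp: axis_def bij_betw_def inj_on_eq_iff)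
      then show ?thesis using colv j by simp
    qed
    show "c r = 0"
      using r zero zero_v unfolding B_def N_def by (cases r) (fastforce split: if_splits)+
  qed
  have finF: "finite F" and finB: "finite B" using fin finN by (auto simp: F_def B_def)
  obtain I where I: "F \<subseteq> I" "I \<subseteq> F \<union> B" "indep_on U I (frow fst p q')" "card B \<le> card I"
    using indep_on_augment[OF fin(1) finF finB indF indB] by metis
  define J where "J = {j. j < CARD('d) \<and> Inr (v, j) \<in> I}"
  have I_eq: "I = F \<union> (\<lambda>j. Inr (v, j)) ` J"
  proof
    show "I \<subseteq> F \<union> (\<lambda>j. Inr (v, j)) ` J"
    proof
      fix r assume "r \<in> I"
      then have "r \<in> F \<union> B" using I(2) by auto
      then show "r \<in> F \<union> (\<lambda>j. Inr (v, j)) ` J"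
        using \<open>r \<in> I\<close> unfolding F_def B_def J_def N_def by (cases r) (auto split: if_splits)
    qed
  qed (use I(1) J_def in auto)
  have finJ: "finite J" by (simp add: J_def)
  have "card I = card F + card J"
    unfolding I_eq using finF finJ
    by (subst card_Un_disjoint) (auto simp: F_def card_image inj_on_def)
  moreover have "card F = t * card U + (card U - 1) * (t - 1)"
    using fin v by (simp add: F_def card_Plus cE)
  moreover have "card B = (t * card U - t) + ((card U - 1) * (t - 1) + CARD('d))"
  proof -
    have "Sigma U N = (U - {v}) \<times> {..<t-1} \<union> {v} \<times> {..<CARD('d)}"
      using v by (auto simp: N_def split: if_splits)
    then have "card (Sigma U N) = (card U - 1) * (t - 1) + CARD('d)"
      using fin v by (subst \<open>Sigma U N = _\<close>, subst card_Un_disjoint) (auto simp: card_cartesian_product)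
    moreover have "card (E - In) = t * card U - t"
      using In fin cE by (subst card_Diff_subset) (auto intro: finite_subset[of In E])
    moreover have "finite (Sigma U N)" using fin finN by auto
    ultimately show ?thesis unfolding B_def using fin by (simp add: card_Plus)
  qed
  moreover have "t \<le> t * card U" using fin v by (cases "card U") auto
  \<comment> \<open>\<open>B\<close> exceeds \<open>F\<close> by \<open>d - t\<close> rows, which is
    \<open>t - 1\<close> for \<open>d = 2 t - 1\<close>.\<close>
  ultimately have "t - 1 \<le> card J" using I(4) t by linarith
  then obtain g where g: "g ` {..<t-1} \<subseteq> J" "inj_on g {..<t-1}"
    using card_le_inj[of "{..<t-1}" J] finJ by auto
  \<comment> \<open>Exchange yields some \<open>t - 1\<close> of the \<open>d\<close> loops at
    \<open>v\<close>; loop number \<open>j\<close> at \<open>v\<close> is taken to be the selected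
    loop \<open>g j\<close>.\<close>
  define \<rho> where "\<rho> r = (case r of Inl e \<Rightarrow> Inl e | Inr x \<Rightarrow> Inr (fst x, if fst x = v then g (snd x) else snd x))"
    for r :: "'v set + 'v \<times> nat"
  define q'' where "q'' x = q' (fst x, if fst x = v then g (snd x) else snd x)" for x
  have "inj_on \<rho> (E <+> U \<times> {..<t-1})"
    using g(2) by (auto simp: inj_on_def \<rho>_def split: sum.splits if_splits)
  moreover have "\<rho> ` (E <+> U \<times> {..<t-1}) \<subseteq> I"
    using g(1) unfolding I_eq by (fastforce simp: \<rho>_def F_def)
  ultimately have "indep_on U (E <+> U \<times> {..<t-1}) (\<lambda>r. frow fst p q' (\<rho> r))"
    using indep_on_mono[OF I(3), of "\<rho> ` (E <+> U \<times> {..<t-1})"] indep_on_reindex I(2) finF finB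
    by (metis finite_Un finite_subset)
  moreover have "frow fst p q' (\<rho> r) w = frow fst p q'' r w" for r w
    by (cases r) (auto simp: \<rho>_def q''_def)
  then have "(\<lambda>r. frow fst p q' (\<rho> r)) = frow fst p q''" by (intro ext)
  ultimately have "indep_on U (E <+> U \<times> {..<t-1}) (frow fst p q'')" by simp
  then show ?thesis by (rule that)
qed

section \<open>Choosing and orienting the reduction in the regular case\<close>

definition complete_on :: "'v set set \<Rightarrow> 'v set \<Rightarrow> bool" where
  "complete_on E X \<longleftrightarrow> (\<forall>x\<in>X. \<forall>y\<in>X. x \<noteq> y \<longrightarrow> {x, y} \<in> E)"

lemma complete_on_mono: "complete_on E X \<Longrightarrow> E \<subseteq> E' \<Longrightarrow> complete_on E' X"
  unfolding complete_on_def by blast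

lemma sum_incidences:
  assumes "finite U" "finite E"
  shows "(\<Sum>u\<in>U. card {e\<in>E. R u e}) = (\<Sum>e\<in>E. card {u\<in>U. R u e})"
proof -
  have "(\<Sum>u\<in>U. card {e\<in>E. R u e}) = (\<Sum>u\<in>U. \<Sum>e\<in>E. if R u e then 1 else 0)"
    using assms by (simp add: sum.If_cases Int_def)
  also have "\<dots> = (\<Sum>e\<in>E. \<Sum>u\<in>U. if R u e then 1 else 0)" by (rule sum.swap)
  also have "\<dots> = (\<Sum>e\<in>E. card {u\<in>U. R u e})"
    using assms by (simp add: sum.If_cases Int_def)
  finally show ?thesis .
qed

lemma card_neighbours:
  assumes "\<And>e. e \<in> E \<Longrightarrow> card e = 2"
  shows "card {u. {x, u} \<in> E} = card {e\<in>E. x \<in> e}"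
proof (rule bij_betw_same_card[of "\<lambda>u. {x, u}"], unfold bij_betw_def, intro conjI)
  show "inj_on (\<lambda>u. {x, u}) {u. {x, u} \<in> E}"
    by (auto simp: inj_on_def doubleton_eq_iff)
  show "(\<lambda>u. {x, u}) ` {u. {x, u} \<in> E} = {e\<in>E. x \<in> e}"
  proof
    show "{e\<in>E. x \<in> e} \<subseteq> (\<lambda>u. {x, u}) ` {u. {x, u} \<in> E}"
    proof
      fix e assume e: "e \<in> {e\<in>E. x \<in> e}"
      then have "card e = 2" "x \<in> e" using assms by auto
      then obtain u where "e = {x, u}" by (rule card2_other)
      then show "e \<in> (\<lambda>u. {x, u}) ` {u. {x, u} \<in> E}" using e by auto
    qed
  qed auto
qed

text \<open>If adding \<open>a b\<close> completes a set \<open>X\<close>, then by regularity only the edges \<open>v a\<close> and \<open>v b\<close> leave \<open>X\<close>, and any third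
  neighbour of \<open>v\<close> can take the place of \<open>b\<close>.\<close>

lemma reducible_pair_exists:
  assumes fin: "finite E" and card2: "\<And>e. e \<in> E \<Longrightarrow> card e = 2"
    and t: "t \<ge> 2" and reg: "\<And>e x. e \<in> E \<Longrightarrow> x \<in> e \<Longrightarrow> card {e\<in>E. x \<in> e} = 2 * t"
    and v: "card {e\<in>E. v \<in> e} = 2 * t"
    and free: "\<And>X. complete_on E X \<Longrightarrow> card X \<noteq> 2 * t + 1"
  obtains a b where "{v, a} \<in> E" "{v, b} \<in> E" "{a, b} \<notin> E" "a \<noteq> b"
    "\<forall>X. complete_on (insert {a, b} {e\<in>E. v \<notin> e}) X \<longrightarrow> card X \<noteq> 2 * t + 1"
proof -
  define N where "N x = {u. {x, u} \<in> E}" for x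
  have cardN: "card (N x) = 2 * t" if "{x, y} \<in> E" for x y
    using reg[OF that, of x] card_neighbours[of E x, OF card2] by (simp add: N_def)
  have cNv: "card (N v) = 2 * t" using v card_neighbours[of E v, OF card2] by (simp add: N_def)
  have finN: "finite (N x)" if "{x, y} \<in> E" for x y
    using cardN[OF that] t by (metis card.infinite mult_is_0 not_numeral_le_zero zero_neq_numeral)
  have finNv: "finite (N v)" using cNv t by (metis card.infinite mult_is_0 not_numeral_le_zero zero_neq_numeral)
  have irrefl: "x \<noteq> y" if "{x, y} \<in> E" for x y using card2[OF that] by auto
  have vN: "v \<notin> N v" using irrefl[of v v] by (auto simp: N_def)
  have "card (insert v (N v)) = 2 * t + 1" using finNv vN cNv by simp
  then have "\<not> complete_on E (insert v (N v))" using free by blast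
  then obtain a b where ab: "{v, a} \<in> E" "{v, b} \<in> E" "{a, b} \<notin> E" "a \<noteq> b"
    unfolding complete_on_def N_def by (auto simp: insert_commute)
  \<comment> \<open>The edges at \<open>v\<close> are gone, so a forbidden clique avoids
    \<open>v\<close>; and it uses the new edge, since \<open>E\<close> contains no such
    clique.\<close>
  have key: "v \<notin> X \<and> a \<in> X \<and> b \<in> X"
    if ab: "{v, a} \<in> E" "{v, b} \<in> E" and X: "complete_on (insert {a, b} {e\<in>E. v \<notin> e}) X" "card X = 2 * t + 1"
    for a b X
  proof -
    have "a \<noteq> v" "b \<noteq> v" using irrefl ab by blast+
    have v: "v \<notin> X"
    proof
      assume "v \<in> X"
      have "card (X - {v}) > 0" using X(2) t \<open>v \<in> X\<close> by simp
      then obtain y where "y \<in> X" "y \<noteq> v" by (metis card_gt_0_iff ex_in_conv DiffE insertCI)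
      then have "{v, y} \<in> insert {a, b} {e\<in>E. v \<notin> e}" using X(1) \<open>v \<in> X\<close> unfolding complete_on_def by blast
      then show False using \<open>a \<noteq> v\<close> \<open>b \<noteq> v\<close> by (auto simp: doubleton_eq_iff)
    qed
    moreover have "a \<in> X \<and> b \<in> X"
    proof (rule ccontr)
      assume "\<not> (a \<in> X \<and> b \<in> X)"
      then have "{x, y} \<noteq> {a, b}" if "x \<in> X" "y \<in> X" for x y
        using that by (auto simp: doubleton_eq_iff)
      then have "complete_on E X" using X(1) unfolding complete_on_def by blast
      then show False using free X(2) by blast
    qed
    ultimately show ?thesis by simp
  qed
  show ?thesis
  proof (cases "\<exists>X. complete_on (insert {a, b} {e\<in>E. v \<notin> e}) X \<and> card X = 2 * t + 1")
    case False
    then show ?thesis using that ab by blast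
  next
    case True
    then obtain X where X: "complete_on (insert {a, b} {e\<in>E. v \<notin> e}) X" "card X = 2 * t + 1" by blast
    have X': "v \<notin> X" "a \<in> X" "b \<in> X" using key[OF ab(1,2) X] by auto
    have finX: "finite X" using X(2) by (metis add_is_0 card.infinite zero_neq_one)
    have Xadj: "{x, y} \<in> E" if "x \<in> X" "y \<in> X" "x \<noteq> y" "{x, y} \<noteq> {a, b}" for x y
      using X(1) that unfolding complete_on_def by blast
    \<comment> \<open>The clique already supplies all \<open>2 t\<close> neighbours.\<close>
    have Nx: "N x = X - {x}" if x: "x \<in> X" "x \<noteq> a" "x \<noteq> b" for x
    proof -
      have sub: "X - {x} \<subseteq> N x" using Xadj x by (auto simp: N_def doubleton_eq_iff)
      have xa: "{x, a} \<in> E" using Xadj[of x a] x X' by (auto simp: doubleton_eq_iff)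
      have "card (X - {x}) = 2 * t" using X(2) x finX by simp
      then show ?thesis using card_subset_eq[OF finN[OF xa] sub] cardN[OF xa] by simp
    qed
    have Na: "N a = insert v (X - {a, b})"
    proof -
      have av: "{a, v} \<in> E" using ab(1) by (simp add: insert_commute)
      have sub: "insert v (X - {a, b}) \<subseteq> N a"
        using Xadj X' av by (auto simp: N_def doubleton_eq_iff)
      have "card (X - {a, b}) = 2 * t - 1" using X(2) X' finX ab(4) by (simp add: card_Diff_subset)
      then have "card (insert v (X - {a, b})) = 2 * t" using finX X' t by simp
      then show ?thesis using card_subset_eq[OF finN[OF av] sub] cardN[OF av] by simp
    qed
    have "card (N v - {a, b}) > 0"
    proof -
      have "card {a, b} = 2" "{a, b} \<subseteq> N v" using ab by (auto simp: N_def)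
      then have "card (N v - {a, b}) = 2 * t - 2" using cNv by (simp add: card_Diff_subset)
      then show ?thesis using t by simp
    qed
    then obtain c where c: "{v, c} \<in> E" "c \<noteq> a" "c \<noteq> b"
      by (metis DiffE N_def card_gt_0_iff equals0I insert_iff mem_Collect_eq)
    have "c \<notin> X"
    proof
      assume "c \<in> X"
      then have "v \<notin> N c" using Nx c X' by auto
      then show False using c by (simp add: N_def insert_commute)
    qed
    have "c \<noteq> v" using irrefl c by blast
    then have ac: "{a, c} \<notin> E" using Na \<open>c \<notin> X\<close> by (auto simp: N_def)
    \<comment> \<open>A third vertex \<open>y\<close> of \<open>Y\<close> is adjacent to
      \<open>a\<close> and \<open>c\<close>. As a neighbour of \<open>a\<close> other than
      \<open>v\<close>, it lies in \<open>X\<close> and is not \<open>b\<close>; then all its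
      neighbours lie in \<open>X\<close>, but \<open>c\<close> does not.\<close>
    have "card Y \<noteq> 2 * t + 1" if Y: "complete_on (insert {a, c} {e\<in>E. v \<notin> e}) Y" for Y
    proof
      assume cY: "card Y = 2 * t + 1"
      have Y': "v \<notin> Y" "a \<in> Y" "c \<in> Y" using key[OF ab(1) c(1) Y cY] by auto
      have "card (Y - {a, c}) > 0"
        using Y' cY c(2) t by (simp add: card_Diff_subset)
      then obtain y where y: "y \<in> Y" "y \<noteq> a" "y \<noteq> c"
        by (metis DiffE card_gt_0_iff equals0I insert_iff)
      have "{a, y} \<in> E" "{y, c} \<in> E"
        using Y Y' y unfolding complete_on_def by (auto simp: doubleton_eq_iff)
      then have "y \<in> N a" "c \<in> N y" by (auto simp: N_def)
      then have "y \<in> X" "y \<noteq> b" using Na y Y' by auto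
      then show False using Nx[of y] y \<open>c \<in> N y\<close> \<open>c \<notin> X\<close> by auto
    qed
    then show ?thesis using that[OF ab(1) c(1) ac] c by blast
  qed
qed

text \<open>In a balanced orientation all edges may be reversed, so one of two given edges at \<open>v\<close> may be
  assumed to leave \<open>v\<close>; the new edge then takes its place.\<close>

lemma reduced_orientation_exists:
  assumes fin: "finite E" and card2: "\<And>e. e \<in> E \<Longrightarrow> card e = 2 \<and> e \<subseteq> U"
    and deg: "\<And>u. u \<in> U \<Longrightarrow> card {e\<in>E. u \<in> e} = 2 * t"
    and \<sigma>: "\<And>e. e \<in> E \<Longrightarrow> \<sigma> e \<in> e" "\<And>u. u \<in> U \<Longrightarrow> card {e\<in>E. \<sigma> e = u} = t"
    and ab: "{v, a} \<in> E" "{v, b} \<in> E" "{a, b} \<notin> E" "a \<noteq> b"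
  obtains \<tau> where "\<forall>e\<in>insert {a, b} {e\<in>E. v \<notin> e}. \<tau> e \<in> e \<inter> (U - {v})"
    "\<forall>u. card {e\<in>insert {a, b} {e\<in>E. v \<notin> e}. \<tau> e = u} \<le> t"
proof -
  have vab: "a \<noteq> v" "b \<noteq> v" "a \<in> U" "b \<in> U" using card2[OF ab(1)] card2[OF ab(2)] by auto
  have "\<exists>\<rho>. (\<forall>e\<in>E. \<rho> e \<in> e) \<and> (\<forall>u\<in>U. card {e\<in>E. \<rho> e = u} = t) \<and> (\<rho> {v, a} = a \<or> \<rho> {v, b} = b)"
  proof (cases "\<sigma> {v, a} = a \<or> \<sigma> {v, b} = b")
    case True
    then show ?thesis using \<sigma> by blast
  next
    case False
    have "\<exists>x. x \<in> e \<and> x \<noteq> \<sigma> e" if "e \<in> E" for e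
      using card2[OF that] by (metis card_2_iff')
    then obtain \<rho> where \<rho>: "\<And>e. e \<in> E \<Longrightarrow> \<rho> e \<in> e \<and> \<rho> e \<noteq> \<sigma> e" by metis
    have "card {e\<in>E. \<rho> e = u} = t" if u: "u \<in> U" for u
    proof -
      \<comment> \<open>After reversal \<open>u\<close> receives the \<open>2 t - t = t\<close>
        edges that used to leave it.\<close>
      have "{e\<in>E. \<rho> e = u} = {e\<in>E. u \<in> e} - {e\<in>E. \<sigma> e = u}"
      proof (intro set_eqI iffI)
        fix e assume e: "e \<in> {e\<in>E. u \<in> e} - {e\<in>E. \<sigma> e = u}"
        then have "card e = 2" "\<sigma> e \<in> e" using card2 \<sigma>(1) by auto
        then have "\<rho> e = u" by (rule card2_other_unique) (use e \<rho>[of e] in auto)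
        then show "e \<in> {e\<in>E. \<rho> e = u}" using e by simp
      next
        fix e assume "e \<in> {e\<in>E. \<rho> e = u}"
        then show "e \<in> {e\<in>E. u \<in> e} - {e\<in>E. \<sigma> e = u}" using \<rho>[of e] by auto
      qed
      moreover have "{e\<in>E. \<sigma> e = u} \<subseteq> {e\<in>E. u \<in> e}" using \<sigma>(1) by auto
      ultimately show ?thesis using deg[OF u] \<sigma>(2)[OF u] fin by (simp add: card_Diff_subset)
    qed
    moreover have "\<rho> {v, a} = a" using \<rho>[OF ab(1)] \<sigma>(1)[OF ab(1)] False by auto
    ultimately show ?thesis using \<rho> by blast
  qed
  then obtain \<rho> x where \<rho>: "\<And>e. e \<in> E \<Longrightarrow> \<rho> e \<in> e" "\<And>u. u \<in> U \<Longrightarrow> card {e\<in>E. \<rho> e = u} = t"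
    and x: "x = a \<or> x = b" "\<rho> {v, x} = x" by blast
  have vx: "{v, x} \<in> E" "x \<in> U" using x ab vab by auto
  define \<tau> where "\<tau> = \<rho>({a, b} := x)"
  show ?thesis
  proof (rule that[of \<tau>]; intro ballI allI)
    fix e assume "e \<in> insert {a, b} {e\<in>E. v \<notin> e}"
    then show "\<tau> e \<in> e \<inter> (U - {v})"
      using x(1) vab \<rho>(1)[of e] card2[of e] by (auto simp: \<tau>_def)
  next
    fix u
    have finE: "finite {e\<in>E. \<rho> e = u}" using fin by simp
    show "card {e\<in>insert {a, b} {e\<in>E. v \<notin> e}. \<tau> e = u} \<le> t"
    proof (cases "u \<in> U")
      case False
      have "\<tau> e \<noteq> u" if "e \<in> insert {a, b} {e\<in>E. v \<notin> e}" for e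
        using that False x(1) vab \<rho>(1)[of e] card2[of e] by (auto simp: \<tau>_def)
      then have "{e\<in>insert {a, b} {e\<in>E. v \<notin> e}. \<tau> e = u} = {}" by blast
      then show ?thesis by (simp only: card.empty)
    next
      case True
      show ?thesis
      proof (cases "u = x")
        case True
        \<comment> \<open>\<open>x\<close> gains the edge \<open>a b\<close> but loses
          \<open>v x\<close>.\<close>
        have "{e\<in>insert {a, b} {e\<in>E. v \<notin> e}. \<tau> e = u} \<subseteq> insert {a, b} ({e\<in>E. \<rho> e = u} - {{v, x}})"
          by (auto simp: \<tau>_def split: if_splits)
        then have "card {e\<in>insert {a, b} {e\<in>E. v \<notin> e}. \<tau> e = u} \<le> card (insert {a, b} ({e\<in>E. \<rho> e = u} - {{v, x}}))"
          using finE by (intro card_mono) auto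
        also have "\<dots> \<le> Suc (card ({e\<in>E. \<rho> e = u} - {{v, x}}))" by (rule card_insert_le_m1) simp_all
        also have "\<dots> = card {e\<in>E. \<rho> e = u}"
          using True vx x(2) finE by (intro card_Suc_Diff1) auto
        finally show ?thesis using \<rho>(2)[OF \<open>u \<in> U\<close>] by simp
      next
        case False
        have "{e\<in>insert {a, b} {e\<in>E. v \<notin> e}. \<tau> e = u} \<subseteq> {e\<in>E. \<rho> e = u}"
          using False by (auto simp: \<tau>_def split: if_splits)
        from card_mono[OF finE this] show ?thesis unfolding \<rho>(2)[OF \<open>u \<in> U\<close>] .
      qed
    qed
  qed
qed

text \<open>The vertices outside \<open>U\<close> are pinned: their columns are ignored.\<close>

theorem independent_framework_exists:
  fixes U :: "'v set"
  assumes "finite U" "finite E" "\<And>e. e \<in> E \<Longrightarrow> card e = 2" "\<And>e. e \<in> E \<Longrightarrow> \<sigma> e \<in> e \<inter> U"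
    and "\<And>u. card {e\<in>E. \<sigma> e = u} \<le> t"
    and "2 * t \<le> CARD('d::finite) \<or>
      CARD('d) = 2 * t - 1 \<and> 2 \<le> t \<and> (\<forall>X. complete_on E X \<longrightarrow> card X \<noteq> 2 * t + 1)"
  obtains p :: "'v \<Rightarrow> real^'d" and q where
    "indep_on U (E <+> Sigma U (\<lambda>u. {..<CARD('d) - card {e\<in>E. \<sigma> e = u}})) (frow fst p q)"
proof -
  have "\<exists>(p :: 'v \<Rightarrow> real^'d) q.
    indep_on U (E <+> Sigma U (\<lambda>u. {..<CARD('d) - card {e\<in>E. \<sigma> e = u}})) (frow fst p q)"
    using assms
  proof (induction "card U" arbitrary: U E \<sigma> rule: less_induct)
    case less
    note fin = less.prems(1,2) and card2 = less.prems(3) and \<sigma> = less.prems(4) and indeg = less.prems(5)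
    define n where "n u = CARD('d) - card {e\<in>E. \<sigma> e = u}" for u
    \<comment> \<open>Only the edges received by \<open>v\<close> disappear. Those leaving
      \<open>v\<close> stay, now with a pinned end, and the indegrees at the other vertices do not
      change.\<close>
    have pin: "\<exists>(p :: 'v \<Rightarrow> real^'d) q. indep_on (U - {v}) ((E - {e\<in>E. \<sigma> e = v}) <+>
        Sigma (U - {v}) (\<lambda>u. {..<n u})) (frow fst p q)" if v: "v \<in> U" for v
    proof -
      let ?E = "E - {e\<in>E. \<sigma> e = v}"
      have sub: "{e\<in>?E. \<sigma> e = u} \<subseteq> {e\<in>E. \<sigma> e = u}" for u by auto
      have "\<exists>(p :: 'v \<Rightarrow> real^'d) q. indep_on (U - {v}) (?E <+>
        Sigma (U - {v}) (\<lambda>u. {..<CARD('d) - card {e\<in>?E. \<sigma> e = u}})) (frow fst p q)"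
      proof (rule less.hyps)
        show "card (U - {v}) < card U" using v fin by (simp add: card_Diff1_less del: card_Diff_insert)
        show "card {e\<in>?E. \<sigma> e = u} \<le> t" for u
          by (rule order_trans[OF card_mono[OF _ sub] indeg]) (use fin in simp)
        show "2 * t \<le> CARD('d) \<or>
            CARD('d) = 2 * t - 1 \<and> 2 \<le> t \<and> (\<forall>X. complete_on ?E X \<longrightarrow> card X \<noteq> 2 * t + 1)"
          using less.prems(6) complete_on_mono[of ?E _ E] by blast
      qed (use fin card2 \<sigma> in auto)
      moreover have "{e\<in>?E. \<sigma> e = u} = {e\<in>E. \<sigma> e = u}" if "u \<in> U - {v}" for u using that by auto
      then have "Sigma (U - {v}) (\<lambda>u. {..<CARD('d) - card {e\<in>?E. \<sigma> e = u}}) = Sigma (U - {v}) (\<lambda>u. {..<n u})"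
        unfolding n_def by (intro Sigma_cong) auto
      ultimately show ?thesis by simp
    qed
    have cE: "card E = (\<Sum>u\<in>U. card {e\<in>E. \<sigma> e = u})"
    proof -
      have "{u\<in>U. \<sigma> e = u} = {\<sigma> e}" if "e \<in> E" for e using \<sigma>[OF that] by auto
      then show ?thesis unfolding sum_incidences[OF fin, of "\<lambda>u e. \<sigma> e = u"] by simp
    qed
    have cE_le: "card E \<le> t * card U"
      using sum_bounded_above[of U "\<lambda>u. card {e\<in>E. \<sigma> e = u}" t] indeg by (simp add: cE mult.commute)
    have inc: "card {u\<in>U. u \<in> e} \<le> 2" if "e \<in> E" for e
      using card_mono[of e "{u\<in>U. u \<in> e}"] card2[OF that] by (metis (no_types, lifting) card.infinite mem_Collect_eq subsetI zero_neq_numeral)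
    have degsum: "(\<Sum>u\<in>U. card {e\<in>E. u \<in> e}) = (\<Sum>e\<in>E. card {u\<in>U. u \<in> e})"
      by (rule sum_incidences[OF fin])
    have degsum_le: "(\<Sum>e\<in>E. card {u\<in>U. u \<in> e}) \<le> 2 * card E"
      using sum_bounded_above[of E "\<lambda>e. card {u\<in>U. u \<in> e}" 2] inc by (simp add: mult.commute)
    show ?case
    proof (cases "U = {}")
      case True
      then have "E = {}" using \<sigma> by blast
      then show ?thesis using True by (simp add: indep_on_def Plus_def)
    next
      case ne: False
      show ?thesis
      proof (cases "\<exists>v\<in>U. card {e\<in>E. v \<in> e} \<le> CARD('d)")
        case True
        then obtain v where v: "v \<in> U" "card {e\<in>E. v \<in> e} \<le> CARD('d)" by blast
        define S where "S = {e\<in>E. v \<in> e}"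
        obtain p\<^sub>1 :: "'v \<Rightarrow> real^'d" and q\<^sub>1 where
          1: "indep_on (U - {v}) ((E - {e\<in>E. \<sigma> e = v}) <+> Sigma (U - {v}) (\<lambda>u. {..<n u})) (frow fst p\<^sub>1 q\<^sub>1)"
          using pin[OF v(1)] by blast
        have finS: "finite S" using fin by (simp add: S_def)
        obtain p\<^sub>2 :: "'v \<Rightarrow> real^'d" where 2: "indep_on {v} S (edge_vec p\<^sub>2)"
          using independent_star_exists[of S v] finS v(2) card2
          unfolding S_def by (metis (no_types, lifting) mem_Collect_eq)
        have 2: "indep_on {v} (Inl ` S) (frow fst p\<^sub>2 q\<^sub>1)"
          using 2 by (subst indep_on_reindex) auto
        have f: "finite ((E - {e\<in>E. \<sigma> e = v}) <+> Sigma (U - {v}) (\<lambda>u. {..<n u}))"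
          using fin by simp
        obtain s q where
          3: "indep_on (U - {v}) ((E - {e\<in>E. \<sigma> e = v}) <+> Sigma (U - {v}) (\<lambda>u. {..<n u}))
            (frow fst (\<lambda>x. p\<^sub>1 x + s *\<^sub>R (p\<^sub>2 x - p\<^sub>1 x)) q)" and
          4: "indep_on {v} (Inl ` S) (frow fst (\<lambda>x. p\<^sub>1 x + s *\<^sub>R (p\<^sub>2 x - p\<^sub>1 x)) q)"
          by (rule frow_common_point[OF f 1 finite_imageI[OF finS] 2])
        have 4: "indep_on {v} S (edge_vec (\<lambda>x. p\<^sub>1 x + s *\<^sub>R (p\<^sub>2 x - p\<^sub>1 x)))"
          using 4 by (subst (asm) indep_on_reindex) auto
        have In: "{e\<in>E. \<sigma> e = v} \<subseteq> {e\<in>E. v \<in> e}" using \<sigma> by auto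
        show ?thesis
          using pin_vertex[OF fin v(1) In 3 4[unfolded S_def]] unfolding n_def by blast
      next
        case False
        \<comment> \<open>Every degree is now at least \<open>d + 1\<close>, while the degrees sum
          to at most \<open>2 * card E\<close>, hence to at most \<open>2 * t * card U\<close>. This
          rules out \<open>2 * t <= d\<close>, and for \<open>d = 2 * t - 1\<close> it turns all
          these estimates into equalities.\<close>
        then have big: "card {e\<in>E. u \<in> e} \<ge> CARD('d) + 1" if "u \<in> U" for u using that by force
        have "card U > 0" using ne fin by (simp add: card_gt_0_iff)
        have "card U * (CARD('d) + 1) \<le> (\<Sum>u\<in>U. card {e\<in>E. u \<in> e})"
          using sum_bounded_below[of U "CARD('d) + 1" "\<lambda>u. card {e\<in>E. u \<in> e}"] big by simp
        then have le: "card U * (CARD('d) + 1) \<le> 2 * card E" using degsum degsum_le by linarith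
        have "\<not> 2 * t \<le> CARD('d)"
        proof
          assume "2 * t \<le> CARD('d)"
          then have "card U * (2 * t + 1) \<le> card U * (CARD('d) + 1)" by (intro mult_left_mono) auto
          moreover have "card U * (2 * t + 1) = 2 * (t * card U) + card U" by (simp add: algebra_simps)
          ultimately show False using le cE_le \<open>card U > 0\<close> by linarith
        qed
        then have d: "CARD('d) = 2 * t - 1" "2 \<le> t"
          and free: "\<And>X. complete_on E X \<Longrightarrow> card X \<noteq> 2 * t + 1"
          using less.prems(6) by auto
        have d1: "CARD('d) + 1 = 2 * t" using d by simp
        have cE_eq: "card E = t * card U" using le cE_le unfolding d1 by (simp add: algebra_simps)
        have indeg_eq: "card {e\<in>E. \<sigma> e = u} = t" if "u \<in> U" for u
          using sum_mono_inv[of "\<lambda>u. card {e\<in>E. \<sigma> e = u}" U "\<lambda>_. t" u] that fin cE cE_eq indeg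
          by (simp add: mult.commute)
        have degs: "(\<Sum>u\<in>U. card {e\<in>E. u \<in> e}) = 2 * (t * card U)"
          using \<open>card U * (CARD('d) + 1) \<le> (\<Sum>u\<in>U. card {e\<in>E. u \<in> e})\<close> degsum degsum_le
          unfolding d1 cE_eq by (simp add: algebra_simps)
        have deg_eq: "card {e\<in>E. u \<in> e} = 2 * t" if "u \<in> U" for u
          using sum_mono_inv[of "\<lambda>_. 2 * t" U "\<lambda>u. card {e\<in>E. u \<in> e}" u] that fin degs big d1
          by (simp add: mult.commute mult.left_commute)
        have "card {u\<in>U. u \<in> e} = 2" if "e \<in> E" for e
          using sum_mono_inv[of "\<lambda>e. card {u\<in>U. u \<in> e}" E "\<lambda>_. 2" e] that fin inc degs degsum cE_eq
          by (simp add: mult.commute)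
        \<comment> \<open>Equality in the degree sum leaves no edge with a pinned end.\<close>
        then have EU: "e \<subseteq> U" if "e \<in> E" for e
        proof -
          have "{u\<in>U. u \<in> e} \<subseteq> e" "finite e" "card {u\<in>U. u \<in> e} = card e"
            using that card2[OF that] \<open>\<And>e. e \<in> E \<Longrightarrow> card {u\<in>U. u \<in> e} = 2\<close> card.infinite by force+
          then have "{u\<in>U. u \<in> e} = e" by (meson card_subset_eq)
          then show ?thesis by blast
        qed
        have reg: "card {e\<in>E. x \<in> e} = 2 * t" if "e \<in> E" "x \<in> e" for e x
          using that EU deg_eq by blast
        have card2_EU: "card e = 2 \<and> e \<subseteq> U" if "e \<in> E" for e using that card2 EU by blast
        have \<sigma>_in: "\<sigma> e \<in> e" if "e \<in> E" for e using that \<sigma> by blast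
        obtain v where v: "v \<in> U" using ne by blast
        obtain a b where ab: "{v, a} \<in> E" "{v, b} \<in> E" "{a, b} \<notin> E" "a \<noteq> b"
          and free': "\<forall>X. complete_on (insert {a, b} {e\<in>E. v \<notin> e}) X \<longrightarrow> card X \<noteq> 2 * t + 1"
          by (rule reducible_pair_exists[OF fin(2) card2 d(2) reg deg_eq[OF v] free])
        obtain \<tau> where \<tau>: "\<forall>e\<in>insert {a, b} {e\<in>E. v \<notin> e}. \<tau> e \<in> e \<inter> (U - {v})"
          "\<forall>u. card {e\<in>insert {a, b} {e\<in>E. v \<notin> e}. \<tau> e = u} \<le> t"
          by (rule reduced_orientation_exists[OF fin(2) card2_EU deg_eq \<sigma>_in indeg_eq ab])
        have n_eq: "n u = t - 1" if "u \<in> U" for u using indeg_eq[OF that] d by (simp add: n_def)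
        have Sig: "Sigma (U - {v}) (\<lambda>u. {..<n u}) = (U - {v}) \<times> {..<t-1}" "Sigma U (\<lambda>u. {..<n u}) = U \<times> {..<t-1}"
          using n_eq by auto
        obtain p\<^sub>1 :: "'v \<Rightarrow> real^'d" and q\<^sub>1 where
          1: "indep_on (U - {v}) ((E - {e\<in>E. \<sigma> e = v}) <+> (U - {v}) \<times> {..<t-1}) (frow fst p\<^sub>1 q\<^sub>1)"
          using pin[OF v] unfolding Sig by blast
        have "\<exists>(p :: 'v \<Rightarrow> real^'d) q. indep_on (U - {v}) (insert {a, b} {e\<in>E. v \<notin> e} <+> Sigma (U - {v})
            (\<lambda>u. {..<CARD('d) - card {e\<in>insert {a, b} {e\<in>E. v \<notin> e}. \<tau> e = u}})) (frow fst p q)"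
        proof (rule less.hyps)
          show "card (U - {v}) < card U" using v fin by (simp add: card_Diff1_less del: card_Diff_insert)
          show "card e = 2" if "e \<in> insert {a, b} {e\<in>E. v \<notin> e}" for e
            using that card2 ab(4) by auto
          show "2 * t \<le> CARD('d) \<or> CARD('d) = 2 * t - 1 \<and> 2 \<le> t \<and>
              (\<forall>X. complete_on (insert {a, b} {e\<in>E. v \<notin> e}) X \<longrightarrow> card X \<noteq> 2 * t + 1)"
            using d free' by blast
        qed (use fin \<tau> in auto)
        then obtain p\<^sub>2 :: "'v \<Rightarrow> real^'d" and q\<^sub>2 where
          2: "indep_on (U - {v}) (insert {a, b} {e\<in>E. v \<notin> e} <+> Sigma (U - {v})
            (\<lambda>u. {..<CARD('d) - card {e\<in>insert {a, b} {e\<in>E. v \<notin> e}. \<tau> e = u}})) (frow fst p\<^sub>2 q\<^sub>2)"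
          by blast
        \<comment> \<open>Indegree at most \<open>t\<close> guarantees \<open>d - t = t - 1\<close>
          loops at every vertex; any further ones are dropped.\<close>
        have "t - 1 \<le> CARD('d) - card {e\<in>insert {a, b} {e\<in>E. v \<notin> e}. \<tau> e = u}" for u
          using \<tau>(2)[rule_format, of u] d by linarith
        then have "(U - {v}) \<times> {..<t-1} \<subseteq> Sigma (U - {v})
            (\<lambda>u. {..<CARD('d) - card {e\<in>insert {a, b} {e\<in>E. v \<notin> e}. \<tau> e = u}})"
          by (intro Sigma_mono) (auto simp del: insert_iff)
        then have 2: "indep_on (U - {v}) (insert {a, b} {e\<in>E. v \<notin> e} <+> (U - {v}) \<times> {..<t-1}) (frow fst p\<^sub>2 q\<^sub>2)"
          using fin by (intro indep_on_mono[OF 2]) auto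
        have In: "{e\<in>E. \<sigma> e = v} \<subseteq> {e\<in>E. v \<in> e}" using \<sigma> by auto
        have "\<exists>(p :: 'v \<Rightarrow> real^'d) q. indep_on U (E <+> U \<times> {..<t-1}) (frow fst p q)"
          by (rule regular_step[OF fin card2_EU v _ d(1) deg_eq[OF v] cE_eq In indeg_eq[OF v] ab 1 2])
            (use d(2) in auto)
        then show ?thesis unfolding Sig(2)[symmetric] n_def .
      qed
    qed
  qed
  then show ?thesis using that by blast
qed

section \<open>Sparse sets and covers\<close>

definition induced :: "('x \<Rightarrow> 'v set) \<Rightarrow> 'x set \<Rightarrow> 'v set \<Rightarrow> 'x set" where
  "induced ends F X = {x\<in>F. ends x \<subseteq> X}"

lemma finite_induced [simp]: "finite F \<Longrightarrow> finite (induced ends F X)"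
  by (simp add: induced_def)

text \<open>An element inside \<open>X\<close> or \<open>Y\<close> is inside the union, and one
  inside both is inside the intersection.\<close>

lemma card_induced_supermodular:
  assumes "finite F"
  shows "card (induced ends F X) + card (induced ends F Y) \<le>
    card (induced ends F (X \<inter> Y)) + card (induced ends F (X \<union> Y))"
proof -
  have "card (induced ends F X) + card (induced ends F Y) =
      card (induced ends F X \<union> induced ends F Y) + card (induced ends F X \<inter> induced ends F Y)"
    using assms by (intro card_Un_Int) auto
  also have "induced ends F X \<inter> induced ends F Y = induced ends F (X \<inter> Y)"
    by (auto simp: induced_def)
  also have "card (induced ends F X \<union> induced ends F Y) \<le> card (induced ends F (X \<union> Y))"
    using assms by (intro card_mono) (auto simp: induced_def)
  finally show ?thesis by simp
qed

text \<open>If neither end of an element could receive it, the two blocking tight sets would have an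
  overfull union.\<close>

lemma orientation_exists:
  assumes "finite F" "finite V" "\<And>x. x \<in> F \<Longrightarrow> ends x \<subseteq> V \<and> (\<exists>u v. ends x = {u, v})"
    and "\<And>X. X \<subseteq> V \<Longrightarrow> card (induced ends F X) \<le> sum b X"
  shows "\<exists>\<sigma>. (\<forall>x\<in>F. \<sigma> x \<in> ends x) \<and> (\<forall>v. card {x\<in>F. \<sigma> x = v} \<le> b v)"
  using assms(1,3,4)
proof (induction F arbitrary: b rule: finite_induct)
  case empty
  then show ?case by simp
next
  case (insert x F)
  obtain u v where uv: "ends x = {u, v}" "u \<in> V" "v \<in> V" using insert.prems(1)[of x] by auto
  have ind_insert: "card (induced ends (insert x F) X) =
      card (induced ends F X) + (if ends x \<subseteq> X then 1 else 0)" for X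
  proof -
    have "induced ends (insert x F) X = (if ends x \<subseteq> X then insert x (induced ends F X) else induced ends F X)"
      by (auto simp: induced_def)
    then show ?thesis using insert.hyps by (auto simp: induced_def)
  qed
  have le: "card (induced ends F X) + (if ends x \<subseteq> X then 1 else 0) \<le> sum b X" if "X \<subseteq> V" for X
    using insert.prems(2)[OF that] ind_insert by simp
  have "\<exists>w\<in>{u, v}. b w > 0 \<and> (\<forall>X\<subseteq>V. card (induced ends F X) \<le> sum (b(w := b w - 1)) X)"
  proof (rule ccontr)
    assume contra: "\<not> ?thesis"
    \<comment> \<open>\<open>w\<close> is prevented from receiving \<open>x\<close> by a set through
      \<open>w\<close> whose capacity is used up; if \<open>b w = 0\<close>, this set is
      \<open>{w}\<close>.\<close>
    have tight: "\<exists>X\<subseteq>V. w \<in> X \<and> sum b X \<le> card (induced ends F X)" if w: "w \<in> {u, v}" for w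
    proof (cases "b w = 0")
      case True
      then show ?thesis using w uv by (intro exI[of _ "{w}"]) auto
    next
      case False
      then obtain X where X: "X \<subseteq> V" "sum (b(w := b w - 1)) X < card (induced ends F X)"
        using contra w by (auto simp: not_le)
      have finX: "finite X" using X assms(2) finite_subset by blast
      have "w \<in> X"
      proof (rule ccontr)
        assume "w \<notin> X"
        then have "sum (b(w := b w - 1)) X = sum b X" by (intro sum.cong) auto
        then show False using X le[OF X(1)] by simp
      qed
      moreover from this have "sum (b(w := b w - 1)) X + 1 = sum b X"
        using finX False by (simp add: sum.remove[of X w])
      ultimately show ?thesis using X by (intro exI[of _ X]) auto
    qed
    obtain X where X: "X \<subseteq> V" "u \<in> X" "sum b X \<le> card (induced ends F X)" using tight by blast
    obtain Y where Y: "Y \<subseteq> V" "v \<in> Y" "sum b Y \<le> card (induced ends F Y)" using tight by blast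
    have fin: "finite X" "finite Y" using X Y assms(2) finite_subset by blast+
    have "sum b X + sum b Y = sum b (X \<inter> Y) + sum b (X \<union> Y)"
      using sum.union_inter[OF fin, of b] by simp
    moreover have "card (induced ends F (X \<inter> Y)) \<le> sum b (X \<inter> Y)"
      using add_leD1[OF le[of "X \<inter> Y"]] X by auto
    moreover have "card (induced ends F (X \<union> Y)) + 1 \<le> sum b (X \<union> Y)"
      using le[of "X \<union> Y"] X Y uv by auto
    ultimately show False
      using X(3) Y(3) card_induced_supermodular[OF insert.hyps(1), of ends X Y] by linarith
  qed
  then obtain w where w: "w \<in> {u, v}" "b w > 0"
    "\<And>X. X \<subseteq> V \<Longrightarrow> card (induced ends F X) \<le> sum (b(w := b w - 1)) X" by blast
  obtain \<sigma> where \<sigma>: "\<forall>x\<in>F. \<sigma> x \<in> ends x" "\<And>z. card {x\<in>F. \<sigma> x = z} \<le> (b(w := b w - 1)) z"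
    using insert.IH[of "b(w := b w - 1)"] insert.prems(1) w(3) by blast
  have "card {y\<in>insert x F. (\<sigma>(x := w)) y = z} \<le> b z" for z
  proof (cases "z = w")
    case True
    have "{y\<in>insert x F. (\<sigma>(x := w)) y = z} = insert x {y\<in>F. \<sigma> y = w}" using True insert.hyps by auto
    then show ?thesis using \<sigma>(2)[of w] True w(2) insert.hyps by simp
  next
    case False
    have "{y\<in>insert x F. (\<sigma>(x := w)) y = z} = {y\<in>F. \<sigma> y = z}" using False insert.hyps by auto
    then show ?thesis using \<sigma>(2)[of z] False by simp
  qed
  moreover have "\<forall>y\<in>insert x F. (\<sigma>(x := w)) y \<in> ends y" using \<sigma>(1) w(1) uv by auto
  ultimately show ?case by blast
qed

section \<open>Complete graphs, tight sets and the covers they yield\<close>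

definition pairs :: "'v set \<Rightarrow> 'v set set" where
  "pairs X = {e. e \<subseteq> X \<and> card e = 2}"

lemma finite_pairs [simp]: "finite X \<Longrightarrow> finite (pairs X)"
  by (simp add: pairs_def)

lemma card_pairs: "finite X \<Longrightarrow> 2 * card (pairs X) = card X * (card X - 1)"
  by (cases "card X") (auto simp: pairs_def n_subsets choose_two)

text \<open>The complete graph on \<open>2 t + 1\<close> vertices attains the sparsity bound, so
  sparsity does not exclude it.\<close>

lemma card_pairs_odd: "card X = 2 * t + 1 \<Longrightarrow> card (pairs X) = t * (2 * t + 1)"
  using card_pairs[of X] card.infinite[of X] by (cases "finite X") auto

lemma complete_on_iff_pairs: "complete_on E X \<longleftrightarrow> pairs X \<subseteq> E"
proof
  show "complete_on E X \<Longrightarrow> pairs X \<subseteq> E"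
    unfolding complete_on_def pairs_def by (auto simp: card_2_iff)
  assume *: "pairs X \<subseteq> E"
  have "{x, y} \<in> pairs X" if "x \<in> X" "y \<in> X" "x \<noteq> y" for x y using that by (simp add: pairs_def)
  then show "complete_on E X" using * unfolding complete_on_def by blast
qed

definition graph_ends :: "('v, 'l) looped_graph \<Rightarrow> 'v set + 'l \<Rightarrow> 'v set" where
  "graph_ends G x = (case x of Inl e \<Rightarrow> e | Inr l \<Rightarrow> {loop_at G l})"

lemma graph_ends_simps [simp]:
  "graph_ends G (Inl e) = e" "graph_ends G (Inr l) = {loop_at G l}"
  by (simp_all add: graph_ends_def)

definition sparse :: "nat \<Rightarrow> ('v, 'l) looped_graph \<Rightarrow> ('v set + 'l) set \<Rightarrow> bool" where
  "sparse t G F \<longleftrightarrow> (\<forall>X\<subseteq>verts G. card (induced (graph_ends G) F X) \<le> t * card X)"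

locale looped_graph_context =
  fixes G :: "('v, 'l) looped_graph" and t :: nat
  assumes graph: "looped_simple_graph G" and t_pos: "t > 0"
begin

abbreviation "V \<equiv> verts G"
abbreviation "ends \<equiv> graph_ends G"
abbreviation "ind \<equiv> induced ends"

lemma finite_V: "finite V" using graph by (simp add: looped_simple_graph_def)

lemma finite_edges: "finite (edges G)"
  using graph finite_subset[of "edges G" "Pow V"] by (auto simp: looped_simple_graph_def)

lemma finite_ground: "finite (ground G)"
  using graph finite_edges by (simp add: ground_def looped_simple_graph_def)

lemma ends_ground:
  assumes "x \<in> ground G"
  shows "ends x \<subseteq> V" "\<exists>u v. ends x = {u, v}" "ends x \<noteq> {}"
proof -
  have "ends x \<subseteq> V \<and> (\<exists>u v. ends x = {u, v})"
  proof (cases x)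
    case (Inl e)
    then have "e \<subseteq> V" "card e = 2" using assms graph by (auto simp: ground_def looped_simple_graph_def)
    then show ?thesis using Inl by (auto simp: card_2_iff)
  next
    case (Inr l)
    then have "loop_at G l \<in> V" using assms graph by (auto simp: ground_def looped_simple_graph_def)
    then show ?thesis using Inr by auto
  qed
  then show "ends x \<subseteq> V" "\<exists>u v. ends x = {u, v}" "ends x \<noteq> {}" by auto
qed

lemma card_edge: "Inl e \<in> ground G \<Longrightarrow> card e = 2 \<and> e \<subseteq> V"
  using graph by (auto simp: ground_def looped_simple_graph_def)

lemma exists_maximal:
  assumes "P {}" "\<And>F. P F \<Longrightarrow> F \<subseteq> ground G"
  obtains F where "P F" "\<And>x. x \<in> ground G - F \<Longrightarrow> \<not> P (insert x F)"
proof -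
  have "\<exists>F. P F \<and> (\<forall>F'. P F' \<longrightarrow> card F' \<le> card F)"
    using assms finite_ground
    by (intro ex_has_greatest_nat[of P "{}" card "card (ground G) + 1"]) (auto simp: less_Suc_eq_le intro: card_mono)
  then obtain F where F: "P F" "\<And>F'. P F' \<Longrightarrow> card F' \<le> card F" by blast
  have "finite F" using assms(2)[OF F(1)] finite_ground finite_subset by blast
  then have "\<not> P (insert x F)" if "x \<in> ground G - F" for x
    using F(2)[of "insert x F"] that by auto
  then show ?thesis using that F(1) by blast
qed

text \<open>Tight sets are closed under union, because the left side of the sparsity condition is
  supermodular and \<open>t * card X\<close> is modular. So a tight set of largest size contains all
  the others.\<close>

lemma maximal_tight_set:
  assumes F: "F \<subseteq> ground G" "sparse t G F"
  obtains R where "R \<subseteq> V" "card (ind F R) = t * card R"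
    "\<And>X. X \<subseteq> V \<Longrightarrow> \<not> X \<subseteq> R \<Longrightarrow> card (ind F X) < t * card X"
proof -
  let ?tight = "\<lambda>X. X \<subseteq> V \<and> card (ind F X) = t * card X"
  have finF: "finite F" using F(1) finite_ground finite_subset by blast
  have sp: "card (ind F X) \<le> t * card X" if "X \<subseteq> V" for X
    using F(2) that by (simp add: sparse_def)
  have "ind F {} = {}" using F(1) ends_ground by (auto simp: induced_def)
  then have "?tight {}" by simp
  then have "\<exists>R. ?tight R \<and> (\<forall>X. ?tight X \<longrightarrow> card X \<le> card R)"
    using finite_V by (intro ex_has_greatest_nat[of ?tight "{}" card "card V + 1"])
      (auto simp: less_Suc_eq_le intro: card_mono)
  then obtain R where R: "?tight R" "\<And>X. ?tight X \<Longrightarrow> card X \<le> card R" by blast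
  show ?thesis
  proof (rule that[of R])
    fix X assume X: "X \<subseteq> V" "\<not> X \<subseteq> R"
    have fin: "finite X" "finite R" using X R(1) finite_V finite_subset by blast+
    show "card (ind F X) < t * card X"
    proof (rule ccontr)
      assume "\<not> card (ind F X) < t * card X"
      then have "card (ind F X) = t * card X" using sp[OF X(1)] by simp
      moreover have "card X + card R = card (X \<union> R) + card (X \<inter> R)" by (rule card_Un_Int[OF fin])
      then have "t * card X + t * card R = t * card (X \<union> R) + t * card (X \<inter> R)"
        by (simp add: distrib_left[symmetric])
      moreover have "card (ind F (X \<inter> R)) \<le> t * card (X \<inter> R)" "card (ind F (X \<union> R)) \<le> t * card (X \<union> R)"
        using sp[of "X \<inter> R"] sp[of "X \<union> R"] X R(1) by auto
      ultimately have "card (ind F (X \<union> R)) = t * card (X \<union> R)"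
        using R(1) card_induced_supermodular[OF finF, of ends X R] by linarith
      then have "card (X \<union> R) \<le> card R" using R X by auto
      then show False using X(2) fin card_seteq[of "X \<union> R" R] by auto
    qed
  qed (use R in auto)
qed

text \<open>A set violating sparsity after the insertion contains the ends of \<open>x\<close> and
  was tight before, so it lies inside \<open>R\<close>.\<close>

lemma not_sparse_insertD:
  assumes F: "F \<subseteq> ground G" "sparse t G F" and "x \<notin> F"
    and R: "\<And>X. X \<subseteq> V \<Longrightarrow> \<not> X \<subseteq> R \<Longrightarrow> card (ind F X) < t * card X"
    and "\<not> sparse t G (insert x F)"
  shows "ends x \<subseteq> R"
proof -
  have finF: "finite F" using F(1) finite_ground finite_subset by blast
  obtain X where X: "X \<subseteq> V" "t * card X < card (ind (insert x F) X)"
    using assms(5) by (auto simp: sparse_def not_le)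
  have sub: "ends x \<subseteq> X"
  proof (rule ccontr)
    assume "\<not> ends x \<subseteq> X"
    then have "ind (insert x F) X = ind F X" by (auto simp: induced_def)
    then show False using X F(2) by (auto simp: sparse_def not_le[symmetric])
  qed
  have "ind (insert x F) X \<subseteq> insert x (ind F X)" by (auto simp: induced_def)
  then have "card (ind (insert x F) X) \<le> card (insert x (ind F X))"
    using finF by (intro card_mono) auto
  also have "\<dots> \<le> Suc (card (ind F X))" using finF by (simp add: card_insert_if)
  finally have "card (ind (insert x F) X) \<le> Suc (card (ind F X))" .
  then have "X \<subseteq> R" using R[OF X(1)] X(2) by linarith
  then show ?thesis using sub by blast
qed

text \<open>For a maximal sparse \<open>F\<close>, the largest tight set \<open>R\<close> covers
  everything outside \<open>F\<close>. The elements of \<open>F\<close> not inside \<open>R\<close>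
  form \<open>T\<close>, and tightness counts the rest.\<close>

lemma sparse_cover_exists:
  obtains F T X where "F \<subseteq> ground G" "sparse t G F" "T \<subseteq> ground G" "is_cover (remove G T) 0 X"
    "int (card F) = cover_value t T 0 X"
proof -
  obtain F where F: "F \<subseteq> ground G \<and> sparse t G F"
    and max: "\<And>x. x \<in> ground G - F \<Longrightarrow> \<not> (insert x F \<subseteq> ground G \<and> sparse t G (insert x F))"
    by (rule exists_maximal[of "\<lambda>F. F \<subseteq> ground G \<and> sparse t G F"]) (auto simp: sparse_def induced_def)
  obtain R where R: "R \<subseteq> V" "card (ind F R) = t * card R"
    "\<And>X. X \<subseteq> V \<Longrightarrow> \<not> X \<subseteq> R \<Longrightarrow> card (ind F X) < t * card X"
    using maximal_tight_set F by blast
  have finF: "finite F" using F finite_ground finite_subset by blast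
  define T where "T = F - ind F R"
  have outside: "ends x \<subseteq> R" if "x \<in> ground G - T" for x
  proof (cases "x \<in> F")
    case True
    then show ?thesis using that by (simp add: T_def induced_def)
  next
    case False
    then show ?thesis using not_sparse_insertD[of F x R] F R(3) max that by blast
  qed
  have "is_cover (remove G T) 0 (\<lambda>_. R)"
    unfolding is_cover_def
  proof (intro conjI allI impI ballI)
    fix e assume "e \<in> edges (remove G T)"
    then have "Inl e \<in> ground G - T" by (auto simp: remove_def ground_def)
    then show "\<exists>j\<le>0::nat. e \<subseteq> R" using outside[of "Inl e"] by auto
  next
    fix l assume "l \<in> loops (remove G T)"
    then have "Inr l \<in> ground G - T" by (auto simp: remove_def ground_def)
    then show "\<exists>j\<le>0::nat. loop_at (remove G T) l \<in> R" using outside[of "Inr l"] by (auto simp: remove_def)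
  qed (use R(1) in \<open>simp add: remove_def\<close>)
  moreover have sub: "ind F R \<subseteq> F" by (auto simp: induced_def)
  then have "card F = card T + t * card R"
    unfolding T_def R(2)[symmetric] using card_mono[OF finF sub] finF by (simp add: card_Diff_subset)
  then have "int (card F) = cover_value t T 0 (\<lambda>_. R)" by (simp add: cover_value_def)
  ultimately show ?thesis using that[of F T "\<lambda>_. R"] F by (auto simp: T_def)
qed

text \<open>With \<open>F\<close> maximal, an element not inside \<open>R\<close> can only be
  blocked by completing a clique on \<open>2 t + 1\<close> vertices. On that set \<open>F\<close>
  induces the complete graph minus one edge, which is \<open>t * card Y - 1\<close> elements. These
  near-cliques become the members of the cover other than \<open>R\<close>.\<close>

lemma clique_free_sparse_cover_exists:
  assumes t2: "t \<ge> 2"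
  obtains F T k X where "F \<subseteq> ground G" "sparse t G F"
    "\<And>X. complete_on {e. Inl e \<in> F} X \<Longrightarrow> card X \<noteq> 2 * t + 1"
    "T \<subseteq> ground G" "admissible_cover t G T k X" "non_intersecting k X"
    "int (card F) = cover_value t T k X"
proof -
  define free where "free F \<longleftrightarrow> (\<forall>X. complete_on {e. Inl e \<in> F} X \<longrightarrow> card X \<noteq> 2 * t + 1)"
    for F :: "('v set + 'l) set"
  have "free {}"
    unfolding free_def complete_on_iff_pairs using card_pairs_odd t_pos by fastforce
  then obtain F where F: "F \<subseteq> ground G \<and> sparse t G F \<and> free F"
    and max: "\<And>x. x \<in> ground G - F \<Longrightarrow> \<not> (insert x F \<subseteq> ground G \<and> sparse t G (insert x F) \<and> free (insert x F))"
    by - (rule exists_maximal[of "\<lambda>F. F \<subseteq> ground G \<and> sparse t G F \<and> free F"];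
      auto simp: sparse_def induced_def)
  obtain R where R: "R \<subseteq> V" "card (ind F R) = t * card R"
    "\<And>X. X \<subseteq> V \<Longrightarrow> \<not> X \<subseteq> R \<Longrightarrow> card (ind F X) < t * card X"
    using maximal_tight_set F by blast
  have finF: "finite F" using F finite_ground finite_subset by blast
  \<comment> \<open>Near-cliques inside \<open>R\<close> are already covered by
    \<open>R\<close>.\<close>
  define \<Y> where "\<Y> = {Y. Y \<subseteq> V \<and> card Y = 2 * t + 1 \<and> \<not> Y \<subseteq> R \<and>
    (\<exists>e\<in>pairs Y. ind F Y = Inl ` (pairs Y - {e}))}"
  have Y_basic: "Y \<subseteq> V" "card Y = 2 * t + 1" "finite Y" "\<not> Y \<subseteq> R" "ind F Y \<subseteq> Inl ` pairs Y"
    and Y_card: "card (ind F Y) + 1 = t * card Y" if Y: "Y \<in> \<Y>" for Y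
  proof -
    obtain e where e: "Y \<subseteq> V" "card Y = 2 * t + 1" "\<not> Y \<subseteq> R" "e \<in> pairs Y" "ind F Y = Inl ` (pairs Y - {e})"
      using Y by (auto simp: \<Y>_def)
    then show "Y \<subseteq> V" "card Y = 2 * t + 1" "\<not> Y \<subseteq> R" "ind F Y \<subseteq> Inl ` pairs Y" by auto
    show fin: "finite Y" using e(1) finite_V finite_subset by blast
    have "card (ind F Y) = card (pairs Y - {e})" unfolding e(5) by (simp add: card_image)
    then have "card (ind F Y) + 1 = card (pairs Y)"
      using e(4) fin by (simp add: card_Diff_singleton) (metis One_nat_def Suc_pred card_gt_0_iff emptyE finite_pairs)
    then show "card (ind F Y) + 1 = t * card Y" using e(2) card_pairs_odd by simp
  qed
  \<comment> \<open>\<open>F\<close> has no loops inside \<open>Y\<close>, so on a part of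
    \<open>Y\<close> it induces at most a complete graph.\<close>
  have Y_sub: "2 * card (ind F (Y \<inter> Z)) \<le> card (Y \<inter> Z) * (card (Y \<inter> Z) - 1)" if Y: "Y \<in> \<Y>" for Y Z
  proof -
    have "ind F (Y \<inter> Z) \<subseteq> Inl ` pairs (Y \<inter> Z)"
    proof
      fix x assume x: "x \<in> ind F (Y \<inter> Z)"
      then have "x \<in> ind F Y" by (auto simp: induced_def)
      then obtain e where e: "x = Inl e" "e \<in> pairs Y" using Y_basic(5)[OF Y] by auto
      then show "x \<in> Inl ` pairs (Y \<inter> Z)" using x by (auto simp: pairs_def induced_def)
    qed
    then have "card (ind F (Y \<inter> Z)) \<le> card (pairs (Y \<inter> Z))"
      using Y_basic(3)[OF Y] by (metis card_image card_mono finite_Int finite_imageI finite_pairs inj_Inl)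
    then show ?thesis using card_pairs[of "Y \<inter> Z"] Y_basic(3)[OF Y] by simp
  qed
  have Y_R: "Y \<inter> R = {}" if Y: "Y \<in> \<Y>" for Y
  proof (rule ccontr)
    assume ne: "Y \<inter> R \<noteq> {}"
    define m where "m = card (Y \<inter> R)"
    have fin: "finite Y" "finite R" using Y_basic[OF Y] R(1) finite_V finite_subset by blast+
    have m: "m > 0" "m < 2 * t + 1"
      using ne fin Y_basic(2,4)[OF Y] psubset_card_mono[of Y "Y \<inter> R"] by (auto simp: m_def card_gt_0_iff)
    have "card Y + card R = card (Y \<union> R) + m" unfolding m_def by (rule card_Un_Int[OF fin])
    then have "t * card Y + t * card R = t * card (Y \<union> R) + t * m"
      by (simp add: distrib_left[symmetric])
    \<comment> \<open>The union is not inside \<open>R\<close>, hence not tight; this one unit of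
      slack makes up for the missing edge of \<open>Y\<close>.\<close>
    moreover have "card (ind F (Y \<union> R)) < t * card (Y \<union> R)"
      using R(1,3) Y_basic[OF Y] by simp
    ultimately have "t * m \<le> card (ind F (Y \<inter> R))"
      using Y_card[OF Y] R(2) card_induced_supermodular[OF finF, of ends Y R] by linarith
    then have "2 * (t * m) \<le> m * (m - 1)" using Y_sub[OF Y, of R] unfolding m_def by linarith
    then have "m * (2 * t) \<le> m * (m - 1)" by (simp only: ac_simps)
    then have "2 * t \<le> m - 1" using m(1) by simp
    then show False using m by linarith
  qed
  have Y_disj: "Y \<inter> Z = {}" if Y: "Y \<in> \<Y>" and Z: "Z \<in> \<Y>" and YZ: "Y \<noteq> Z" for Y Z
  proof (rule ccontr)
    assume ne: "Y \<inter> Z \<noteq> {}"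
    define m where "m = card (Y \<inter> Z)"
    have fin: "finite Y" "finite Z" using Y_basic[OF Y] Y_basic[OF Z] by auto
    have "\<not> Y \<subseteq> Z" using card_subset_eq[OF fin(2), of Y] Y_basic(2)[OF Y] Y_basic(2)[OF Z] YZ by auto
    then have m: "m > 0" "m < 2 * t + 1"
      using ne fin Y_basic(2)[OF Y] psubset_card_mono[of Y "Y \<inter> Z"] by (auto simp: m_def card_gt_0_iff)
    have "card Y + card Z = card (Y \<union> Z) + m" unfolding m_def by (rule card_Un_Int[OF fin])
    then have "t * card Y + t * card Z = t * card (Y \<union> Z) + t * m"
      by (simp add: distrib_left[symmetric])
    moreover have "card (ind F (Y \<union> Z)) < t * card (Y \<union> Z)"
      using R(3)[of "Y \<union> Z"] Y_basic[OF Y] Y_basic[OF Z] by simp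
    \<comment> \<open>Two missing edges stand against one unit of slack, so the bound is weaker by 1
      than for \<open>R\<close>.\<close>
    ultimately have "t * m \<le> card (ind F (Y \<inter> Z)) + 1"
      using Y_card[OF Y] Y_card[OF Z] card_induced_supermodular[OF finF, of ends Y Z] by linarith
    then have *: "2 * (t * m) \<le> m * (m - 1) + 2" using Y_sub[OF Y, of Z] unfolding m_def by linarith
    \<comment> \<open>Since \<open>m <= 2 t\<close>, the bound leaves only \<open>m = 1\<close> and
      \<open>m = 2\<close>, and both contradict \<open>t >= 2\<close>.\<close>
    have "m * (m - 1) \<le> m * (2 * t - 1)" using m by (intro mult_left_mono) auto
    then have "m * (m - 1) + m \<le> m * (2 * t - 1) + m" by simp
    also have "m * (2 * t - 1) + m = m * (2 * t - 1 + 1)" by (simp only: distrib_left mult_1_right)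
    also have "\<dots> = 2 * (t * m)" using t_pos by (simp add: ac_simps)
    finally have "m \<le> 2" using * by linarith
    then have "m = 1 \<or> m = 2" using m by linarith
    then show False using * t2 by auto
  qed
  have "\<Y> \<subseteq> Pow V" by (auto simp: \<Y>_def)
  then have fin\<Y>: "finite \<Y>" using finite_V finite_subset by blast
  define T where "T = F - (ind F R \<union> (\<Union>Y\<in>\<Y>. ind F Y))"
  have outside: "ends x \<subseteq> R \<or> (\<exists>Y\<in>\<Y>. \<exists>e. x = Inl e \<and> e \<subseteq> Y)" if x: "x \<in> ground G - T" for x
  proof (cases "x \<in> F")
    case True
    then consider "x \<in> ind F R" | Y where "Y \<in> \<Y>" "x \<in> ind F Y" using x by (auto simp: T_def)
    then show ?thesis
    proof cases
      case 2
      then show ?thesis using Y_basic(5)[OF 2(1)] by (force simp: induced_def)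
    qed (simp add: induced_def)
  next
    case False
    show ?thesis
    proof (cases "ends x \<subseteq> R")
      case nR: False
      then have sp: "sparse t G (insert x F)" using not_sparse_insertD[of F x R] F R(3) False by blast
      then have "\<not> free (insert x F)" using max x False F by blast
      then obtain Y where Y: "complete_on {e. Inl e \<in> insert x F} Y" "card Y = 2 * t + 1"
        by (auto simp: free_def)
      then have "\<not> complete_on {e. Inl e \<in> F} Y" using F by (auto simp: free_def)
      then obtain e where e: "e \<in> pairs Y" "x = Inl e" using Y(1) unfolding complete_on_iff_pairs by blast
      have sub: "Inl ` pairs Y \<subseteq> ind (insert x F) Y"
        using Y(1) unfolding complete_on_iff_pairs by (auto simp: induced_def pairs_def)
      have fin: "finite Y" using Y(2) card.infinite by fastforce
      have YV: "Y \<subseteq> V"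
      proof
        fix y assume y: "y \<in> Y"
        have "card (Y - {y}) > 0" using y fin Y(2) t_pos by simp
        then obtain z where "z \<in> Y" "z \<noteq> y" by (metis DiffE card_gt_0_iff equals0I singletonI)
        then have "Inl {y, z} \<in> insert x F"
          using sub y by (auto simp: pairs_def induced_def image_subset_iff)
        then show "y \<in> V" using card_edge[of "{y, z}"] F x by auto
      qed
      \<comment> \<open>The edges of the clique alone exhaust the sparsity bound on
        \<open>Y\<close>, so no loop lies inside \<open>Y\<close>.\<close>
      have "card (ind (insert x F) Y) \<le> card (Inl ` pairs Y :: ('v set + 'l) set)"
        using sp[unfolded sparse_def, rule_format, OF YV] Y(2) card_pairs_odd[OF Y(2)] by (simp add: card_image)
      then have eq: "ind (insert x F) Y = Inl ` pairs Y"
        using card_seteq[OF _ sub] finF by simp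
      have "ind F Y = ind (insert x F) Y - {x}" using False by (auto simp: induced_def)
      then have "ind F Y = Inl ` pairs Y - {x}" by (simp only: eq)
      then have "ind F Y = Inl ` (pairs Y - {e})" by (simp add: e(2) image_set_diff[OF inj_Inl])
      moreover have "\<not> Y \<subseteq> R" using nR e by (auto simp: pairs_def)
      ultimately have "Y \<in> \<Y>" using YV Y(2) e(1) by (auto simp: \<Y>_def)
      then show ?thesis using e by (auto simp: pairs_def)
    qed simp
  qed
  obtain y :: "nat \<Rightarrow> 'v set" where y: "bij_betw y {1..card \<Y>} \<Y>"
    using ex_bij_betw_nat_finite_1[OF fin\<Y>] by blast
  define X where "X j = (if j = 0 then R else y j)" for j
  have XY: "X j \<in> \<Y>" if "j \<in> {1..card \<Y>}" for j
    using y that by (auto simp: X_def bij_betw_def)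
  have YX: "\<exists>j\<le>card \<Y>. X j = Y" if "Y \<in> \<Y>" for Y
    using y that unfolding bij_betw_def X_def by (metis (no_types, opaque_lifting) atLeastAtMost_iff imageE not_one_le_zero)
  have cover: "is_cover (remove G T) (card \<Y>) X"
    unfolding is_cover_def
  proof (intro conjI allI impI ballI)
    fix j assume "j \<le> card \<Y>"
    then show "X j \<subseteq> verts (remove G T)"
      using XY[of j] Y_basic(1)[of "X j"] R(1) by (cases "j = 0") (auto simp: remove_def X_def)
  next
    fix e assume "e \<in> edges (remove G T)"
    then have "Inl e \<in> ground G - T" by (auto simp: remove_def ground_def)
    then have "e \<subseteq> X 0 \<or> (\<exists>Y\<in>\<Y>. e \<subseteq> Y)" using outside[of "Inl e"] by (auto simp: X_def)
    then show "\<exists>j\<le>card \<Y>. e \<subseteq> X j" using YX by (metis le0)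
  next
    fix l assume "l \<in> loops (remove G T)"
    then have "Inr l \<in> ground G - T" by (auto simp: remove_def ground_def)
    then show "\<exists>j\<le>card \<Y>. loop_at (remove G T) l \<in> X j"
      using outside[of "Inr l"] by (intro exI[of _ 0]) (auto simp: X_def remove_def)
  qed
  have "admissible_cover t G T (card \<Y>) X"
    unfolding admissible_cover_def
  proof (intro conjI cover ballI allI impI)
    fix l assume "l \<in> loops (remove G T)"
    then have "Inr l \<in> ground G - T" by (auto simp: remove_def ground_def)
    then show "loop_at G l \<in> X 0" using outside[of "Inr l"] by (auto simp: X_def)
  next
    fix l assume l: "Inr l \<in> T"
    then have "Inr l \<in> ground G" using F by (auto simp: T_def)
    then have "loop_at G l \<in> V" using ends_ground(1)[of "Inr l"] by simp
    then show "loop_at G l \<in> verts G - X 0" using l by (auto simp: T_def X_def induced_def)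
  next
    fix j assume "j \<in> {1..card \<Y>}"
    then show "card (X j) = 2 * t + 1" using XY Y_basic(2) by blast
  qed
  moreover have "non_intersecting (card \<Y>) X"
    unfolding non_intersecting_def
  proof (intro allI impI)
    fix i j assume ij: "i \<le> card \<Y>" "j \<le> card \<Y>" "i \<noteq> j"
    have "i = 0 \<or> j = 0 \<or> X i \<noteq> X j"
      using inj_on_eq_iff[OF bij_betw_imp_inj_on[OF y], of i j] ij by (auto simp: X_def)
    moreover have "X i \<in> \<Y>" if "i \<noteq> 0" using XY[of i] ij that by simp
    moreover have "X j \<in> \<Y>" if "j \<noteq> 0" using XY[of j] ij that by simp
    moreover have "X 0 = R" by (simp add: X_def)
    ultimately show "X i \<inter> X j = {}" using Y_R Y_disj ij by (metis inf_commute)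
  qed
  moreover have "int (card F) = cover_value t T (card \<Y>) X"
  proof -
    have ind_disj: "ind F A \<inter> ind F B = {}" if "A \<inter> B = {}" for A B
    proof (rule equals0I)
      fix x assume "x \<in> ind F A \<inter> ind F B"
      then have "x \<in> F" "ends x \<subseteq> A \<inter> B" by (simp_all add: induced_def)
      then have "ends x = {}" using that by simp
      then show False using ends_ground(3)[of x] F \<open>x \<in> F\<close> by blast
    qed
    have sumY: "card (\<Union>Y\<in>\<Y>. ind F Y) = (\<Sum>Y\<in>\<Y>. card (ind F Y))"
    proof (rule card_UN_disjoint[OF fin\<Y>])
      show "\<forall>Y\<in>\<Y>. finite (ind F Y)" using finF by simp
      show "\<forall>Y\<in>\<Y>. \<forall>Z\<in>\<Y>. Y \<noteq> Z \<longrightarrow> ind F Y \<inter> ind F Z = {}"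
        using ind_disj[OF Y_disj] by simp
    qed
    have "card (ind F R \<union> (\<Union>Y\<in>\<Y>. ind F Y)) = card (ind F R) + card (\<Union>Y\<in>\<Y>. ind F Y)"
    proof (rule card_Un_disjoint)
      show "finite (ind F R)" "finite (\<Union>Y\<in>\<Y>. ind F Y)" using fin\<Y> finF by simp_all
      have "ind F R \<inter> ind F Y = {}" if "Y \<in> \<Y>" for Y using Y_R[OF that] by (intro ind_disj) (simp add: Int_commute)
      then show "ind F R \<inter> (\<Union>Y\<in>\<Y>. ind F Y) = {}" by blast
    qed
    moreover have "ind F R \<union> (\<Union>Y\<in>\<Y>. ind F Y) \<subseteq> F" by (auto simp: induced_def)
    then have "card F = card T + card (ind F R \<union> (\<Union>Y\<in>\<Y>. ind F Y))"
      unfolding T_def using finF by (metis card_Diff_subset card_mono finite_subset le_add_diff_inverse2)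
    ultimately have "int (card F) = int (card T) + int t * int (card R) + (\<Sum>Y\<in>\<Y>. int (card (ind F Y)))"
      by (simp add: R(2) sumY)
    also have "(\<Sum>Y\<in>\<Y>. int (card (ind F Y))) = (\<Sum>Y\<in>\<Y>. int t * int (card Y) - 1)"
    proof (rule sum.cong[OF refl])
      fix Y assume "Y \<in> \<Y>"
      then have "int (card (ind F Y) + 1) = int (t * card Y)" using Y_card by presburger
      then show "int (card (ind F Y)) = int t * int (card Y) - 1" by simp
    qed
    also have "\<dots> = (\<Sum>j=1..card \<Y>. int t * int (card (y j)) - 1)"
      by (rule sum.reindex_bij_betw[OF y, symmetric])
    also have "\<dots> = (\<Sum>j=1..card \<Y>. int t * int (card (X j)) - 1)"
      by (intro sum.cong) (auto simp: X_def)
    finally show ?thesis by (simp add: cover_value_def X_def[of 0])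
  qed
  ultimately show ?thesis using that[of F T "card \<Y>" X] F by (auto simp: T_def free_def)
qed

end

section \<open>Generic frameworks\<close>

text \<open>Each element is determined by its restriction to a finite set of keys, and only
  countably many such sets and restrictions exist. It serves both for monomials in finitely many
  variables and for rational polynomials.\<close>

lemma countable_supported:
  assumes "countable A" "countable (UNIV :: 'b::zero set)"
  shows "countable {P :: 'a \<Rightarrow>\<^sub>0 'b. Poly_Mapping.keys P \<subseteq> A}"
proof -
  have "countable {P :: 'a \<Rightarrow>\<^sub>0 'b. Poly_Mapping.keys P \<subseteq> K}" if K: "finite K" for K
  proof (rule countable_image_inj_on)
    show "inj_on (\<lambda>P. restrict (Poly_Mapping.lookup P) K) {P :: 'a \<Rightarrow>\<^sub>0 'b. Poly_Mapping.keys P \<subseteq> K}"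
    proof (rule inj_onI)
      fix P Q :: "'a \<Rightarrow>\<^sub>0 'b"
      assume h: "P \<in> {P. Poly_Mapping.keys P \<subseteq> K}" "Q \<in> {P. Poly_Mapping.keys P \<subseteq> K}"
        "restrict (Poly_Mapping.lookup P) K = restrict (Poly_Mapping.lookup Q) K"
      show "P = Q"
      proof (rule poly_mapping_eqI)
        fix i
        show "Poly_Mapping.lookup P i = Poly_Mapping.lookup Q i"
        proof (cases "i \<in> K")
          case True
          then show ?thesis using fun_cong[OF h(3), of i] by simp
        next
          case False
          then have "i \<notin> Poly_Mapping.keys P" "i \<notin> Poly_Mapping.keys Q" using h by auto
          then show ?thesis by (simp add: in_keys_iff)
        qed
      qed
    qed
    have "countable (PiE K (\<lambda>_. UNIV :: 'b set))" using K assms(2) by (intro countable_PiE) auto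
    then show "countable ((\<lambda>P. restrict (Poly_Mapping.lookup P) K) ` {P :: 'a \<Rightarrow>\<^sub>0 'b. Poly_Mapping.keys P \<subseteq> K})"
      by (rule countable_subset[rotated]) auto
  qed
  then have "countable (\<Union>K\<in>{K. finite K \<and> K \<subseteq> A}. {P :: 'a \<Rightarrow>\<^sub>0 'b. Poly_Mapping.keys P \<subseteq> K})"
    using countable_Collect_finite_subset[OF assms(1)] by (intro countable_UN) auto
  moreover have "{P :: 'a \<Rightarrow>\<^sub>0 'b. Poly_Mapping.keys P \<subseteq> A} \<subseteq>
      (\<Union>K\<in>{K. finite K \<and> K \<subseteq> A}. {P. Poly_Mapping.keys P \<subseteq> K})"
  proof
    fix P :: "'a \<Rightarrow>\<^sub>0 'b" assume "P \<in> {P. Poly_Mapping.keys P \<subseteq> A}"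
    then show "P \<in> (\<Union>K\<in>{K. finite K \<and> K \<subseteq> A}. {P. Poly_Mapping.keys P \<subseteq> K})"
      by (intro UN_I[of "Poly_Mapping.keys P"]) simp_all
  qed
  ultimately show ?thesis by (rule countable_subset[rotated])
qed

lemma poly_value_superset:
  assumes "finite M" "Poly_Mapping.keys P \<subseteq> M"
  shows "poly_value x P = (\<Sum>m\<in>M. of_rat (Poly_Mapping.lookup P m) *
    (\<Prod>i\<in>Poly_Mapping.keys m. x i ^ Poly_Mapping.lookup m i))"
  unfolding poly_value_def using assms by (intro sum.mono_neutral_left) (auto simp: in_keys_iff)

text \<open>As a function of one coordinate, the value is a real polynomial whose coefficients are values of
  polynomials in the other coordinates; the latter do not all vanish.\<close>

lemma finite_zeros_coordinate:
  fixes P :: "('i \<Rightarrow>\<^sub>0 nat) \<Rightarrow>\<^sub>0 rat"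
  assumes x: "alg_independent_on J x" and P: "P \<noteq> 0"
    and keys: "\<forall>m\<in>Poly_Mapping.keys P. Poly_Mapping.keys m \<subseteq> insert c J" and c: "c \<notin> J"
  shows "finite {r. poly_value (x(c := r)) P = 0}"
proof -
  define mon where "mon m = (\<Prod>i\<in>Poly_Mapping.keys m - {c}. x i ^ Poly_Mapping.lookup m i)"
    for m :: "'i \<Rightarrow>\<^sub>0 nat"
  define Q where "Q = (\<Sum>m\<in>Poly_Mapping.keys P.
    Polynomial.monom (of_rat (Poly_Mapping.lookup P m) * mon m) (Poly_Mapping.lookup m c))"
  have prod_c: "(\<Prod>i\<in>Poly_Mapping.keys m. (x(c := r)) i ^ Poly_Mapping.lookup m i) =
      mon m * r ^ Poly_Mapping.lookup m c" for m r
  proof -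
    have "(\<Prod>i\<in>Poly_Mapping.keys m - {c}. (x(c := r)) i ^ Poly_Mapping.lookup m i) = mon m"
      unfolding mon_def by (intro prod.cong) auto
    moreover have "Poly_Mapping.keys m - {c} = Poly_Mapping.keys m" "Poly_Mapping.lookup m c = 0"
      if "c \<notin> Poly_Mapping.keys m" using that by (auto simp: in_keys_iff)
    ultimately show ?thesis
      by (cases "c \<in> Poly_Mapping.keys m") (simp_all add: prod.remove[of "Poly_Mapping.keys m" c])
  qed
  have val_eq: "poly_value (x(c := r)) P = poly Q r" for r
    unfolding poly_value_def Q_def poly_sum poly_monom prod_c by (simp add: mult_ac)
  obtain m\<^sub>0 where m\<^sub>0: "m\<^sub>0 \<in> Poly_Mapping.keys P" using P by (metis ex_in_conv keys_eq_empty)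
  \<comment> \<open>\<open>k\<close> is the exponent of the variable \<open>c\<close> in some
    monomial of \<open>P\<close>. Below, \<open>R\<close> is the part of \<open>P\<close> of degree
    \<open>k\<close> in \<open>c\<close> with that power removed, and its value is the coefficient
    of \<open>Q\<close> at \<open>k\<close>.\<close>
  define k where "k = Poly_Mapping.lookup m\<^sub>0 c"
  define strip where "strip m = m - Poly_Mapping.single c k" for m :: "'i \<Rightarrow>\<^sub>0 nat"
  define M where "M = {m\<in>Poly_Mapping.keys P. Poly_Mapping.lookup m c = k}"
  have finM: "finite M" by (simp add: M_def)
  have strip: "strip m + Poly_Mapping.single c k = m" "Poly_Mapping.keys (strip m) = Poly_Mapping.keys m - {c}"
    if "m \<in> M" for m
  proof -
    have lk: "Poly_Mapping.lookup (strip m) i = (if i = c then 0 else Poly_Mapping.lookup m i)" for i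
      using that by (auto simp: strip_def M_def lookup_minus lookup_single when_def)
    show "strip m + Poly_Mapping.single c k = m"
      using that by (intro poly_mapping_eqI) (auto simp: lookup_add lk lookup_single when_def M_def)
    show "Poly_Mapping.keys (strip m) = Poly_Mapping.keys m - {c}"
      by (auto simp: in_keys_iff lk split: if_splits)
  qed
  have inj: "inj_on strip M" by (metis inj_onI strip(1))
  define R where "R = (\<Sum>m\<in>M. Poly_Mapping.single (strip m) (Poly_Mapping.lookup P m))"
  have lookup_R: "Poly_Mapping.lookup R (strip m) = Poly_Mapping.lookup P m" if "m \<in> M" for m
  proof -
    have "Poly_Mapping.lookup R (strip m) =
        (\<Sum>m'\<in>M. if m' = m then Poly_Mapping.lookup P m' else 0)"
      unfolding R_def lookup_sum lookup_single when_def
      using inj that by (intro sum.cong) (auto simp: inj_on_eq_iff)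
    then show ?thesis using finM that by simp
  qed
  have keys_R: "Poly_Mapping.keys R \<subseteq> strip ` M"
    unfolding R_def by (rule order_trans[OF keys_sum]) auto
  have "m\<^sub>0 \<in> M" using m\<^sub>0 by (simp add: M_def k_def)
  then have "R \<noteq> 0" using lookup_R[of m\<^sub>0] m\<^sub>0 by (auto simp: in_keys_iff)
  moreover have "\<forall>m\<in>Poly_Mapping.keys R. Poly_Mapping.keys m \<subseteq> J"
  proof
    fix m assume "m \<in> Poly_Mapping.keys R"
    then obtain m' where m': "m' \<in> M" "m = strip m'" using keys_R by auto
    then have "m' \<in> Poly_Mapping.keys P" by (simp add: M_def)
    then show "Poly_Mapping.keys m \<subseteq> J" using keys strip(2)[OF m'(1)] m'(2) by auto
  qed
  ultimately have "poly_value x R \<noteq> 0" using x by (simp add: alg_independent_on_def)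
  moreover have "poly_value x R = Polynomial.coeff Q k"
  proof -
    have mon: "(\<Prod>i\<in>Poly_Mapping.keys (strip m). x i ^ Poly_Mapping.lookup (strip m) i) = mon m"
      if "m \<in> M" for m
      unfolding mon_def strip(2)[OF that]
      by (intro prod.cong) (auto simp: strip_def lookup_minus lookup_single when_def)
    have "poly_value x R = (\<Sum>m\<in>strip ` M. of_rat (Poly_Mapping.lookup R m) *
        (\<Prod>i\<in>Poly_Mapping.keys m. x i ^ Poly_Mapping.lookup m i))"
      by (rule poly_value_superset) (use finM keys_R in auto)
    also have "\<dots> = (\<Sum>m\<in>M. of_rat (Poly_Mapping.lookup P m) * mon m)"
      by (subst sum.reindex[OF inj]) (auto intro!: sum.cong simp: lookup_R mon)
    also have "\<dots> = Polynomial.coeff Q k"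
      unfolding Q_def coeff_sum M_def by (subst sum.inter_filter) (auto intro!: sum.cong)
    finally show ?thesis .
  qed
  ultimately have "Q \<noteq> 0" by auto
  then show ?thesis unfolding val_eq by (rule poly_roots_finite)
qed

text \<open>Each of the countably many nonzero rational polynomials excludes only finitely many
  values of the new coordinate.\<close>

lemma countable_algebraic_coordinates:
  fixes x :: "'i \<Rightarrow> real"
  assumes "alg_independent_on J x" "finite J" "c \<notin> J"
  shows "countable {r. \<not> alg_independent_on (insert c J) (x(c := r))}"
proof -
  define \<P> where "\<P> = {P :: ('i \<Rightarrow>\<^sub>0 nat) \<Rightarrow>\<^sub>0 rat.
    Poly_Mapping.keys P \<subseteq> {m. Poly_Mapping.keys m \<subseteq> insert c J}}"
  have "countable \<P>"
    unfolding \<P>_def using assms(2) by (intro countable_supported) (auto intro: countable_finite)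
  then have "countable (\<Union>P\<in>\<P> - {0}. {r. poly_value (x(c := r)) P = 0})"
    using finite_zeros_coordinate[OF assms(1) _ _ assms(3)]
    by (intro countable_UN) (auto simp: \<P>_def intro!: countable_finite)
  moreover have "{r. \<not> alg_independent_on (insert c J) (x(c := r))} \<subseteq>
      (\<Union>P\<in>\<P> - {0}. {r. poly_value (x(c := r)) P = 0})"
    unfolding alg_independent_on_def \<P>_def by blast
  ultimately show ?thesis by (rule countable_subset[rotated])
qed

lemma alg_independent_on_empty: "alg_independent_on {} x"
  unfolding alg_independent_on_def
proof (intro allI impI)
  fix P :: "('a \<Rightarrow>\<^sub>0 nat) \<Rightarrow>\<^sub>0 rat"
  assume P: "P \<noteq> 0" "\<forall>m\<in>Poly_Mapping.keys P. Poly_Mapping.keys m \<subseteq> {}"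
  then have "Poly_Mapping.keys P \<subseteq> {0}" by auto
  then have "poly_value x P = of_rat (Poly_Mapping.lookup P 0)"
    by (subst poly_value_superset[of "{0}"]) auto
  moreover have "Poly_Mapping.keys P \<noteq> {}" using P(1) by simp
  then have "0 \<in> Poly_Mapping.keys P" using \<open>Poly_Mapping.keys P \<subseteq> {0}\<close> by blast
  ultimately show "poly_value x P \<noteq> 0" by (simp add: in_keys_iff)
qed

section \<open>Independence at some position and at a generic one\<close>

lemma lookup_rigidity_row:
  assumes "\<And>e. x = Inl e \<Longrightarrow> finite e"
  shows "Poly_Mapping.lookup (rigidity_row G p q x) w = frow (loop_at G) p q x w"
proof (cases x)
  case (Inl e)
  then have fin: "finite e" using assms by simp
  have "(\<Sum>u\<in>e. \<Sum>v\<in>e. if u = w then p u - p v else 0) = (\<Sum>u\<in>e. if u = w then \<Sum>v\<in>e. p w - p v else 0)"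
    by (intro sum.cong) auto
  then show ?thesis using Inl fin
    by (simp add: rigidity_row_def lookup_sum lookup_single when_def edge_vec_def)
qed (auto simp: rigidity_row_def lookup_single when_def)

lemma indep_on_rigidity_rows:
  fixes p :: "'v \<Rightarrow> real^'d"
  assumes H: "looped_simple_graph H" and F: "F \<subseteq> ground H"
  shows "indep_on (verts H) F (frow (loop_at H) p q) \<longleftrightarrow>
    inj_on (rigidity_row H p q) F \<and> independent (rigidity_row H p q ` F)"
proof -
  interpret looped_graph_context H 1 using H by unfold_locales auto
  have finF: "finite F" using F finite_ground finite_subset by blast
  have fin: "finite e" if "x \<in> F" "x = Inl e" for x e
    using card_edge[of e] F that finite_V finite_subset by blast
  have lk: "Poly_Mapping.lookup (rigidity_row H p q x) w = frow (loop_at H) p q x w" if "x \<in> F" for x w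
    using fin[OF that] by (rule lookup_rigidity_row)
  have "indep_on (verts H) F (frow (loop_at H) p q) \<longleftrightarrow>
      indep_on (verts H) F (\<lambda>x. Poly_Mapping.lookup (rigidity_row H p q x))"
    by (rule indep_on_cong) (simp add: lk)
  also have "\<dots> \<longleftrightarrow> inj_on (rigidity_row H p q) F \<and> independent (rigidity_row H p q ` F)"
  proof (rule indep_on_Poly_Mapping[OF finF])
    fix x assume x: "x \<in> F"
    have "w \<in> verts H" if "frow (loop_at H) p q x w \<noteq> 0" for w
      using that x F ends_ground(1)[of x] by (cases x) (auto simp: edge_vec_def split: if_splits)
    then show "Poly_Mapping.keys (rigidity_row H p q x) \<subseteq> verts H"
      by (auto simp: in_keys_iff lk[OF x])
  qed
  finally show ?thesis .
qed

lemma frow_add_scaleR: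
  "frow lv p\<^sub>0 q\<^sub>0 r w + s *\<^sub>R frow lv p\<^sub>1 q\<^sub>1 r w =
   frow lv (\<lambda>x. p\<^sub>0 x + s *\<^sub>R p\<^sub>1 x) (\<lambda>x. q\<^sub>0 x + s *\<^sub>R q\<^sub>1 x) r w"
  by (cases r) (simp_all add: edge_vec_def scaleR_sum_right sum.distrib[symmetric] algebra_simps)

text \<open>The coordinates are moved one at a time: for all but countably many new values the coordinates
  moved so far stay algebraically independent, and for all but finitely many the rows stay
  independent.\<close>

lemma lc_independentI:
  fixes H :: "('v, 'l) looped_graph" and p :: "'v \<Rightarrow> real^'d"
  assumes H: "looped_simple_graph H" and F: "F \<subseteq> ground H"
    and ind: "indep_on (verts H) F (frow (loop_at H) p q)"
  shows "lc_independent TYPE('d) H F"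
proof -
  interpret looped_graph_context H 1 using H by unfold_locales auto
  have finF: "finite F" using F finite_ground finite_subset by blast
  define rows where "rows x = frow (loop_at H) (\<lambda>v. \<chi> i. x (Inl v, i) :: real^'d) (\<lambda>l. \<chi> i. x (Inr l, i))"
    for x
  have "\<exists>x. alg_independent_on J x \<and> indep_on (verts H) F (rows x)" if "finite J" for J
    using that
  proof (induction J rule: finite_induct)
    case empty
    have "rows (\<lambda>(a, i). case_sum p q a $ i) = frow (loop_at H) p q"
      by (simp add: rows_def)
    then show ?case using ind alg_independent_on_empty by metis
  next
    case (insert c J)
    then obtain x where x: "alg_independent_on J x" "indep_on (verts H) F (rows x)" by blast
    \<comment> \<open>The unit vector of coordinate \<open>c\<close>. Rows are linear in the
      coordinates, so changing this one moves them along a line.\<close>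
    define \<delta> where "\<delta> = (\<lambda>y. if y = c then 1 else 0 :: real)"
    have "rows (x(c := r)) s w = rows x s w + (r - x c) *\<^sub>R rows \<delta> s w" for r s w
    proof -
      have "x(c := r) = (\<lambda>y. x y + (r - x c) * \<delta> y)" by (auto simp: \<delta>_def)
      then show ?thesis unfolding rows_def frow_add_scaleR
        by (simp add: vec_eq_iff plus_vec_def scaleR_vec_def)
    qed
    then have eq: "rows (x(c := r)) = (\<lambda>s w. rows x s w + (r - x c) *\<^sub>R rows \<delta> s w)" for r
      by (intro ext)
    have "finite {s. \<not> indep_on (verts H) F (\<lambda>r w. rows x r w + s *\<^sub>R rows \<delta> r w)}"
      by (rule finite_dependent_on_line[OF finF x(2)])
    then have "finite ((\<lambda>s. s + x c) ` {s. \<not> indep_on (verts H) F (\<lambda>r w. rows x r w + s *\<^sub>R rows \<delta> r w)})"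
      by (rule finite_imageI)
    moreover have "{r. \<not> indep_on (verts H) F (rows (x(c := r)))} \<subseteq>
        (\<lambda>s. s + x c) ` {s. \<not> indep_on (verts H) F (\<lambda>r w. rows x r w + s *\<^sub>R rows \<delta> r w)}"
    proof
      fix r assume "r \<in> {r. \<not> indep_on (verts H) F (rows (x(c := r)))}"
      then show "r \<in> (\<lambda>s. s + x c) ` {s. \<not> indep_on (verts H) F (\<lambda>r w. rows x r w + s *\<^sub>R rows \<delta> r w)}"
        unfolding eq by (intro image_eqI[of _ _ "r - x c"]) auto
    qed
    ultimately have "countable {r. \<not> indep_on (verts H) F (rows (x(c := r)))}"
      by (meson countable_finite finite_subset)
    then have "countable ({r. \<not> alg_independent_on (insert c J) (x(c := r))} \<union>
        {r. \<not> indep_on (verts H) F (rows (x(c := r)))})"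
      using countable_algebraic_coordinates[OF x(1) insert.hyps(1,2)] by simp
    then have "{r. \<not> alg_independent_on (insert c J) (x(c := r))} \<union>
        {r. \<not> indep_on (verts H) F (rows (x(c := r)))} \<noteq> UNIV"
      using uncountable_UNIV_real by metis
    then show ?case by blast
  qed
  moreover have "finite ((verts H <+> loops H) \<times> (UNIV :: 'd set))"
    using H by (simp add: looped_simple_graph_def)
  ultimately obtain x where x: "alg_independent_on ((verts H <+> loops H) \<times> (UNIV :: 'd set)) x"
    "indep_on (verts H) F (rows x)" by blast
  define p' :: "'v \<Rightarrow> real^'d" where "p' = (\<lambda>v. \<chi> i. x (Inl v, i))"
  define q' :: "'l \<Rightarrow> real^'d" where "q' = (\<lambda>l. \<chi> i. x (Inr l, i))"
  have "(\<lambda>(a, i). case_sum p' q' a $ i) = x"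
    by (auto simp: p'_def q'_def fun_eq_iff split: sum.splits)
  then have "generic H p' q'" using x(1) by (simp add: generic_def)
  moreover have "indep_on (verts H) F (frow (loop_at H) p' q')"
    using x(2) by (simp add: rows_def p'_def q'_def)
  ultimately show ?thesis
    unfolding lc_independent_def indep_on_rigidity_rows[OF H F] using F by blast
qed

lemma lc_independentD:
  assumes "looped_simple_graph H" "lc_independent TYPE('d::finite) H F"
  obtains p :: "'v \<Rightarrow> real^'d" and q where "F \<subseteq> ground H" "indep_on (verts H) F (frow (loop_at H) p q)"
  using assms(2) that indep_on_rigidity_rows[OF assms(1)] unfolding lc_independent_def by metis

section \<open>The rank formula\<close>

text \<open>Rows that vanish outside the columns of \<open>X\<close> live in a space spanned by
  \<open>d * card X\<close> unit vectors.\<close>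

lemma indep_on_card_le:
  fixes f :: "'r \<Rightarrow> 'w \<Rightarrow> real^'d"
  assumes "indep_on U F f" "finite F" "finite X"
    and zero: "\<And>r w. r \<in> F \<Longrightarrow> w \<in> U \<Longrightarrow> w \<notin> X \<Longrightarrow> f r w = 0"
  shows "card F \<le> CARD('d) * card X"
proof -
  define g where "g r = (\<Sum>w\<in>X. Poly_Mapping.single w (f r w))" for r
  define S where "S = (\<lambda>(w, i). Poly_Mapping.single w (axis i 1 :: real^'d)) ` (X \<times> UNIV)"
  have lg: "Poly_Mapping.lookup (g r) w = (if w \<in> X then f r w else 0)" for r w
    using assms(3) by (simp add: g_def lookup_sum lookup_single when_def)
  have "indep_on U F (\<lambda>r. Poly_Mapping.lookup (g r))"
    using assms(1) zero by (subst indep_on_cong[of _ _ _ f]) (auto simp: lg)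
  then have "indep_on (U \<union> X) F (\<lambda>r. Poly_Mapping.lookup (g r))"
    unfolding indep_on_def by blast
  moreover have "Poly_Mapping.keys (g r) \<subseteq> U \<union> X" for r
    by (auto simp: in_keys_iff lg split: if_splits)
  ultimately have "inj_on g F \<and> independent (g ` F)"
    using indep_on_Poly_Mapping[OF assms(2), of g "U \<union> X"] by blast
  moreover have "g ` F \<subseteq> span S"
  proof
    fix x assume "x \<in> g ` F"
    then obtain r where x: "x = g r" by auto
    have "Poly_Mapping.single w y \<in> span S" if w: "w \<in> X" for w and y :: "real^'d"
    proof -
      have "Poly_Mapping.single w y = (\<Sum>i\<in>UNIV. (y $ i) *\<^sub>R Poly_Mapping.single w (axis i 1))"
      proof (rule poly_mapping_eqI)
        fix w'
        have "(\<Sum>i\<in>UNIV. (y $ i) *\<^sub>R (axis i 1 :: real^'d)) = y"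
          using basis_expansion[of y] by (simp add: scalar_mult_eq_scaleR)
        then show "Poly_Mapping.lookup (Poly_Mapping.single w y) w' =
            Poly_Mapping.lookup (\<Sum>i\<in>UNIV. (y $ i) *\<^sub>R Poly_Mapping.single w (axis i 1)) w'"
          by (cases "w = w'") (simp_all add: lookup_sum lookup_scaleR lookup_single when_def)
      qed
      moreover have "Poly_Mapping.single w (axis i 1 :: real^'d) \<in> S" for i
        unfolding S_def using w by (intro image_eqI[of _ _ "(w, i)"]) auto
      ultimately show ?thesis by (simp only:) (intro span_sum span_scale span_base)
    qed
    then show "x \<in> span S" unfolding x g_def by (intro span_sum)
  qed
  moreover have "finite S" using assms(3) by (simp add: S_def)
  ultimately have "card (g ` F) \<le> card S" using independent_span_bound by blast
  also have "\<dots> \<le> card (X \<times> (UNIV :: 'd set))"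
    unfolding S_def using assms(3) by (intro card_image_le) auto
  finally show ?thesis
    using \<open>inj_on g F \<and> independent (g ` F)\<close> by (simp add: card_image card_cartesian_product mult.commute)
qed

text \<open>An affine dependence with coefficients \<open>\<lambda>\<close> between the \<open>d + 2\<close> points gives the self-stress
  \<open>\<lambda> x * \<lambda> y\<close> of the complete graph.\<close>

lemma complete_graph_dependent:
  fixes p :: "'v \<Rightarrow> real^'d"
  assumes X: "card X = CARD('d) + 2"
  shows "\<not> indep_on U (pairs X) (edge_vec p)"
proof
  assume ind: "indep_on U (pairs X) (edge_vec p)"
  have finX: "finite X" using X by (metis card.infinite add_is_0 zero_neq_numeral)
  \<comment> \<open>Appending 1 turns affine dependences into linear ones: here \<open>d + 2\<close>
    vectors in dimension \<open>d + 1\<close>.\<close>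
  define f where "f x = (p x, 1 :: real)" for x
  have "\<not> (inj_on f X \<and> independent (f ` X))"
  proof
    assume h: "inj_on f X \<and> independent (f ` X)"
    then have "card (f ` X) \<le> DIM((real^'d) \<times> real)" using independent_bound by blast
    then show False using h X by (simp add: card_image)
  qed
  then obtain c x where c: "(\<Sum>x\<in>X. c x *\<^sub>R f x) = 0" and x: "x \<in> X" "c x \<noteq> 0"
    unfolding inj_on_and_independent_iff[OF finX] by blast
  have c1: "(\<Sum>x\<in>X. c x) = 0" and cp: "(\<Sum>x\<in>X. c x *\<^sub>R p x) = 0"
    using arg_cong[OF c, of fst] arg_cong[OF c, of snd] by (simp_all add: f_def fst_sum snd_sum)
  \<comment> \<open>The coefficients sum to 0, so a second one is nonzero, and the edge
    \<open>{x, y}\<close> then carries nonzero stress.\<close>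
  obtain y where y: "y \<in> X" "y \<noteq> x" "c y \<noteq> 0"
  proof (rule ccontr)
    assume "\<not> thesis"
    then have "c y = 0" if "y \<in> X - {x}" for y using that \<open>\<And>y. y \<in> X \<Longrightarrow> y \<noteq> x \<Longrightarrow> c y \<noteq> 0 \<Longrightarrow> thesis\<close> by blast
    then have "(\<Sum>x\<in>X. c x) = c x" using finX x by (simp add: sum.remove[of X x])
    then show False using c1 x by simp
  qed
  have "prod c {x, y} = 0"
  proof (rule indep_onD[OF ind, of "prod c"])
    fix w
    show "(\<Sum>e\<in>pairs X. prod c e *\<^sub>R edge_vec p e w) = 0"
    proof (cases "w \<in> X")
      case False
      then show ?thesis by (intro sum.neutral) (auto simp: edge_vec_def pairs_def)
    next
      case True
      have bij: "bij_betw (\<lambda>x. {w, x}) (X - {w}) {e\<in>pairs X. w \<in> e}"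
        unfolding bij_betw_def
      proof
        show "inj_on (\<lambda>x. {w, x}) (X - {w})" by (auto simp: inj_on_def doubleton_eq_iff)
        show "(\<lambda>x. {w, x}) ` (X - {w}) = {e\<in>pairs X. w \<in> e}"
        proof
          show "{e\<in>pairs X. w \<in> e} \<subseteq> (\<lambda>x. {w, x}) ` (X - {w})"
          proof
            fix e assume e: "e \<in> {e\<in>pairs X. w \<in> e}"
            then have "card e = 2" "w \<in> e" by (auto simp: pairs_def)
            then obtain u where "u \<noteq> w" "e = {w, u}" by (rule card2_other)
            then show "e \<in> (\<lambda>x. {w, x}) ` (X - {w})" using e by (auto simp: pairs_def)
          qed
        qed (use True in \<open>auto simp: pairs_def\<close>)
      qed
      have "(\<Sum>e\<in>pairs X. prod c e *\<^sub>R edge_vec p e w) = (\<Sum>e\<in>{e\<in>pairs X. w \<in> e}. prod c e *\<^sub>R edge_vec p e w)"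
        using finX by (intro sum_edge_vec_incident[symmetric]) simp
      also have "\<dots> = (\<Sum>x\<in>X - {w}. prod c {w, x} *\<^sub>R edge_vec p {w, x} w)"
        by (rule sum.reindex_bij_betw[OF bij, symmetric])
      also have "\<dots> = (\<Sum>x\<in>X - {w}. (c w * c x) *\<^sub>R (p w - p x))"
        by (intro sum.cong) (auto simp: edge_vec_pair)
      also have "\<dots> = (\<Sum>x\<in>X. (c w * c x) *\<^sub>R (p w - p x))"
        using finX by (intro sum.mono_neutral_left) auto
      also have "\<dots> = c w *\<^sub>R ((\<Sum>x\<in>X. c x) *\<^sub>R p w - (\<Sum>x\<in>X. c x *\<^sub>R p x))"
        by (simp add: scaleR_sum_left scaleR_sum_right sum_subtractf[symmetric] scaleR_diff_right)
      finally show ?thesis by (simp add: c1 cp)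
    qed
  qed (use x y in \<open>auto simp: pairs_def\<close>)
  then show False using x y by simp
qed

lemma looped_simple_graph_add_loops: "looped_simple_graph G \<Longrightarrow> looped_simple_graph (add_loops s G)"
  by (auto simp: looped_simple_graph_def add_loops_def)

text \<open>Rows inside \<open>X 0\<close>, added loops included, number at most
  \<open>d * card (X 0)\<close>, and each vertex off \<open>X 0\<close> has \<open>d - t\<close>
  added loops; together this is \<open>(d - t) * card V + t * card (X 0)\<close>. Every other
  \<open>X j\<close> has \<open>d + 2\<close> vertices, so one of its \<open>t * card (X j)\<close>
  pairs must be missing. For \<open>k = 0\<close> the condition on these members is vacuous, so one
  bound serves both ranges of \<open>d\<close>.\<close>

lemma card_lc_independent_le:
  fixes G :: "('v, 'l) looped_graph"
  assumes G: "looped_simple_graph G" and t: "t > 0" "t \<le> CARD('d)"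
    and H: "lc_independent TYPE('d::finite) (add_loops (CARD('d) - t) G) H"
    and T: "T \<subseteq> ground G" and cover: "is_cover (remove G T) k X"
    and loops: "\<And>l. l \<in> loops (remove G T) \<Longrightarrow> loop_at G l \<in> X 0"
    and cardX: "\<And>j. j \<in> {1..k} \<Longrightarrow> CARD('d) = 2 * t - 1 \<and> card (X j) = 2 * t + 1"
  shows "int (card H) \<le> int (CARD('d) - t) * int (card (verts G)) + cover_value t T k X"
proof -
  interpret looped_graph_context G t using G t by unfold_locales
  let ?s = "CARD('d) - t"
  let ?G = "add_loops ?s G"
  obtain p :: "'v \<Rightarrow> real^'d" and q where HG: "H \<subseteq> ground ?G" and ind: "indep_on V H (frow (loop_at ?G) p q)"
    using lc_independentD[OF looped_simple_graph_add_loops[OF G] H] by (metis add_loops_def looped_graph.select_convs(1))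
  interpret G': looped_graph_context ?G t
    using looped_simple_graph_add_loops[OF G] t by unfold_locales
  have finH: "finite H" using HG G'.finite_ground finite_subset by blast
  have XV: "X j \<subseteq> V" if "j \<le> k" for j using cover that by (auto simp: is_cover_def remove_def)
  have finX0: "finite (X 0)" using XV[of 0] finite_V finite_subset by blast
  define \<tau> :: "'v set + 'l \<Rightarrow> 'v set + ('l + 'v \<times> nat)" where "\<tau> = map_sum id Inl"
  define B where "B = {x\<in>H. graph_ends ?G x \<subseteq> X 0}"
  define C where "C = (\<lambda>x. Inr (Inr x) :: 'v set + ('l + 'v \<times> nat)) ` ((V - X 0) \<times> {..<?s})"
  define D where "D j = H \<inter> Inl ` pairs (X j)" for j
  have "H \<subseteq> \<tau> ` T \<union> B \<union> C \<union> (\<Union>j\<in>{1..k}. D j)"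
  proof
    fix x assume x: "x \<in> H"
    then have xG: "x \<in> ground ?G" using HG by blast
    show "x \<in> \<tau> ` T \<union> B \<union> C \<union> (\<Union>j\<in>{1..k}. D j)"
    proof (cases x)
      case (Inl e)
      then have e: "e \<in> edges G" using xG by (auto simp: ground_def add_loops_def)
      show ?thesis
      proof (cases "Inl e \<in> T")
        case True
        then show ?thesis unfolding Inl \<tau>_def by force
      next
        case False
        then have "e \<in> edges (remove G T)" using e by (simp add: remove_def)
        then obtain j where j: "j \<le> k" "e \<subseteq> X j" using cover by (auto simp: is_cover_def)
        show ?thesis
        proof (cases "j = 0")
          case True
          then show ?thesis using j x Inl by (auto simp: B_def)
        next
          case False
          have "card e = 2" using e G by (auto simp: looped_simple_graph_def)
          then have "x \<in> D j" using j x Inl by (auto simp: D_def pairs_def)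
          then show ?thesis using False j by (intro UnI2 UN_I[of j]) auto
        qed
      qed
    next
      case (Inr y)
      show ?thesis
      proof (cases y)
        case (Inl l)
        then have l: "l \<in> loops G" using xG \<open>x = Inr y\<close> by (auto simp: ground_def add_loops_def)
        show ?thesis
        proof (cases "Inr l \<in> T")
          case True
          then show ?thesis unfolding \<open>x = Inr y\<close> Inl \<tau>_def by force
        next
          case False
          then have "loop_at G l \<in> X 0" using loops l by (simp add: remove_def)
          then have "x \<in> B" using x \<open>x = Inr y\<close> Inl by (simp add: B_def add_loops_def)
          then show ?thesis by simp
        qed
      next
        case (Inr z)
        obtain v j where z: "z = (v, j)" by force
        then have vj: "v \<in> V" "j < ?s" using xG \<open>x = Inr y\<close> Inr by (auto simp: ground_def add_loops_def)
        show ?thesis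
        proof (cases "v \<in> X 0")
          case True
          then have "x \<in> B" using x \<open>x = Inr y\<close> Inr z by (simp add: B_def add_loops_def)
          then show ?thesis by simp
        next
          case False
          then have "x \<in> C" using vj \<open>x = Inr y\<close> Inr z by (auto simp: C_def)
          then show ?thesis by simp
        qed
      qed
    qed
  qed
  moreover have finT: "finite T" using T finite_ground finite_subset by blast
  moreover have "finite B" "finite C" "finite (D j)" for j using finH finite_V by (auto simp: B_def C_def D_def)
  ultimately have "card H \<le> card (\<tau> ` T \<union> B \<union> C \<union> (\<Union>j\<in>{1..k}. D j))"
    by (intro card_mono) auto
  also have "\<dots> \<le> card (\<tau> ` T \<union> B \<union> C) + card (\<Union>j\<in>{1..k}. D j)" by (rule card_Un_le)
  also have "\<dots> \<le> card (\<tau> ` T \<union> B) + card C + card (\<Union>j\<in>{1..k}. D j)" by (intro add_mono card_Un_le) simp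
  also have "\<dots> \<le> card (\<tau> ` T) + card B + card C + card (\<Union>j\<in>{1..k}. D j)" by (intro add_mono card_Un_le) simp_all
  also have "\<dots> \<le> card T + card B + card C + (\<Sum>j=1..k. card (D j))"
    by (intro add_mono card_UN_le card_image_le finT) simp_all
  finally have le: "card H \<le> card T + card B + card C + (\<Sum>j=1..k. card (D j))" .
  have indB: "indep_on V B (frow (loop_at ?G) p q)"
    by (rule indep_on_mono[OF ind _ finH]) (auto simp: B_def)
  have zeroB: "frow (loop_at ?G) p q r w = 0" if "r \<in> B" "w \<in> V" "w \<notin> X 0" for r w
    using that by (cases r) (auto simp: B_def edge_vec_def)
  have B: "card B \<le> CARD('d) * card (X 0)"
    by (rule indep_on_card_le[OF indB _ finX0 zeroB]) (use finH in \<open>simp_all add: B_def\<close>)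
  have C: "card C = ?s * (card V - card (X 0))"
    unfolding C_def using finX0 finite_V XV[of 0]
    by (subst card_image) (auto simp: inj_on_def card_cartesian_product card_Diff_subset mult.commute)
  have D: "int (card (D j)) \<le> int t * int (card (X j)) - 1" if j: "j \<in> {1..k}" for j
  proof -
    have "finite (X j)" using XV[of j] j finite_V finite_subset by auto
    have "D j \<noteq> Inl ` pairs (X j)"
    proof
      assume "D j = Inl ` pairs (X j)"
      then have "Inl ` pairs (X j) \<subseteq> H" by (auto simp: D_def)
      then have "indep_on V (Inl ` pairs (X j)) (frow (loop_at ?G) p q)"
        using indep_on_mono[OF ind _ finH] by blast
      then have "indep_on V (pairs (X j)) (edge_vec p)" by (subst (asm) indep_on_reindex) auto
      moreover have "card (X j) = CARD('d) + 2" using cardX[OF j] t(1) by linarith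
      ultimately show False using complete_graph_dependent[of "X j" V p] by blast
    qed
    then have "D j \<subset> Inl ` pairs (X j)" by (auto simp: D_def)
    then have "card (D j) < card (Inl ` pairs (X j) :: ('v set + ('l + 'v \<times> nat)) set)"
      using \<open>finite (X j)\<close> by (intro psubset_card_mono) auto
    also have "\<dots> = t * card (X j)"
      using card_pairs_odd[of "X j" t] cardX[OF j] by (simp add: card_image)
    finally have "int (card (D j)) < int (t * card (X j))" by (simp only: of_nat_less_iff)
    then show ?thesis by simp
  qed
  have "int (card H) \<le> int (card T + card B + card C + (\<Sum>j=1..k. card (D j)))"
    using le by (simp only: of_nat_le_iff)
  also have "\<dots> \<le> int (card T) + int (CARD('d) * card (X 0)) + int (?s * (card V - card (X 0))) +
      (\<Sum>j=1..k. int t * int (card (X j)) - 1)"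
  proof -
    have "(\<Sum>j=1..k. int (card (D j))) \<le> (\<Sum>j=1..k. int t * int (card (X j)) - 1)"
      by (rule sum_mono[OF D])
    moreover have "int (card B) \<le> int (CARD('d) * card (X 0))" using B by (simp only: of_nat_le_iff)
    ultimately show ?thesis unfolding C[symmetric] of_nat_add of_nat_sum by linarith
  qed
  finally have bound: "int (card H) \<le> int (card T) + int (CARD('d) * card (X 0)) +
      int (?s * (card V - card (X 0))) + (\<Sum>j=1..k. int t * int (card (X j)) - 1)" .
  have "int (CARD('d) * card (X 0)) + int (?s * (card V - card (X 0))) = int ?s * int (card V) + int t * int (card (X 0))"
  proof -
    have "card (X 0) \<le> card V" using XV[of 0] finite_V by (intro card_mono) auto
    then obtain m where m: "card V = card (X 0) + m" using le_Suc_ex by blast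
    obtain s where s: "CARD('d) = t + s" using t(2) le_Suc_ex by blast
    show ?thesis unfolding m s by (simp add: algebra_simps)
  qed
  then show ?thesis unfolding cover_value_def using bound by linarith
qed

text \<open>A loop of \<open>F\<close> can only be assigned to its own vertex, so the edges received
  by a vertex and the loops of \<open>F\<close> there number at most \<open>t\<close> in total. The
  \<open>d - indegree\<close> loops supplied by the realisation therefore suffice for the loops of
  \<open>F\<close> and the \<open>d - t\<close> added ones.\<close>

lemma lc_independent_extension:
  fixes G :: "('v, 'l) looped_graph"
  assumes G: "looped_simple_graph G" and t: "t > 0" "t \<le> CARD('d::finite)"
    and F: "F \<subseteq> ground G" "sparse t G F"
    and dim: "2 * t \<le> CARD('d) \<or> CARD('d) = 2 * t - 1 \<and> 2 \<le> t \<and>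
      (\<forall>X. complete_on {e. Inl e \<in> F} X \<longrightarrow> card X \<noteq> 2 * t + 1)"
  obtains H where "lc_independent TYPE('d) (add_loops (CARD('d) - t) G) H"
    "card H = (CARD('d) - t) * card (verts G) + card F"
proof -
  interpret looped_graph_context G t using G t by unfold_locales
  let ?s = "CARD('d) - t"
  let ?G = "add_loops ?s G"
  have finF: "finite F" using F(1) finite_ground finite_subset by blast
  define E where "E = {e. Inl e \<in> F}"
  define LF where "LF = {l. Inr l \<in> F}"
  have F_eq: "F = E <+> LF"
  proof (rule set_eqI)
    fix x show "x \<in> F \<longleftrightarrow> x \<in> E <+> LF" by (cases x) (auto simp: E_def LF_def)
  qed
  have fin: "finite E" "finite LF" using finF unfolding F_eq by (simp_all add: finite_Plus_iff)
  have endsF: "ends x \<subseteq> V \<and> (\<exists>u v. ends x = {u, v})" if "x \<in> F" for x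
    using ends_ground[of x] F(1) that by blast
  have "\<exists>\<sigma>. (\<forall>x\<in>F. \<sigma> x \<in> ends x) \<and> (\<forall>v. card {x\<in>F. \<sigma> x = v} \<le> t)"
    by (rule orientation_exists[OF finF finite_V endsF]) (use F(2) in \<open>simp_all add: sparse_def mult.commute\<close>)
  then obtain \<sigma> where \<sigma>: "\<And>x. x \<in> F \<Longrightarrow> \<sigma> x \<in> ends x" "\<And>v. card {x\<in>F. \<sigma> x = v} \<le> t" by blast
  have split: "{x\<in>F. \<sigma> x = v} = {e\<in>E. \<sigma> (Inl e) = v} <+> {l\<in>LF. loop_at G l = v}" for v
  proof (rule set_eqI)
    fix x show "x \<in> {x\<in>F. \<sigma> x = v} \<longleftrightarrow> x \<in> {e\<in>E. \<sigma> (Inl e) = v} <+> {l\<in>LF. loop_at G l = v}"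
      using \<sigma>(1)[of x] by (cases x) (auto simp: E_def LF_def)
  qed
  have count: "card {e\<in>E. \<sigma> (Inl e) = v} + card {l\<in>LF. loop_at G l = v} \<le> t" for v
    using \<sigma>(2)[of v] fin unfolding split by (simp add: card_Plus)
  define n where "n u = CARD('d) - card {e\<in>E. \<sigma> (Inl e) = u}" for u
  obtain p :: "'v \<Rightarrow> real^'d" and q where pq: "indep_on V (E <+> Sigma V (\<lambda>u. {..<n u})) (frow fst p q)"
  proof (rule independent_framework_exists[OF finite_V fin(1), of "\<lambda>e. \<sigma> (Inl e)" t])
    fix e assume "e \<in> E"
    then have e: "Inl e \<in> F" by (simp add: E_def)
    then show "card e = 2" "\<sigma> (Inl e) \<in> e \<inter> V" using card_edge[of e] F(1) \<sigma>(1)[OF e] by auto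
  next
    fix u show "card {e\<in>E. \<sigma> (Inl e) = u} \<le> t" using count[of u] by simp
  qed (use dim in \<open>auto simp: n_def E_def\<close>)
  define L where "L = LF <+> V \<times> {..<?s}"
  define lv where "lv = (case_sum (loop_at G) fst :: 'l + 'v \<times> nat \<Rightarrow> 'v)"
  have lv: "loop_at ?G = lv" by (simp add: add_loops_def lv_def)
  have "\<forall>v\<in>V. \<exists>g. g ` {l\<in>L. lv l = v} \<subseteq> {..<n v} \<and> inj_on g {l\<in>L. lv l = v}"
  proof (intro ballI card_le_inj)
    fix v assume v: "v \<in> V"
    have "{l\<in>L. lv l = v} = {l\<in>LF. loop_at G l = v} <+> {v} \<times> {..<?s}"
      using v by (auto simp: L_def lv_def)
    then have "card {l\<in>L. lv l = v} = card {l\<in>LF. loop_at G l = v} + ?s"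
      using fin by (simp add: card_Plus card_cartesian_product)
    then show "card {l\<in>L. lv l = v} \<le> card {..<n v}" using count[of v] t(2) by (simp add: n_def)
  qed (use fin finite_V in \<open>auto simp: L_def\<close>)
  from bchoice[OF this] obtain g where
    "\<forall>v\<in>V. g v ` {l\<in>L. lv l = v} \<subseteq> {..<n v} \<and> inj_on (g v) {l\<in>L. lv l = v}" by blast
  then have g: "\<And>v. v \<in> V \<Longrightarrow> g v ` {l\<in>L. lv l = v} \<subseteq> {..<n v}"
    "\<And>v. v \<in> V \<Longrightarrow> inj_on (g v) {l\<in>L. lv l = v}" by auto
  have lvV: "lv l \<in> V" if "l \<in> L" for l
    using that F(1) G by (auto simp: L_def lv_def LF_def ground_def looped_simple_graph_def)
  define \<rho> where "\<rho> = map_sum (id :: 'v set \<Rightarrow> _) (\<lambda>l. (lv l, g (lv l) l))"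
  define H where "H = E <+> L"
  have finH: "finite H" using fin finite_V by (auto simp: H_def L_def)
  have "inj_on \<rho> H"
  proof (rule inj_onI)
    fix x y assume xy: "x \<in> H" "y \<in> H" "\<rho> x = \<rho> y"
    show "x = y"
    proof (cases x)
      case (Inl e)
      then show ?thesis using xy by (cases y) (auto simp: \<rho>_def)
    next
      case (Inr l)
      then obtain l' where l': "y = Inr l'" using xy by (cases y) (auto simp: \<rho>_def)
      then have "l \<in> L" "l' \<in> L" "lv l = lv l'" "g (lv l) l = g (lv l) l'"
        using xy Inr by (auto simp: H_def \<rho>_def)
      then have "l = l'" using inj_onD[OF g(2)[OF lvV, of l]] by auto
      then show ?thesis using Inr l' by simp
    qed
  qed
  moreover have "\<rho> ` H \<subseteq> E <+> Sigma V (\<lambda>u. {..<n u})"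
  proof (rule image_subsetI)
    fix x assume x: "x \<in> H"
    show "\<rho> x \<in> E <+> Sigma V (\<lambda>u. {..<n u})"
    proof (cases x)
      case (Inl e)
      then show ?thesis using x by (auto simp: H_def \<rho>_def)
    next
      case (Inr l)
      then have l: "l \<in> L" using x by (auto simp: H_def)
      then have "g (lv l) l \<in> {..<n (lv l)}" using g(1)[OF lvV[OF l]] by blast
      then show ?thesis using Inr lvV[OF l] by (simp add: \<rho>_def InrI)
    qed
  qed
  moreover have "finite (E <+> Sigma V (\<lambda>u. {..<n u}))" using fin finite_V by auto
  ultimately have "indep_on V H (\<lambda>r. frow fst p q (\<rho> r))"
    using indep_on_mono[OF pq] indep_on_reindex by metis
  moreover have "frow fst p q (\<rho> r) w = frow lv p (\<lambda>l. q (lv l, g (lv l) l)) r w" for r w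
    by (cases r) (auto simp: \<rho>_def)
  then have "(\<lambda>r. frow fst p q (\<rho> r)) = frow lv p (\<lambda>l. q (lv l, g (lv l) l))" by (intro ext)
  ultimately have "indep_on (verts ?G) H (frow (loop_at ?G) p (\<lambda>l. q (lv l, g (lv l) l)))"
    unfolding lv by (simp add: add_loops_def)
  moreover have "H \<subseteq> ground ?G"
    using F(1) by (auto simp: H_def L_def E_def LF_def ground_def add_loops_def)
  ultimately have "lc_independent TYPE('d) ?G H"
    by (intro lc_independentI looped_simple_graph_add_loops G)
  moreover have "card H = ?s * card V + card F"
    unfolding H_def L_def F_eq using fin finite_V by (simp add: card_Plus card_cartesian_product)
  ultimately show ?thesis by (rule that)
qed

text \<open>\<open>upper\<close> is weak duality; the pair \<open>H\<close>, \<open>x\<close>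
  attains equality, so it realises both the maximum and the minimum.\<close>

lemma lc_rank_eq_Min:
  fixes \<S> :: "int set"
  assumes G: "looped_simple_graph G" and fin: "finite \<S>"
    and upper: "\<And>y F. y \<in> \<S> \<Longrightarrow> lc_independent TYPE('d::finite) G F \<Longrightarrow> int (card F) \<le> c + y"
    and H: "lc_independent TYPE('d) G H" "int (card H) = c + x" "x \<in> \<S>"
  shows "int (lc_rank TYPE('d) G) = c + Min \<S>"
proof -
  interpret looped_graph_context G 1 using G by unfold_locales auto
  have "{card F | F. lc_independent TYPE('d) G F} \<subseteq> {..card (ground G)}"
    using finite_ground by (auto simp: lc_independent_def intro: card_mono)
  then have "finite {card F | F. lc_independent TYPE('d) G F}" by (rule finite_subset) simp
  then have "lc_rank TYPE('d) G = card H"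
    unfolding lc_rank_def
  proof (rule Max_eqI)
    fix y assume "y \<in> {card F | F. lc_independent TYPE('d) G F}"
    then obtain F where F: "y = card F" "lc_independent TYPE('d) G F" by blast
    show "y \<le> card H" using upper[OF H(3) F(2)] H(2) F(1) by simp
  qed (use H(1) in blast)
  moreover have "Min \<S> = x" using fin upper[OF _ H(1)] H(2,3) by (intro Min_eqI) auto
  ultimately show ?thesis using H(2) by simp
qed

text \<open>Disjoint nonempty members have distinct representatives. This bounds \<open>k\<close>,
  as finiteness of the set of values requires.\<close>

lemma non_intersecting_card_le:
  assumes "finite V" "non_intersecting k X" "\<And>j. j \<in> {1..k} \<Longrightarrow> X j \<subseteq> V \<and> X j \<noteq> {}"
  shows "k \<le> card V"
proof -
  have "\<forall>j\<in>{1..k}. \<exists>x. x \<in> X j" using assms(3) by blast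
  then obtain f where f: "\<And>j. j \<in> {1..k} \<Longrightarrow> f j \<in> X j" by metis
  have "inj_on f {1..k}"
  proof (rule inj_onI, rule ccontr)
    fix i j assume ij: "i \<in> {1..k}" "j \<in> {1..k}" "f i = f j" "i \<noteq> j"
    then have "X i \<inter> X j = {}" using assms(2) by (auto simp: non_intersecting_def)
    then show False using f[of i] f[of j] ij by auto
  qed
  moreover have "f ` {1..k} \<subseteq> V" using f assms(3) by blast
  ultimately have "card {1..k} \<le> card V" using assms(1) by (rule card_inj_on_le)
  then show ?thesis by simp
qed

text \<open>\<open>Min\<close> calls for a finite set, but the functions \<open>X\<close> are
  arbitrary beyond \<open>k\<close>. The value depends only on \<open>card T\<close>,
  \<open>card (X 0)\<close> and \<open>k\<close>, which are all bounded.\<close>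

lemma finite_cover_values:
  fixes G :: "('v, 'l) looped_graph"
  assumes G: "looped_simple_graph G"
  shows "finite {cover_value t T k X | T k X. T \<subseteq> ground G \<and> k \<le> card (verts G) \<and>
    X 0 \<subseteq> verts G \<and> (\<forall>j\<in>{1..k}. card (X j) = 2 * t + 1)}"
proof -
  interpret looped_graph_context G 1 using G by unfold_locales auto
  let ?f = "\<lambda>(a, b, k). int a + int t * int b + int k * (int t * int (2 * t + 1) - 1)"
  have "{cover_value t T k X | T k X. T \<subseteq> ground G \<and> k \<le> card V \<and> X 0 \<subseteq> V \<and>
      (\<forall>j\<in>{1..k}. card (X j) = 2 * t + 1)} \<subseteq> ?f ` ({..card (ground G)} \<times> {..card V} \<times> {..card V})"
  proof
    fix y assume "y \<in> {cover_value t T k X | T k X. T \<subseteq> ground G \<and> k \<le> card V \<and> X 0 \<subseteq> V \<and>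
      (\<forall>j\<in>{1..k}. card (X j) = 2 * t + 1)}"
    then obtain T k X where y: "y = cover_value t T k X" and T: "T \<subseteq> ground G" and k: "k \<le> card V"
      and X: "X 0 \<subseteq> V" "\<And>j. j \<in> {1..k} \<Longrightarrow> card (X j) = 2 * t + 1" by blast
    have "(\<Sum>j=1..k. int t * int (card (X j)) - 1) = (\<Sum>j=1..k. int t * int (2 * t + 1) - 1)"
      using X(2) by (intro sum.cong) auto
    then have "y = ?f (card T, card (X 0), k)" unfolding y cover_value_def by simp
    moreover have "card T \<le> card (ground G)" "card (X 0) \<le> card V"
      using T X(1) finite_ground finite_V by (auto intro: card_mono)
    ultimately show "y \<in> ?f ` ({..card (ground G)} \<times> {..card V} \<times> {..card V})"
      using k by (intro image_eqI[of _ _ "(card T, card (X 0), k)"]) auto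
  qed
  then show ?thesis by (rule finite_subset) simp
qed

theorem theorem3p10:
  fixes G :: "('v, 'l) looped_graph" and t :: nat
  assumes "looped_simple_graph G"
    and "t > 0"
    and "CARD('d::finite) \<ge> 2"
    and "CARD('d) \<ge> 2 * t - 1"
  shows "(CARD('d) = 2 * t - 1 \<longrightarrow>
           int (lc_rank TYPE('d) (add_loops (CARD('d) - t) G)) =
             int (CARD('d) - t) * int (card (verts G)) +
             Min {cover_value t T k X | T k X.
                    T \<subseteq> ground G \<and> admissible_cover t G T k X \<and> non_intersecting k X}) \<and>
         (CARD('d) \<ge> 2 * t \<longrightarrow>
           int (lc_rank TYPE('d) (add_loops (CARD('d) - t) G)) =
             int (CARD('d) - t) * int (card (verts G)) +
             Min {cover_value t T 0 X | T X. T \<subseteq> ground G \<and> is_cover (remove G T) 0 X})"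
proof -
  interpret looped_graph_context G t using assms by unfold_locales
  have t_le: "t \<le> CARD('d)" using assms by linarith
  note G' = looped_simple_graph_add_loops[OF assms(1), of "CARD('d) - t"]
  have sub0: "X j \<subseteq> V" if "is_cover (remove G T) k X" "j \<le> k" for T k X j
    using that by (auto simp: is_cover_def remove_def)
  show ?thesis
  proof (intro conjI impI)
    assume d: "CARD('d) = 2 * t - 1"
    \<comment> \<open>This is where \<open>d >= 2\<close> enters: \<open>t = 1\<close> would mean
      \<open>d = 1\<close>.\<close>
    then have t2: "2 \<le> t" using assms(3) by linarith
    obtain F T k X where F: "F \<subseteq> ground G" "sparse t G F"
      "\<And>X. complete_on {e. Inl e \<in> F} X \<Longrightarrow> card X \<noteq> 2 * t + 1"
      and X: "T \<subseteq> ground G" "admissible_cover t G T k X" "non_intersecting k X"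
        "int (card F) = cover_value t T k X"
      using clique_free_sparse_cover_exists[OF t2] by metis
    obtain H where H: "lc_independent TYPE('d) (add_loops (CARD('d) - t) G) H"
      "card H = (CARD('d) - t) * card V + card F"
      using lc_independent_extension[OF assms(1,2) t_le F(1,2)] d t2 F(3) by blast
    show "int (lc_rank TYPE('d) (add_loops (CARD('d) - t) G)) = int (CARD('d) - t) * int (card V) +
        Min {cover_value t T k X | T k X. T \<subseteq> ground G \<and> admissible_cover t G T k X \<and> non_intersecting k X}"
    proof (rule lc_rank_eq_Min[OF G' _ _ H(1)])
      have "k \<le> card V \<and> X 0 \<subseteq> V \<and> (\<forall>j\<in>{1..k}. card (X j) = 2 * t + 1)"
        if "admissible_cover t G T k X" "non_intersecting k X" for T k X
      proof -
        have c: "is_cover (remove G T) k X" "\<forall>j\<in>{1..k}. card (X j) = 2 * t + 1"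
          using that(1) by (simp_all add: admissible_cover_def)
        have "X j \<subseteq> V \<and> X j \<noteq> {}" if j: "j \<in> {1..k}" for j
        proof -
          have "card (X j) = 2 * t + 1" using c(2) j by blast
          then show ?thesis using sub0[OF c(1), of j] j by auto
        qed
        then show ?thesis using c sub0[of T k X 0] non_intersecting_card_le[OF finite_V that(2)] by simp
      qed
      then show "finite {cover_value t T k X | T k X. T \<subseteq> ground G \<and> admissible_cover t G T k X \<and> non_intersecting k X}"
        by (intro finite_subset[OF _ finite_cover_values[OF assms(1), of t]]) blast
      show "int (card H) = int (CARD('d) - t) * int (card V) + cover_value t T k X"
        unfolding H(2) X(4)[symmetric] by simp
      show "cover_value t T k X \<in> {cover_value t T k X | T k X.
          T \<subseteq> ground G \<and> admissible_cover t G T k X \<and> non_intersecting k X}"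
        using X by blast
      fix y F
      assume "y \<in> {cover_value t T k X | T k X. T \<subseteq> ground G \<and> admissible_cover t G T k X \<and> non_intersecting k X}"
        and F: "lc_independent TYPE('d) (add_loops (CARD('d) - t) G) F"
      then obtain T k X where y: "y = cover_value t T k X" "T \<subseteq> ground G" "admissible_cover t G T k X" by blast
      show "int (card F) \<le> int (CARD('d) - t) * int (card V) + y"
        unfolding y(1) using y(3) d
        by (intro card_lc_independent_le[OF assms(1,2) t_le F y(2)]) (auto simp: admissible_cover_def)
    qed
  next
    assume d: "CARD('d) \<ge> 2 * t"
    obtain F T X where F: "F \<subseteq> ground G" "sparse t G F"
      and X: "T \<subseteq> ground G" "is_cover (remove G T) 0 X" "int (card F) = cover_value t T 0 X"
      using sparse_cover_exists by metis
    obtain H where H: "lc_independent TYPE('d) (add_loops (CARD('d) - t) G) H"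
      "card H = (CARD('d) - t) * card V + card F"
      using lc_independent_extension[OF assms(1,2) t_le F] d by blast
    show "int (lc_rank TYPE('d) (add_loops (CARD('d) - t) G)) = int (CARD('d) - t) * int (card V) +
        Min {cover_value t T 0 X | T X. T \<subseteq> ground G \<and> is_cover (remove G T) 0 X}"
    proof (rule lc_rank_eq_Min[OF G' _ _ H(1)])
      have "{cover_value t T 0 X | T X. T \<subseteq> ground G \<and> is_cover (remove G T) 0 X} \<subseteq>
          {cover_value t T k X | T k X. T \<subseteq> ground G \<and> k \<le> card V \<and> X 0 \<subseteq> V \<and>
            (\<forall>j\<in>{1..k}. card (X j) = 2 * t + 1)}"
        using sub0[of _ 0] by fastforce
      then show "finite {cover_value t T 0 X | T X. T \<subseteq> ground G \<and> is_cover (remove G T) 0 X}"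
        by (rule finite_subset[OF _ finite_cover_values[OF assms(1)]])
      show "int (card H) = int (CARD('d) - t) * int (card V) + cover_value t T 0 X"
        unfolding H(2) X(3)[symmetric] by simp
      show "cover_value t T 0 X \<in> {cover_value t T 0 X | T X. T \<subseteq> ground G \<and> is_cover (remove G T) 0 X}"
        using X by blast
      fix y F
      assume "y \<in> {cover_value t T 0 X | T X. T \<subseteq> ground G \<and> is_cover (remove G T) 0 X}"
        and F: "lc_independent TYPE('d) (add_loops (CARD('d) - t) G) F"
      then obtain T X where y: "y = cover_value t T 0 X" "T \<subseteq> ground G" "is_cover (remove G T) 0 X" by blast
      show "int (card F) \<le> int (CARD('d) - t) * int (card V) + y"
        unfolding y(1) using y(3)
        by (intro card_lc_independent_le[OF assms(1,2) t_le F y(2)]) (auto simp: is_cover_def remove_def)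
    qed
  qed
qed

end
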